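(* Fix an integer $m\ge 1$. For each integer $n$ such that either $2\le m\le n$, or $m=1$ and $n\ge 3$, let $\nu_{m,n}$ be the unique quasistationary distribution of the Invasion Model on the complete bipartite graph $K_{m,n}$, and let $\bar\nu_{m,n}$ be the probability measure on $\{0,\dots,m\}\times[0,1]$ that is the law, under $\nu_{m,n}$, of the pair (number of opinions $1$ in $\mathcal S$, proportion of opinions $1$ in $\mathcal L$). Then, as $n\to\infty$, $\bar\nu_{m,n}$ converges in distribution to the probability measure $\bar\nu_\infty$ on $\{0,\dots,m\}\times[0,1]$ given by $$\bar\nu_{\infty}(k,dx)=\binom{m}{k}x^k(1-x)^{m-k}\,dx,\qquad k\in\{0,\dots,m\},\ x\in[0,1],$$ where $dx$ is Lebesgue measure. In particular, under $\bar\nu_\infty$: 1. each of the two marginals is uniform (the first on $\{0,\dots,m\}$, the second on $[0,1]$); 2. the conditional distribution of the first coordinate given that the second equals $x$ is the binomial distribution $\mathrm{Bin}(m,x)$; 3. the conditional distribution of the second coordinate given that the first equals $k$ is the Beta distribution $\mathrm{Beta}(k+1,m-k+1)$.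
   Context: Complete bipartite graph: $K_{m,n}$ has vertex set $V=\mathcal S\sqcup\mathcal L$ with $|\mathcal S|=m$, $|\mathcal L|=n$, and its edges are all pairs consisting of one element of $\mathcal S$ and one element of $\mathcal L$. Invasion Model on a finite connected loopless graph $G=(V,E)$: the discrete-time Markov chain $(\eta_t)_{t\in\mathbb Z_+}$ on $\Omega=\{0,1\}^V$ with the following step. Independently of the past, sample a vertex $v\in V$ uniformly, then, given $v$, sample a neighbor $u$ of $v$ uniformly; set $\eta_{t+1}(u)=\eta_t(v)$ and $\eta_{t+1}(w)=\eta_t(w)$ for all $w\ne u$. The value $\eta(v)\in\{0,1\}$ is called the opinion of $v$ ($1$ means "yes"). The set $\Delta\subset\Omega$ of the two constant functions is the absorbing set, and $\tau=\inf\{t\in\mathbb Z_+:\eta_t\in\Delta\}$. Quasistationary distribution (QSD): a probability measure $\nu$ on $\Omega-\Delta$ such that $P_\nu(\eta_1\in\cdot\mid\tau>1)=\nu(\cdot)$, where $P_\nu$ is the law of the chain with initial distribution $\nu$. For $m,n$ as in the claim, the Invasion Model on $K_{m,n}$ has a unique QSD, $\nu_{m,n}$. Explicitly, for $k\in\{0,\dots,m\}$ and $l\in\{0,\dots,n\}$ put $\nu_{m,n}(k,l)=\nu_{m,n}\big(\{\eta:\sum_{u\in\mathcal S}\eta(u)=k,\ \sum_{u\in\mathcal L}\eta(u)=l\}\big)$ (equal to $0$ for $(k,l)\in\{(0,0),(m,n)\}$). Then $\bar\nu_{m,n}$ is determined by $$\int f\,d\bar\nu_{m,n}=\sum_{k=0}^m\sum_{l=0}^n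 f(k,l/n)\,\nu_{m,n}(k,l)$$ for all continuous $f:\{0,\dots,m\}\times[0,1]\to\mathbb R$. *)

theory Defs
  imports "HOL-Probability.Probability" "Graph_Theory.Graph_Theory"
begin

section \<open>The Invasion Model\<close>

text \<open>
  An undirected simple graph is a symmetric, loop-free \<^typ>\<open>'a pair_pre_digraph\<close>: both
  orientations of every edge are in \<^const>\<open>parcs\<close>. Configurations are extensional functions
  on the vertex set, so that the configuration space is finite when the graph is.
\<close>

definition neighbours :: "'a pair_pre_digraph \<Rightarrow> 'a \<Rightarrow> 'a set" where
  "neighbours G v = {u. (v, u) \<in> parcs G}"

definition configs :: "'a pair_pre_digraph \<Rightarrow> ('a \<Rightarrow> nat) set" where
  "configs G = pverts G \<rightarrow>\<^sub>E {0, 1}"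

definition consensus :: "'a pair_pre_digraph \<Rightarrow> ('a \<Rightarrow> nat) set" where
  "consensus G = (\<lambda>c. \<lambda>v\<in>pverts G. c) ` {0, 1}"

definition sample_pair :: "'a pair_pre_digraph \<Rightarrow> ('a \<times> 'a) pmf" where
  "sample_pair G =
     pmf_of_set (pverts G) \<bind> (\<lambda>v. pmf_of_set (neighbours G v) \<bind> (\<lambda>u. return_pmf (v, u)))"

fun invade :: "'a \<times> 'a \<Rightarrow> ('a \<Rightarrow> nat) \<Rightarrow> ('a \<Rightarrow> nat)" where
  "invade (v, u) \<eta> = \<eta>(u := \<eta> v)"

text \<open>
  The chain is realised on the product of the initial configuration and an independent
  i.i.d. sequence of sampled pairs \<open>(v, u)\<close>, one for each time step.
\<close>

definition invasion_space ::
  "'a pair_pre_digraph \<Rightarrow> ('a \<Rightarrow> nat) measure \<Rightarrow> (('a \<Rightarrow> nat) \<times> ('a \<times> 'a) stream) measure" where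
  "invasion_space G \<nu> = \<nu> \<Otimes>\<^sub>M stream_space (measure_pmf (sample_pair G))"

primrec invasion :: "nat \<Rightarrow> ('a \<Rightarrow> nat) \<times> ('a \<times> 'a) stream \<Rightarrow> ('a \<Rightarrow> nat)" where
  "invasion 0 \<omega> = fst \<omega>"
| "invasion (Suc t) \<omega> = invade (snd \<omega> !! t) (invasion t \<omega>)"

definition absorption_time ::
  "'a pair_pre_digraph \<Rightarrow> ('a \<Rightarrow> nat) \<times> ('a \<times> 'a) stream \<Rightarrow> enat" where
  "absorption_time G \<omega> = (INF t\<in>{t. invasion t \<omega> \<in> consensus G}. enat t)"

text \<open>
  \<^const>\<open>cond_prob\<close> is \<open>0\<close> when conditioning on a null event, so the last condition
  (with \<open>A\<close> the whole space) forces \<open>\<tau> > 1\<close> to have positive probability.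
\<close>

definition quasistationary :: "'a pair_pre_digraph \<Rightarrow> ('a \<Rightarrow> nat) measure \<Rightarrow> bool" where
  "quasistationary G \<nu> \<longleftrightarrow>
     prob_space \<nu> \<and>
     sets \<nu> = sets (count_space (configs G - consensus G)) \<and>
     (\<forall>A \<subseteq> configs G - consensus G.
        \<P>(\<omega> in invasion_space G \<nu>. invasion 1 \<omega> \<in> A \<bar> absorption_time G \<omega> > 1) = measure \<nu> A)"


section \<open>Complete bipartite graphs\<close>

definition part_S :: "nat \<Rightarrow> (nat + nat) set" where
  "part_S m = Inl ` {..<m}"

definition part_L :: "nat \<Rightarrow> (nat + nat) set" where
  "part_L n = Inr ` {..<n}"

definition complete_bipartite :: "nat \<Rightarrow> nat \<Rightarrow> (nat + nat) pair_pre_digraph" where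
  "complete_bipartite m n =
     \<lparr> pverts = part_S m \<union> part_L n,
       parcs = part_S m \<times> part_L n \<union> part_L n \<times> part_S m \<rparr>"

lemma complete_bipartite_is_complete_bipartite_digraph:
  "complete_bipartite_digraph m n (with_proj (complete_bipartite m n))"
  unfolding complete_bipartite_digraph_pair_def
proof (intro conjI exI)
  show "finite (pverts (complete_bipartite m n))"
    by (simp add: complete_bipartite_def part_S_def part_L_def)
  show "pverts (complete_bipartite m n) = part_S m \<union> part_L n"
    "parcs (complete_bipartite m n) = part_S m \<times> part_L n \<union> part_L n \<times> part_S m"
    by (simp_all add: complete_bipartite_def)
  show "part_S m \<inter> part_L n = {}" by (auto simp: part_S_def part_L_def)
  show "card (part_S m) = m" "card (part_L n) = n"
    by (simp_all add: part_S_def part_L_def card_image)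
qed


section \<open>Laws on \<open>{0..m} \<times> [0,1]\<close>\<close>

definition count_proportion_space :: "nat \<Rightarrow> (nat \<times> real) measure" where
  "count_proportion_space m = count_space {0..m} \<Otimes>\<^sub>M restrict_space borel {0..1}"

definition count_proportion_law ::
  "nat \<Rightarrow> nat \<Rightarrow> (nat + nat \<Rightarrow> nat) measure \<Rightarrow> (nat \<times> real) measure" where
  "count_proportion_law m n \<nu> =
     distr \<nu> (count_proportion_space m)
       (\<lambda>\<eta>. (\<Sum>u\<in>part_S m. \<eta> u, real (\<Sum>u\<in>part_L n. \<eta> u) / real n))"

definition limit_law :: "nat \<Rightarrow> (nat \<times> real) measure" where
  "limit_law m =
     density (count_space {0..m} \<Otimes>\<^sub>M restrict_space lborel {0..1})
       (\<lambda>(k, x). ennreal (real (m choose k) * x ^ k * (1 - x) ^ (m - k)))"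


section \<open>General notions of probability\<close>

definition converges_in_distribution_on ::
  "'a::topological_space set \<Rightarrow> (nat \<Rightarrow> 'a measure) \<Rightarrow> 'a measure \<Rightarrow> bool" where
  "converges_in_distribution_on E M N \<longleftrightarrow>
     (\<forall>f :: 'a \<Rightarrow> real. continuous_on E f \<longrightarrow> bounded (f ` E) \<longrightarrow>
        (\<lambda>n. \<integral>x. f x \<partial>M n) \<longlonglongrightarrow> (\<integral>x. f x \<partial>N))"

text \<open>
  \<open>\<kappa>\<close> is a (regular) conditional distribution of \<open>X\<close> given \<open>Y\<close> under \<open>M\<close>, where \<open>X\<close> and
  \<open>Y\<close> take values in the measurable spaces \<open>NX\<close> and \<open>NY\<close>.
\<close>

definition conditional_distribution ::
  "'w measure \<Rightarrow> 'x measure \<Rightarrow> ('w \<Rightarrow> 'x) \<Rightarrow> 'y measure \<Rightarrow> ('w \<Rightarrow> 'y) \<Rightarrow>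
     ('y \<Rightarrow> 'x measure) \<Rightarrow> bool" where
  "conditional_distribution M NX X NY Y \<kappa> \<longleftrightarrow>
     X \<in> measurable M NX \<and> Y \<in> measurable M NY \<and> \<kappa> \<in> measurable NY (prob_algebra NX) \<and>
     (\<forall>A\<in>sets NX. \<forall>B\<in>sets NY.
        emeasure M {\<omega>\<in>space M. X \<omega> \<in> A \<and> Y \<omega> \<in> B} =
        (\<integral>\<^sup>+y\<in>B. emeasure (\<kappa> y) A \<partial>distr M NY Y))"

definition beta_distribution :: "real \<Rightarrow> real \<Rightarrow> real measure" where
  "beta_distribution a b =
     density lborel
       (\<lambda>x. ennreal (x powr (a - 1) * (1 - x) powr (b - 1) / Beta a b * indicator {0<..<1} x))"

end

theory Submission
  imports Defs
begin

text \<open>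
  Under the counting map a quasistationary distribution becomes a law of \<open>(k, l)\<close> with
  \<open>E (L g) = - \<lambda> E g\<close> for all \<open>g\<close> vanishing at the two absorbing states, where \<open>L\<close> is the generator.
  A quadratic test function, positive off the absorbing states, shows that \<open>n\<^sup>2 \<lambda>\<close> is bounded.
  The coordinate \<open>k\<close> equilibrates fast: testing with binomial coefficients in \<open>k\<close> times powers of
  \<open>x = l / n\<close> yields, asymptotically, the factorial moments of \<open>Bin(m, x)\<close> given \<open>x\<close>. Testing with
  powers of the martingale \<open>M / (m\<^sup>2 + n\<^sup>2)\<close>, \<open>M = m k + n l\<close>, gives \<open>n\<^sup>2 \<lambda> / m \<rightarrow> 2\<close> and the moment
  recursion of the adjoint Wright-Fisher equation \<open>(x (1 - x) \<rho>)'' = - 2 \<rho>\<close>, which only mixtures of the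
  uniform law with atoms at 0 and 1 satisfy. Atoms are excluded by testing with \<open>sqrt M\<close>, since
  \<open>- L (sqrt M)\<close> is at least of order \<open>(1 - x) / sqrt M\<close>. Hence the moments of \<open>x\<close> converge to those
  of the uniform law.
\<close>

section \<open>Laws of counts invariant up to a killing rate\<close>

text \<open>Two time scales shape the proof. For fixed \<open>m\<close> the count \<open>k\<close>
  is refreshed at rates of order \<open>n\<close>, while \<open>x\<close> moves by steps
  \<open>1 / n\<close> at rates of order 1, hence diffuses on the time scale \<open>n^2\<close>. The
  limiting equation alone does not determine the law: atoms at 0 and 1 are invisible to the
  differences of moments that the martingale tests control. The test with \<open>sqrt M\<close>
  supplies the missing information. Since \<open>M\<close> is about \<open>n^2 x\<close>, it
  imitates \<open>x (1 - x) (sqrt x)'' = - (1 - x) / (4 sqrt x)\<close>; the mean of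
  \<open>- L (sqrt M)\<close> is at most \<open>lam\<close> times a quantity of order
  \<open>n\<close>, so in effect the mean of \<open>(1 - x) / sqrt x\<close> stays bounded as
  \<open>n\<close> grows. \<open>M\<close> stands in for \<open>n^2 x\<close> because its drift
  vanishes exactly and because states with \<open>l = 0 < k\<close> are not absorbed. Relations
  among moments are carried as null sequences instead of passing to subsequences, so that no
  convergence of \<open>lam\<close> has to be known beforehand.\<close>

definition mean :: "nat \<Rightarrow> nat \<Rightarrow> (nat \<Rightarrow> nat \<Rightarrow> real) \<Rightarrow> (real \<Rightarrow> real \<Rightarrow> real) \<Rightarrow> real" where
  "mean m n p \<phi> = (\<Sum>k\<le>m. \<Sum>l\<le>n. p k l * \<phi> (real k) (real l))"

text \<open>
  The counts of ones \<open>(k, l)\<close> in the two parts form a Markov chain, whose transition operator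
  \<open>P\<close> satisfies \<open>generator g = (m + n) (P g - g)\<close>. Real arguments avoid truncated
  subtraction; jumps out of the grid have rate zero.
\<close>

definition generator :: "nat \<Rightarrow> nat \<Rightarrow> (real \<Rightarrow> real \<Rightarrow> real) \<Rightarrow> real \<Rightarrow> real \<Rightarrow> real" where
  "generator m n g k l =
     k * (real n - l) / real n * (g k (l + 1) - g k l) +
     (real m - k) * l / real n * (g k (l - 1) - g k l) +
     l * (real m - k) / real m * (g (k + 1) l - g k l) +
     (real n - l) * k / real m * (g (k - 1) l - g k l)"

text \<open>The degree-weighted proportion of ones, a martingale of the chain.\<close>

definition degree_weight :: "nat \<Rightarrow> nat \<Rightarrow> real \<Rightarrow> real \<Rightarrow> real" where
  "degree_weight m n k l = (real m * k + real n * l) / (real m ^ 2 + real n ^ 2)"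

text \<open>The number of edges whose ends disagree. Each of them moves \<open>l\<close> at rate
  \<open>1 / n\<close> and \<open>k\<close> at rate \<open>1 / m\<close>.\<close>

definition discordance :: "nat \<Rightarrow> nat \<Rightarrow> real \<Rightarrow> real \<Rightarrow> real" where
  "discordance m n k l = k * (real n - l) + (real m - k) * l"

lemma mean_add: "mean m n p (\<lambda>k l. \<phi> k l + \<psi> k l) = mean m n p \<phi> + mean m n p \<psi>"
  by (simp add: mean_def sum.distrib algebra_simps)

lemma mean_diff: "mean m n p (\<lambda>k l. \<phi> k l - \<psi> k l) = mean m n p \<phi> - mean m n p \<psi>"
  by (simp add: mean_def sum_subtractf algebra_simps)

lemma mean_cmult: "mean m n p (\<lambda>k l. c * \<phi> k l) = c * mean m n p \<phi>"
  by (simp add: mean_def sum_distrib_left algebra_simps)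

lemma mean_cong:
  assumes "\<And>k l. k \<le> m \<Longrightarrow> l \<le> n \<Longrightarrow> \<phi> (real k) (real l) = \<psi> (real k) (real l)"
  shows "mean m n p \<phi> = mean m n p \<psi>"
  unfolding mean_def by (intro sum.cong refl) (use assms in auto)

lemma mean_flip:
  "mean m n (\<lambda>k l. p (m - k) (n - l)) \<phi> = mean m n p (\<lambda>k l. \<phi> (real m - k) (real n - l))"
proof -
  have flip: "(\<Sum>k\<le>N. f (N - k)) = (\<Sum>k\<le>N. f k)" for f :: "nat \<Rightarrow> real" and N
    by (rule sum.nat_diff_reindex[of _ "Suc N", simplified lessThan_Suc_atMost, simplified])
  have "mean m n p (\<lambda>k l. \<phi> (real m - k) (real n - l)) =
    (\<Sum>k\<le>m. \<Sum>l\<le>n. p k l * \<phi> (real (m - k)) (real (n - l)))"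
    unfolding mean_def by (intro sum.cong refl) (auto simp: of_nat_diff)
  also have "\<dots> = (\<Sum>k\<le>m. \<Sum>l\<le>n. p (m - k) l * \<phi> (real (m - (m - k))) (real (n - l)))"
    by (rule flip[symmetric])
  also have "\<dots> = (\<Sum>k\<le>m. \<Sum>l\<le>n. p (m - k) (n - l) * \<phi> (real (m - (m - k))) (real (n - (n - l))))"
    by (intro sum.cong refl flip[symmetric])
  also have "\<dots> = mean m n (\<lambda>k l. p (m - k) (n - l)) \<phi>"
    unfolding mean_def by (intro sum.cong refl) auto
  finally show ?thesis by simp
qed

text \<open>A discordant edge moves \<open>l\<close> by one at rate \<open>1 / n\<close> and
  \<open>k\<close> by one in the opposite direction at rate \<open>1 / m\<close>; the weights
  \<open>n\<close> and \<open>m\<close> make the two drifts cancel.\<close>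

lemma generator_weight: 
  assumes "m > 0" "n > 0"
  shows "generator m n (\<lambda>k l. real m * k + real n * l) k l = 0"
  using assms by (simp add: generator_def divide_simps) (simp add: algebra_simps)

lemma generator_affine:
  "generator m n (\<lambda>k l. F k l + c * G k l + d) k l = generator m n F k l + c * generator m n G k l"
proof -
  have key: "r * ((a + c * b + d) - (a' + c * b' + d)) = r * (a - a') + c * (r * (b - b'))" for r a b a' b' :: real
    by (simp add: algebra_simps)
  have sum: "(a1 + c * b1) + (a2 + c * b2) + (a3 + c * b3) + (a4 + c * b4) =
      (a1 + a2 + a3 + a4) + c * (b1 + b2 + b3 + b4)" for a1 a2 a3 a4 b1 b2 b3 b4 :: real
    by (simp add: algebra_simps)
  show ?thesis unfolding generator_def key by (rule sum)
qed

text \<open>For the third bound, \<open>l \<le> n\<close> is used in one summand and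
  \<open>n - l \<le> n\<close> in the other; what remains on the left no longer depends on
  \<open>k\<close>.\<close>

lemma discordance_bounds:
  assumes "0 \<le> k" "k \<le> real m" "0 \<le> l" "l \<le> real n"
  shows "0 \<le> discordance m n k l" "discordance m n k l \<le> 2 * real m * real n"
    "real m * l * (real n - l) \<le> discordance m n k l * real n"
proof -
  show "0 \<le> discordance m n k l" using assms by (auto simp: discordance_def)
  have "k * (real n - l) \<le> real m * real n" "(real m - k) * l \<le> real m * real n"
    using assms by (auto intro!: mult_mono)
  thus "discordance m n k l \<le> 2 * real m * real n" by (simp add: discordance_def)
  have "k * (real n - l) * l \<le> k * (real n - l) * real n"
    "(real m - k) * l * (real n - l) \<le> (real m - k) * l * real n"
    using assms by (auto intro!: mult_left_mono)
  thus "real m * l * (real n - l) \<le> discordance m n k l * real n"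
    by (simp add: discordance_def algebra_simps)
qed

lemma weight_bounds:
  assumes "0 \<le> k" "k \<le> real m" "0 \<le> l" "l \<le> real n"
  shows "0 \<le> degree_weight m n k l" "degree_weight m n k l \<le> 1"
proof -
  have "real m * k \<le> real m * real m" "real n * l \<le> real n * real n"
    using assms by (auto intro!: mult_left_mono)
  hence le: "real m * k + real n * l \<le> real m ^ 2 + real n ^ 2" by (simp add: power2_eq_square)
  show "degree_weight m n k l \<le> 1"
  \<comment> \<open>For \<open>m = n = 0\<close> division by zero makes the weight 0.\<close>
  proof (cases "real m ^ 2 + real n ^ 2 = 0")
    case False
    hence "real m ^ 2 + real n ^ 2 > 0" by (metis add_nonneg_nonneg order_le_less zero_le_power2)
    thus ?thesis using le by (simp add: degree_weight_def)
  qed (simp add: degree_weight_def)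
qed (use assms in \<open>auto simp: degree_weight_def\<close>)

text \<open>What remains of a quasistationary law after counting. If \<open>\<rho>\<close> is the
  probability to survive one step, the mean of \<open>P g\<close> is \<open>\<rho>\<close> times the
  mean of \<open>g\<close> for every \<open>g\<close> that vanishes at both absorbing states; thus
  \<open>lam\<close> stands for \<open>(m + n) * (1 - \<rho>)\<close>.\<close>

locale qs_law =
  fixes m n :: nat and p :: "nat \<Rightarrow> nat \<Rightarrow> real" and lam :: real
  assumes m_pos: "1 \<le> m" and n_ge: "2 \<le> n"
    and nonneg: "\<And>k l. 0 \<le> p k l"
    and absorbed: "p 0 0 = 0" "p m n = 0"
    and total: "(\<Sum>k\<le>m. \<Sum>l\<le>n. p k l) = 1"
    and lam_nonneg: "0 \<le> lam"
    and stationary: "\<And>g. g 0 0 = 0 \<Longrightarrow> g (real m) (real n) = 0 \<Longrightarrow>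
      mean m n p (generator m n g) = - lam * mean m n p g"
begin

abbreviation "E \<equiv> mean m n p"
abbreviation "A \<equiv> generator m n"

lemma mean_mono:
  assumes "\<And>k l. k \<le> m \<Longrightarrow> l \<le> n \<Longrightarrow> (k, l) \<noteq> (0, 0) \<Longrightarrow> (k, l) \<noteq> (m, n) \<Longrightarrow>
    \<phi> (real k) (real l) \<le> \<psi> (real k) (real l)"
  shows "E \<phi> \<le> E \<psi>"
  unfolding mean_def
proof (intro sum_mono)
  fix k l assume "k \<in> {..m}" "l \<in> {..n}"
  thus "p k l * \<phi> (real k) (real l) \<le> p k l * \<psi> (real k) (real l)"
    using assms[of k l] absorbed nonneg[of k l]
    by (cases "(k, l) = (0, 0) \<or> (k, l) = (m, n)") (auto intro: mult_left_mono)
qed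

lemma mean_const: "E (\<lambda>_ _. c) = c"
proof -
  have "E (\<lambda>_ _. c) = (\<Sum>k\<le>m. \<Sum>l\<le>n. p k l) * c"
    by (simp add: mean_def sum_distrib_right)
  thus ?thesis by (simp add: total)
qed

lemma mean_abs_le:
  assumes "\<And>k l. k \<le> m \<Longrightarrow> l \<le> n \<Longrightarrow> \<bar>\<phi> (real k) (real l)\<bar> \<le> c"
  shows "\<bar>E \<phi>\<bar> \<le> c"
proof -
  have "E \<phi> \<le> E (\<lambda>_ _. c)" "E (\<lambda>_ _. -c) \<le> E \<phi>"
    by (rule mean_mono; use assms in \<open>fastforce simp: abs_le_iff\<close>)+
  thus ?thesis by (simp add: mean_const abs_le_iff)
qed

text \<open>Exchanging the two opinions commutes with the dynamics, so every bound near the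
  consensus 0 has a counterpart near the consensus 1.\<close>

lemma qs_law_flip: "qs_law m n (\<lambda>k l. p (m - k) (n - l)) lam"
proof
  have "E (\<lambda>_ _. 1) = mean m n (\<lambda>k l. p (m - k) (n - l)) (\<lambda>_ _. 1)"
    by (simp add: mean_flip)
  thus "(\<Sum>k\<le>m. \<Sum>l\<le>n. p (m - k) (n - l)) = 1"
    unfolding mean_const by (simp add: mean_def)
next
  fix g :: "real \<Rightarrow> real \<Rightarrow> real" assume g: "g 0 0 = 0" "g (real m) (real n) = 0"
  have "A (\<lambda>k l. g (real m - k) (real n - l)) = (\<lambda>k l. A g (real m - k) (real n - l))"
    by (simp add: generator_def algebra_simps fun_eq_iff)
  thus "mean m n (\<lambda>k l. p (m - k) (n - l)) (A g) = - lam * mean m n (\<lambda>k l. p (m - k) (n - l)) g"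
    unfolding mean_flip using stationary[of "\<lambda>k l. g (real m - k) (real n - l)"] g by simp
qed (use m_pos n_ge nonneg absorbed lam_nonneg in auto)

text \<open>Cutting \<open>F\<close> down to 0 at the absorbing states changes it at no state that
  carries mass, but can only lower the values reached by jumps; so the generator of the cut function
  lies below \<open>A F\<close>. This form admits \<open>sqrt M\<close>, which is positive at
  \<open>(m, n)\<close>.\<close>

lemma superharmonic_bound:
  assumes "0 \<le> F 0 0" "0 \<le> F (real m) (real n)"
  shows "- lam * E F \<le> E (A F)"
proof -
  define g where "g = (\<lambda>k l. if (k, l) = (0, 0) \<or> (k, l) = (real m, real n) then 0 else F k l)"
  have le: "g k l \<le> F k l" for k l using assms by (auto simp: g_def)
  have "- lam * E F = - lam * E g"
    using absorbed by (auto simp: mean_def g_def intro!: sum.cong)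
  also have "\<dots> = E (A g)" by (subst stationary) (auto simp: g_def)
  also have "\<dots> \<le> E (A F)"
  proof (rule mean_mono)
    fix k l assume kl: "k \<le> m" "l \<le> n" "(k, l) \<noteq> (0, 0)" "(k, l) \<noteq> (m, n)"
    have eq: "g (real k) (real l) = F (real k) (real l)" using kl by (auto simp: g_def)
    show "A g (real k) (real l) \<le> A F (real k) (real l)"
      unfolding generator_def eq
      by (intro add_mono mult_left_mono diff_right_mono le) (use kl in auto)
  qed
  finally show ?thesis .
qed

text \<open>Subtracting the affine function of the martingale that interpolates \<open>F\<close>
  between the two absorbing states makes \<open>stationary\<close> applicable, while
  \<open>A\<close> annihilates the subtracted part.\<close>

lemma generator_mean:
  "E (A F) = - lam * E (\<lambda>k l. F k l - F 0 0 * (1 - degree_weight m n k l) - F (real m) (real n) * degree_weight m n k l)"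
proof -
  have pos: "real m ^ 2 + real n ^ 2 > 0" using m_pos by (simp add: add_pos_nonneg)
  let ?g = "\<lambda>k l. F k l - F 0 0 * (1 - degree_weight m n k l) - F (real m) (real n) * degree_weight m n k l"
  have w1: "degree_weight m n (real m) (real n) = 1" "degree_weight m n 0 0 = 0"
    using pos m_pos n_ge by (auto simp: degree_weight_def power2_eq_square)
  have g: "?g = (\<lambda>k l. F k l + (F 0 0 - F (real m) (real n)) / (real m ^ 2 + real n ^ 2) *
      (real m * k + real n * l) + - F 0 0)"
    by (simp add: fun_eq_iff degree_weight_def algebra_simps diff_divide_distrib)
  have "A ?g = A F" using m_pos n_ge
    by (subst g, intro ext, subst generator_affine) (simp add: generator_weight)
  moreover have "E (A ?g) = - lam * E ?g"
    by (rule stationary) (auto simp: w1)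
  ultimately show ?thesis by simp
qed

end

section \<open>Bounds on the killing rate and on the mass near consensus\<close>

text \<open>These three quadratics vanish at both absorbing states and span a space invariant under
  the generator, so that a bound \<open>A H \<ge> - C * H\<close> reduces to a comparison of
  coefficients.\<close>

lemma generator_quadratics:
  assumes "m > 0" "n > 0"
  shows "generator m n (\<lambda>k l. \<alpha> * (k * (real m - k)) + \<beta> * (l * (real n - l)) + \<gamma> * discordance m n k l) k l =
    (2 * \<gamma> - 2 * real n * \<alpha> / real m) * (k * (real m - k)) +
    (2 * \<gamma> - 2 * real m * \<beta> / real n) * (l * (real n - l)) +
    (\<alpha> * (real m - 1) / real m + \<beta> * (real n - 1) / real n - \<gamma> * (real n / real m + real m / real n)) *
      discordance m n k l"
  using assms by (simp add: generator_def discordance_def divide_simps) (simp add: algebra_simps)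

text \<open>With \<open>a\<close> and \<open>b\<close> the two roots, the gap below the tangent is
  exactly \<open>(b - a)^2 / (2 * a)\<close>, where \<open>b - a = h / (a + b)\<close> and
  \<open>(a + b)^2 \<le> 2 * (a^2 + b^2)\<close>.\<close>

lemma sqrt_step:
  fixes M h :: real
  assumes "0 < M" "0 \<le> M + h"
  shows "sqrt (M + h) - sqrt M \<le> h / (2 * sqrt M) - h ^ 2 / (4 * sqrt M * (2 * M + \<bar>h\<bar>))"
proof -
  define a b where "a = sqrt M" and "b = sqrt (M + h)"
  have a: "a > 0" "a ^ 2 = M" and b: "b \<ge> 0" "b ^ 2 = M + h"
    using assms by (auto simp: a_def b_def)
  have h: "h = (b - a) * (a + b)" using a b by (simp add: power2_eq_square algebra_simps)
  have ab: "a + b > 0" using a b by simp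
  have le: "(a + b) ^ 2 \<le> 2 * (2 * M + \<bar>h\<bar>)"
  proof -
    have "(a + b) ^ 2 \<le> 2 * (a ^ 2 + b ^ 2)" using sum_squares_bound[of a b] by (simp add: power2_sum)
    thus ?thesis using a b by simp
  qed
  have "h ^ 2 / (4 * a * (2 * M + \<bar>h\<bar>)) = h ^ 2 / (2 * a * (2 * (2 * M + \<bar>h\<bar>)))"
    by (simp add: algebra_simps)
  also have "\<dots> \<le> h ^ 2 / (2 * a * (a + b) ^ 2)"
    using le a ab by (intro divide_left_mono mult_left_mono mult_pos_pos) (auto simp: assms add_pos_nonneg)
  also have "\<dots> = (b - a) ^ 2 / (2 * a)"
    unfolding h using ab by (simp add: power_mult_distrib)
  also have "\<dots> = h / (2 * a) - (b - a)"
    unfolding h using a(1) by (simp add: field_simps power2_eq_square)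
  finally show ?thesis by (simp add: a_def b_def)
qed

text \<open>Bernoulli bounds \<open>J * x\<close> by \<open>(1 + x) ^ J\<close>, and
  \<open>(1 + x) * (1 - x) \<le> 1\<close> absorbs that power. The exponent \<open>2 * J\<close> is
  the one of the square of \<open>(1 - x) ^ J\<close>, which is later compared with
  \<open>1 / M\<close>.\<close>

lemma power_sqrt_bound:
  fixes x :: real
  assumes "0 \<le> x" "x \<le> 1"
  shows "real J * x * (1 - x) ^ (2 * J) \<le> 1"
proof -
  have "1 + real J * x \<le> (1 + x) ^ J"
    using Bernoulli_inequality[of x J] assms by simp
  hence "(real J * x) * (1 - x) ^ J \<le> (1 + x) ^ J * (1 - x) ^ J"
    using assms by (intro mult_right_mono) auto
  also have "\<dots> = (1 - x\<^sup>2) ^ J" by (simp add: power_mult_distrib[symmetric] algebra_simps power2_eq_square)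
  also have "\<dots> \<le> 1" using assms by (intro power_le_one) (auto simp: power_le_one)
  finally have 1: "(real J * x) * (1 - x) ^ J \<le> 1" .
  have "real J * x * (1 - x) ^ (2 * J) = ((real J * x) * (1 - x) ^ J) * (1 - x) ^ J"
    by (simp add: mult_2 power_add)
  also have "\<dots> \<le> 1 * 1" by (intro mult_mono 1) (use assms in \<open>auto intro: power_le_one\<close>)
  finally show ?thesis by simp
qed

context qs_law
begin

text \<open>A function \<open>H\<close> that is positive off the absorbing states, zero on them, and
  satisfies \<open>A H \<ge> - C * H\<close> forces \<open>lam \<le> C\<close>.\<close>

lemma lam_le: "lam \<le> 2 * real m * (1 + real m ^ 2) / real n ^ 2"
proof -
  \<comment> \<open>The ratio of \<open>a\<close> to \<open>c\<close> makes the coefficient of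
    \<open>k * (m - k)\<close> in \<open>A H\<close> vanish; the ratio of \<open>b\<close> to
    \<open>c\<close> leaves the discordance with the coefficient \<open>a * (m - 1) / m\<close>. The
    only negative coefficient is then that of \<open>l * (n - l)\<close>: it is bounded in
    \<open>n\<close>, whereas \<open>b\<close> is of order \<open>n^2\<close>, and their ratio is
    the bound on \<open>lam\<close>.\<close>
  define a c where "a = real m ^ 2 * (real n - 1) / real n" and "c = real m * (real n - 1)"
  define b where "b = real n ^ 2 + real m ^ 2"
  define H where "H = (\<lambda>k l. a * (k * (real m - k)) + b * (l * (real n - l)) + c * discordance m n k l)"
  define C where "C = 2 * real m * (1 + real m ^ 2) / real n ^ 2"
  have mn: "real m \<ge> 1" "real n \<ge> 2" using m_pos n_ge by auto
  have pos: "a > 0" "b > 0" "c > 0" using mn by (auto simp: a_def b_def c_def intro!: divide_pos_pos mult_pos_pos add_pos_pos)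
  have c1: "2 * c - 2 * real n * a / real m = 0"
    using mn by (simp add: a_def c_def power2_eq_square)
  have c3: "0 \<le> a * (real m - 1) / real m + b * (real n - 1) / real n - c * (real n / real m + real m / real n)"
  proof -
    have "b * (real n - 1) / real n = c * (real n / real m + real m / real n)"
      using mn by (simp add: b_def c_def divide_simps) (simp add: algebra_simps power2_eq_square)
    thus ?thesis using mn pos by simp
  qed
  have C: "C \<ge> 0" using mn by (simp add: C_def)
  have c2: "- C * b \<le> 2 * c - 2 * real m * b / real n"
  proof -
    have "2 * c - 2 * real m * b / real n = - (2 * real m * (real n + real m ^ 2)) / real n"
      using mn by (simp add: b_def c_def field_simps power2_eq_square)
    also have "\<dots> \<ge> - (2 * real m * (real n + real m ^ 2 * real n)) / real n"
      using mn by (intro divide_right_mono) (auto intro!: mult_left_mono)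
    also have "- (2 * real m * (real n + real m ^ 2 * real n)) / real n = - C * real n ^ 2"
      using mn by (simp add: C_def divide_simps) (simp add: algebra_simps power2_eq_square)
    also have "- C * real n ^ 2 \<ge> - C * b"
      using mult_left_mono[of "real n ^ 2" b C] C by (simp add: b_def)
    finally show ?thesis by simp
  qed
  have AH: "- C * H k l \<le> A H k l" if "0 \<le> k" "k \<le> real m" "0 \<le> l" "l \<le> real n" for k l
  proof -
    have d: "discordance m n k l \<ge> 0" using discordance_bounds(1) that by blast
    have "A H k l = (2 * c - 2 * real m * b / real n) * (l * (real n - l)) +
      (a * (real m - 1) / real m + b * (real n - 1) / real n - c * (real n / real m + real m / real n)) * discordance m n k l"
      unfolding H_def using generator_quadratics[of m n a b c k l] c1 mn by simp
    also have "\<dots> \<ge> (- C * b) * (l * (real n - l)) + 0"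
      using that d c3 c2 by (intro add_mono mult_right_mono mult_nonneg_nonneg) auto
    also have "(- C * b) * (l * (real n - l)) + 0 \<ge> - C * H k l"
      using that pos C d by (simp add: H_def algebra_simps)
        (smt (verit) mult_nonneg_nonneg mult.commute mult_left_mono)
    finally show ?thesis by simp
  qed
  have "- C * E H = E (\<lambda>k l. - C * H k l)" by (simp only: mean_cmult)
  also have "\<dots> \<le> E (A H)" by (rule mean_mono) (use AH in auto)
  also have "E (A H) = - lam * E H"
    by (rule stationary) (auto simp: H_def discordance_def)
  finally have "lam * E H \<le> C * E H" by simp
  moreover have "E H > 0"
  proof -
    have "c \<le> H (real k) (real l)" if "k \<le> m" "l \<le> n" "(k, l) \<noteq> (0, 0)" "(k, l) \<noteq> (m, n)" for k l
    proof -
      \<comment> \<open>Off consensus some edge joins different opinions.\<close>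
      have "1 \<le> k * (n - l) + (m - k) * l" using that m_pos n_ge
        by (cases "k = 0"; cases "l = n") (auto simp: Suc_le_eq)
      hence "1 \<le> real (k * (n - l) + (m - k) * l)" by linarith
      hence "1 \<le> discordance m n (real k) (real l)" using that by (simp add: discordance_def of_nat_diff)
      hence "c * 1 \<le> c * discordance m n (real k) (real l)" using pos by (intro mult_left_mono) auto
      moreover have "0 \<le> a * (real k * (real m - real k))" "0 \<le> b * (real l * (real n - real l))"
        using pos that by auto
      ultimately show ?thesis by (simp add: H_def)
    qed
    hence "E (\<lambda>_ _. c) \<le> E H" by (intro mean_mono) auto
    thus ?thesis using pos by (simp add: mean_const)
  qed
  ultimately show ?thesis unfolding C_def[symmetric] by simp
qed

text \<open>Because \<open>M\<close> is a martingale, only concavity terms survive. Those of the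
  \<open>l\<close>-jumps, of size \<open>n\<close>, are kept; those of the \<open>k\<close>-jumps
  are nonpositive and dropped. The constant \<open>2 * m^2 + 3\<close> comes from comparing
  \<open>2 * M + n\<close> with \<open>n\<close> if \<open>l = 0\<close> and with
  \<open>n * l\<close> otherwise.\<close>

lemma sqrt_generator:
  assumes "k \<le> m" "l \<le> n" "(k, l) \<noteq> (0, 0)"
  defines "M \<equiv> real m * real k + real n * real l"
  shows "A (\<lambda>k l. sqrt (real m * k + real n * l)) (real k) (real l) \<le>
    - ((1 - real l / real n) / (4 * (2 * real m ^ 2 + 3) * sqrt M))"
proof -
  have mn: "real m \<ge> 1" "real n \<ge> 2" using m_pos n_ge by auto
  have kl: "0 \<le> real k" "real k \<le> real m" "0 \<le> real l" "real l \<le> real n" using assms by auto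
  have M: "M > 0"
  proof (cases "k = 0")
    case True
    hence "real n * real l > 0" using assms(3) mn by auto
    thus ?thesis by (simp add: M_def add_nonneg_pos)
  next
    case False
    hence "real m * real k > 0" using mn by auto
    thus ?thesis by (simp add: M_def add_pos_nonneg)
  qed
  define q where "q = (\<lambda>h. h / (2 * sqrt M))"
  \<comment> \<open>A jump that would make \<open>M\<close> negative has rate 0, hence the condition
    on \<open>M + h\<close> only for \<open>r \<noteq> 0\<close>.\<close>
  have step: "r * (sqrt (M + h) - sqrt M) \<le> r * (q h - h ^ 2 / (4 * sqrt M * (2 * M + \<bar>h\<bar>)))"
    if "r \<ge> 0" "r \<noteq> 0 \<Longrightarrow> 0 \<le> M + h" for r h
    using sqrt_step[OF M, of h] that by (cases "r = 0") (auto simp: q_def intro!: mult_left_mono)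
  have step0: "r * (sqrt (M + h) - sqrt M) \<le> r * q h"
    if "r \<ge> 0" "r \<noteq> 0 \<Longrightarrow> 0 \<le> M + h" for r h
  proof -
    have "h ^ 2 / (4 * sqrt M * (2 * M + \<bar>h\<bar>)) \<ge> 0" using M by simp
    hence "r * (q h - h ^ 2 / (4 * sqrt M * (2 * M + \<bar>h\<bar>))) \<le> r * q h" using that by (intro mult_left_mono) auto
    thus ?thesis using step[OF that] by linarith
  qed
  \<comment> \<open>The concavity gain of one jump of \<open>l\<close>, up or down; these jumps have
    total rate \<open>discordance / n\<close>.\<close>
  define D where "D = real n ^ 2 / (4 * sqrt M * (2 * M + real n))"
  have "A (\<lambda>k l. sqrt (real m * k + real n * l)) (real k) (real l) =
     real k * (real n - real l) / real n * (sqrt (M + real n) - sqrt M) +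
     (real m - real k) * real l / real n * (sqrt (M + - real n) - sqrt M) +
     real l * (real m - real k) / real m * (sqrt (M + real m) - sqrt M) +
     (real n - real l) * real k / real m * (sqrt (M + - real m) - sqrt M)"
    by (simp add: generator_def M_def algebra_simps)
  also have "\<dots> \<le> real k * (real n - real l) / real n * (q (real n) - (real n) ^ 2 / (4 * sqrt M * (2 * M + \<bar>real n\<bar>))) +
     (real m - real k) * real l / real n * (q (- real n) - (- real n) ^ 2 / (4 * sqrt M * (2 * M + \<bar>- real n\<bar>))) +
     real l * (real m - real k) / real m * q (real m) +
     (real n - real l) * real k / real m * q (- real m)"
  proof (intro add_mono step step0)
    assume "(real m - real k) * real l / real n \<noteq> 0"
    hence "real l \<ge> 1" by auto
    hence "real n * real l \<ge> real n * 1" by (intro mult_left_mono) auto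
    thus "0 \<le> M + - real n" by (simp add: M_def add_increasing)
  next
    assume "(real n - real l) * real k / real m \<noteq> 0"
    hence "real k \<ge> 1" by auto
    hence "real m * real k \<ge> real m * 1" by (intro mult_left_mono) auto
    moreover have "real n * real l \<ge> 0" by simp
    ultimately show "0 \<le> M + - real m" unfolding M_def by linarith
  qed (use kl M in auto)
  also have "\<dots> = - (discordance m n (real k) (real l) / real n * D)"
    using mn M by (simp add: q_def D_def discordance_def divide_simps) (simp add: algebra_simps)
  also have "\<dots> \<le> - ((1 - real l / real n) / (4 * (2 * real m ^ 2 + 3) * sqrt M))"
  proof -
    \<comment> \<open>Once \<open>sqrt M\<close> is cancelled the claim is polynomial. For
      \<open>l = 0\<close> the discordance is \<open>k * n\<close> with \<open>k \<ge> 1\<close>,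
      and \<open>M \<le> m^2\<close>; for \<open>l \<ge> 1\<close> the lower bound of the
      discordance that is free of \<open>k\<close> suffices.\<close>
    have key: "(real n - real l) * (2 * M + real n) \<le> discordance m n (real k) (real l) * real n ^ 2 * (2 * real m ^ 2 + 3)"
    proof (cases "l = 0")
      case True
      hence k: "real k \<ge> 1" using assms by auto
      have "2 * M + real n \<le> 2 * (real m * real m) * 1 + real n"
        using True kl mn by (simp add: M_def mult_left_mono)
      also have "\<dots> \<le> 2 * (real m * real m) * real n + 3 * real n"
        using mn by (intro add_mono mult_left_mono) auto
      also have "\<dots> = 1 * real n * (2 * real m ^ 2 + 3)" by (simp add: power2_eq_square algebra_simps)
      also have "\<dots> \<le> real k * real n * (2 * real m ^ 2 + 3)" using k by (intro mult_right_mono) auto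
      finally have "real n * (2 * M + real n) \<le> real n * (real k * real n * (2 * real m ^ 2 + 3))"
        by (intro mult_left_mono) auto
      also have "\<dots> \<le> real n * (real n * (real k * real n * (2 * real m ^ 2 + 3)))"
        using mn mult_right_mono[of 1 "real n" "real n * (real k * real n * (2 * real m ^ 2 + 3))"] by auto
      finally show ?thesis using True by (simp add: discordance_def power2_eq_square algebra_simps)
    next
      case False
      hence l: "real l \<ge> 1" by simp
      hence nl: "real n \<le> real n * real l" using mult_left_mono[of 1 "real l" "real n"] by simp
      have "real m * real k \<le> real m * real m" using kl by (intro mult_left_mono) auto
      hence "2 * M + real n \<le> 2 * (real m * real m) + 3 * (real n * real l)"
        using nl by (simp add: M_def mult.commute[of "real n" "real l"])
      also have "\<dots> = 2 * (real m * real m) * 1 + 3 * (real n * real l)" by simp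
      also have "\<dots> \<le> 2 * (real m * real m) * (real n * real l) + 3 * (real n * real l)"
        using mult_left_mono[of 1 "real n * real l" "2 * (real m * real m)"] order.trans[OF _ nl, of 1] mn by simp
      also have "\<dots> = real n * real l * (2 * real m ^ 2 + 3)" by (simp add: power2_eq_square algebra_simps)
      finally have "(real n - real l) * (2 * M + real n) \<le> (real n - real l) * (real n * real l * (2 * real m ^ 2 + 3))"
        using kl by (intro mult_left_mono) auto
      also have "\<dots> = 1 * (real l * (real n - real l)) * (real n * (2 * real m ^ 2 + 3))" by (simp add: algebra_simps)
      also have "\<dots> \<le> real m * (real l * (real n - real l)) * (real n * (2 * real m ^ 2 + 3))"
        using mn kl by (intro mult_right_mono) auto
      also have "\<dots> \<le> (discordance m n (real k) (real l) * real n) * (real n * (2 * real m ^ 2 + 3))"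
        using discordance_bounds(3)[of "real k" m "real l" n] kl by (intro mult_right_mono) (auto simp: algebra_simps)
      finally show ?thesis by (simp add: power2_eq_square algebra_simps)
    qed
    have "1 - real l / real n = (real n - real l) / real n" "2 * M + real n \<noteq> 0"
      using mn M by (auto simp: diff_divide_distrib)
    hence "(1 - real l / real n) / (4 * (2 * real m ^ 2 + 3) * sqrt M) =
      (real n - real l) * (2 * M + real n) / (4 * (2 * real m ^ 2 + 3) * sqrt M * real n * (2 * M + real n))"
      by (simp add: mult_ac)
    also have "\<dots> \<le> (discordance m n (real k) (real l) * real n ^ 2 * (2 * real m ^ 2 + 3)) / (4 * (2 * real m ^ 2 + 3) * sqrt M * real n * (2 * M + real n))"
      using key M by (intro divide_right_mono) auto
    also have "\<dots> = discordance m n (real k) (real l) / real n * D"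
    proof -
      have "d * N ^ 2 * c / (4 * c * s * N * t) = d / N * (N ^ 2 / (4 * s * t))" if "c \<noteq> 0" for d N c s t :: real
        using that by (simp add: power2_eq_square)
      moreover have "2 * real m ^ 2 + 3 \<noteq> 0" by (smt (verit) zero_le_power2)
      ultimately show ?thesis unfolding D_def by blast
    qed
    finally show ?thesis by simp
  qed
  finally show ?thesis .
qed

text \<open>The bound does not depend on \<open>n\<close> and tends to 0 as \<open>J\<close> grows,
  so no mass can collect at \<open>x = 0\<close>. The powers of \<open>n\<close> cancel:
  \<open>K\<close> and the mean of \<open>sqrt M\<close> contribute one factor \<open>n\<close>
  each, and \<open>lam\<close> contributes \<open>n^-2\<close>.\<close>

lemma lower_tail:
  assumes "1 \<le> J" "J \<le> n"
  shows "E (\<lambda>k l. (1 - l / real n) ^ Suc J) \<le>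
    8 * real m * (1 + real m ^ 2) * (2 * real m ^ 2 + 3) * (1 + real m) ^ 2 / sqrt (real J)"
proof -
  have mn: "real m \<ge> 1" "real n \<ge> 2" using m_pos n_ge by auto
  define c where "c = 4 * (2 * real m ^ 2 + 3)"
  have c: "c > 0" by (simp add: c_def add_nonneg_pos)
  define F where "F = (\<lambda>k l. sqrt (real m * k + real n * l))"
  \<comment> \<open>Chosen so that \<open>(1 - x) ^ J \<le> K / sqrt M\<close>, which turns
    \<open>(1 - x) ^ Suc J\<close> into a multiple of the lower bound for
    \<open>- A F\<close>.\<close>
  define K where "K = (1 + real m) * real n / sqrt (real J)"
  have K: "K \<ge> 0" using mn by (simp add: K_def)
  have pt: "(1 - real l / real n) ^ Suc J \<le> - K * c * A F (real k) (real l)"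
    if kl: "k \<le> m" "l \<le> n" "(k, l) \<noteq> (0, 0)" for k l
  proof -
    define x where "x = real l / real n"
    define M where "M = real m * real k + real n * real l"
    have x: "0 \<le> x" "x \<le> 1" using kl mn by (auto simp: x_def)
    have M: "M > 0" 
    proof -
      have "0 < m * k + n * l" using kl m_pos n_ge by auto
      hence "0 < real (m * k + n * l)" by linarith
      thus ?thesis by (simp add: M_def)
    qed
    \<comment> \<open>The part \<open>n * l\<close> of \<open>M\<close> is compensated by the powers
      of \<open>1 - x\<close>. The part \<open>m * k\<close> is not, for instance at
      \<open>l = 0\<close>; there \<open>J \<le> n\<close> is used.\<close>
    have "(real J * M) * (1 - x) ^ (2 * J) = real J * (real m * real k) * (1 - x) ^ (2 * J) + real n ^ 2 * (real J * x * (1 - x) ^ (2 * J))"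
      using mn by (simp add: M_def x_def power2_eq_square algebra_simps)
    also have "\<dots> \<le> real n * (real m * real m) * 1 + real n ^ 2 * 1"
      using assms kl x by (intro add_mono mult_mono power_sqrt_bound) (auto intro: power_le_one)
    also have "\<dots> \<le> real n ^ 2 * (real m * real m) + real n ^ 2"
      using mn by (simp add: power2_eq_square mult_right_mono)
    also have "\<dots> \<le> ((1 + real m) * real n) ^ 2" using mn by (simp add: power2_eq_square algebra_simps)
    finally have "sqrt ((real J * M) * (1 - x) ^ (2 * J)) \<le> sqrt (((1 + real m) * real n) ^ 2)"
      by (rule real_sqrt_le_mono)
    also have "sqrt ((real J * M) * (1 - x) ^ (2 * J)) = sqrt (real J) * sqrt M * (1 - x) ^ J"
      using x by (simp add: real_sqrt_mult power_even_eq)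
    finally have "(1 - x) ^ J \<le> K / sqrt M"
      using M assms mn by (simp add: K_def field_simps)
    hence "(1 - x) ^ Suc J \<le> (1 - x) * (K / sqrt M)"
      unfolding power_Suc using x by (intro mult_left_mono) auto
    also have "\<dots> = K * c * ((1 - x) / (c * sqrt M))" using c M by (simp add: field_simps)
    also have "\<dots> \<le> K * c * (- A F (real k) (real l))"
      using sqrt_generator[OF kl] K c unfolding F_def M_def x_def c_def
      by (intro mult_left_mono) auto
    finally show ?thesis by (simp add: x_def)
  qed
  have "E (\<lambda>k l. (1 - l / real n) ^ Suc J) \<le> E (\<lambda>k l. - K * c * A F k l)"
    by (rule mean_mono) (use pt in auto)
  also have "\<dots> = - K * c * E (A F)" by (simp only: mean_cmult)
  also have "\<dots> \<le> K * c * (lam * E F)"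
  proof -
    have "- lam * E F \<le> E (A F)" by (rule superharmonic_bound) (auto simp: F_def)
    hence "K * c * (- E (A F)) \<le> K * c * (lam * E F)" using K c by (intro mult_left_mono) auto
    thus ?thesis by simp
  qed
  also have "\<dots> \<le> K * c * ((2 * real m * (1 + real m ^ 2) / real n ^ 2) * ((1 + real m) * real n))"
  proof (intro mult_left_mono mult_mono lam_le)
    have "E F \<le> E (\<lambda>_ _. (1 + real m) * real n)"
    proof (rule mean_mono)
      fix k l assume kl: "k \<le> m" "l \<le> n"
      have "real m * real k + real n * real l \<le> real m * real m + real n * real n"
        using kl by (intro add_mono mult_mono) auto
      also have "\<dots> \<le> ((1 + real m) * real n) ^ 2"
      proof -
        have "1 \<le> real n * real n" using mult_mono[of 1 "real n" 1 "real n"] mn by simp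
        hence "real m * real m * 1 + real n * real n \<le>
            real m * real m * (real n * real n) + (2 * real m * (real n * real n) + real n * real n)"
          by (intro add_mono mult_left_mono) auto
        thus ?thesis by (simp add: power2_eq_square algebra_simps)
      qed
      finally show "F (real k) (real l) \<le> (1 + real m) * real n"
        unfolding F_def using mn by (intro real_le_lsqrt) auto
    qed
    thus "E F \<le> (1 + real m) * real n" by (simp add: mean_const)
    have "E (\<lambda>_ _. 0) \<le> E F" by (rule mean_mono) (auto simp: F_def)
    thus "0 \<le> E F" by (simp add: mean_const)
  qed (use K c in auto)
  also have "\<dots> = 8 * real m * (1 + real m ^ 2) * (2 * real m ^ 2 + 3) * (1 + real m) ^ 2 / sqrt (real J)"
    using mn by (simp add: K_def c_def power2_eq_square) (simp add: algebra_simps)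
  finally show ?thesis .
qed

lemma upper_tail:
  assumes "1 \<le> J" "J \<le> n"
  shows "E (\<lambda>k l. (l / real n) ^ Suc J) \<le>
    8 * real m * (1 + real m ^ 2) * (2 * real m ^ 2 + 3) * (1 + real m) ^ 2 / sqrt (real J)"
proof -
  interpret flip: qs_law m n "\<lambda>k l. p (m - k) (n - l)" lam by (rule qs_law_flip)
  show ?thesis using flip.lower_tail[OF assms] n_ge by (simp add: mean_flip diff_divide_distrib)
qed

end

section \<open>The generator on binomial moments and on powers of the martingale\<close>

text \<open>With \<open>x\<close> frozen, \<open>k\<close> counts successes while single sites of
  \<open>S\<close> are resampled by a coin of bias \<open>x\<close>. On binomial coefficients this
  dynamics is triangular: a death reproduces the coefficient, a birth also brings in the next lower
  index. The three identities express this.\<close>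

lemma gbinomial_fall:
  fixes a :: real
  shows "a * (((a - 1) gchoose Suc i) - (a gchoose Suc i)) = - (real (Suc i) * (a gchoose Suc i))"
proof -
  have "(a gchoose Suc i) = ((a - 1) gchoose i) + ((a - 1) gchoose Suc i)"
    using gbinomial_Suc_Suc[of "a - 1" i] by simp
  thus ?thesis using gbinomial_absorption[of i a] by (simp add: algebra_simps)
qed

lemma gbinomial_shift:
  fixes a :: real
  shows "real (Suc i) * (a gchoose Suc i) = (a - real i) * (a gchoose i)"
  using gbinomial_absorption[of i a] gbinomial_absorb_comp[of a i] by simp

lemma gbinomial_rise:
  fixes a :: real
  shows "(b - a) * (((a + 1) gchoose Suc i) - (a gchoose Suc i)) =
    (b - real i) * (a gchoose i) - real (Suc i) * (a gchoose Suc i)"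
  using gbinomial_Suc_Suc[of a i] gbinomial_shift[of i a] by (simp add: algebra_simps)

text \<open>The first summand is the slow motion of \<open>x\<close>, the one with the prefactor
  \<open>n / m\<close> the fast refreshment of \<open>k\<close>. With \<open>gchoose\<close> over
  the reals the value at \<open>k - 1\<close> makes sense even for \<open>k = 0\<close>, where its
  rate is 0.\<close>

lemma generator_binomial_power:
  assumes "m > 0" "n > 0"
  shows "generator m n (\<lambda>k l. (k gchoose Suc i) * (l / real n) ^ j) k l =
    (k gchoose Suc i) * (k * (1 - l / real n) * ((l / real n + 1 / real n) ^ j - (l / real n) ^ j) +
      (real m - k) * (l / real n) * ((l / real n - 1 / real n) ^ j - (l / real n) ^ j)) +
    real n / real m * ((l / real n) ^ j *
      ((real m - real i) * (l / real n) * (k gchoose i) - real (Suc i) * (k gchoose Suc i)))"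
proof -
  let ?x = "l / real n"
  define u v w where "u = (k gchoose Suc i)" and "v = ((k + 1) gchoose Suc i)" and "w = ((k - 1) gchoose Suc i)"
  have r: "(real m - k) * (v - u) = (real m - real i) * (k gchoose i) - real (Suc i) * u"
    and f: "k * (w - u) = - (real (Suc i) * u)"
    using gbinomial_rise[of "real m" k i] gbinomial_fall[of k i] by (auto simp: u_def v_def w_def)
  have x: "(l + 1) / real n = ?x + 1 / real n" "(l - 1) / real n = ?x - 1 / real n"
    "(real n - l) = real n * (1 - ?x)" "l = real n * ?x"
    using assms by (auto simp: field_simps)
  have "generator m n (\<lambda>k l. (k gchoose Suc i) * (l / real n) ^ j) k l =
    k * (real n - l) / real n * (u * (?x + 1 / real n) ^ j - u * ?x ^ j) +
     (real m - k) * l / real n * (u * (?x - 1 / real n) ^ j - u * ?x ^ j) +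
     l * (real m - k) / real m * (v * ?x ^ j - u * ?x ^ j) +
     (real n - l) * k / real m * (w * ?x ^ j - u * ?x ^ j)"
    unfolding generator_def x(1,2) u_def v_def w_def by simp
  also have "\<dots> = u * (k * ((real n - l) / real n) * ((?x + 1 / real n) ^ j - ?x ^ j) +
     (real m - k) * ?x * ((?x - 1 / real n) ^ j - ?x ^ j)) +
     ?x ^ j / real m * (l * ((real m - k) * (v - u)) + (real n - l) * (k * (w - u)))"
    using assms by (simp add: field_simps)
  also have "(real n - l) / real n = 1 - ?x" using assms by (simp add: field_simps)
  also have "l * ((real m - k) * (v - u)) + (real n - l) * (k * (w - u)) =
     real n * (?x * (real m - real i) * (k gchoose i) - real (Suc i) * u)"
    unfolding r f using assms by (simp add: field_simps)
  finally show ?thesis by (simp add: u_def mult_ac)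
qed

text \<open>A second order expansion with a cubic error uniform over the unit interval. The
  truncated exponents \<open>a - 1\<close> and \<open>a - 2\<close> are harmless, because their
  coefficients vanish whenever truncation occurs.\<close>

lemma taylor_power:
  fixes y z :: real
  assumes "0 \<le> y" "y \<le> 1" "0 \<le> z" "z \<le> 1"
  shows "\<bar>z ^ a - y ^ a - real a * y ^ (a - 1) * (z - y) -
    real a * (real a - 1) / 2 * y ^ (a - 2) * (z - y) ^ 2\<bar> \<le> real a ^ 3 * \<bar>z - y\<bar> ^ 3"
proof (induction a)
  case (Suc a)
  define h where "h = z - y"
  define T where "T = z ^ a - y ^ a - real a * y ^ (a - 1) * h - real a * (real a - 1) / 2 * y ^ (a - 2) * h ^ 2"
  have T: "\<bar>T\<bar> \<le> real a ^ 3 * \<bar>h\<bar> ^ 3" using Suc by (simp add: T_def h_def)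
  define Q where "Q = real a * (real a - 1) / 2 * y ^ (a - 2)"
  have y1: "real a * y ^ (a - 1) * y = real a * y ^ a" by (cases a) auto
  have y2: "Q * y = real a * (real a - 1) / 2 * y ^ (a - 1)"
    by (cases a; cases "a - 1") (auto simp: Q_def)
  have z: "z = y + h" by (simp add: h_def)
  have "z ^ Suc a = z * (T + y ^ a + real a * y ^ (a - 1) * h + Q * h ^ 2)"
    by (simp add: T_def Q_def)
  also have "\<dots> = z * T + y ^ Suc a + h * y ^ a + (real a * y ^ (a - 1) * y) * h +
      real a * y ^ (a - 1) * h ^ 2 + (Q * y) * h ^ 2 + Q * h ^ 3"
    unfolding z by (simp add: algebra_simps power2_eq_square power3_eq_cube)
  also have "\<dots> = y ^ Suc a + real (Suc a) * y ^ a * h +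
      real (Suc a) * (real (Suc a) - 1) / 2 * y ^ (a - 1) * h ^ 2 + (z * T + Q * h ^ 3)"
    unfolding y1 y2 by (simp add: algebra_simps add_divide_distrib diff_divide_distrib)
  finally have eq: "z ^ Suc a - y ^ Suc a - real (Suc a) * y ^ a * h -
      real (Suc a) * (real (Suc a) - 1) / 2 * y ^ (a - 1) * h ^ 2 = z * T + Q * h ^ 3" by simp
  have Q: "\<bar>Q\<bar> \<le> real a ^ 2"
  proof (cases a)
    case (Suc b)
    have "\<bar>Q\<bar> = real a * real b / 2 * y ^ (a - 2)" using Suc assms by (simp add: Q_def abs_mult)
    also have "\<dots> \<le> real a * real a * 1"
      using assms Suc by (intro mult_mono power_le_one) auto
    finally show ?thesis by (simp add: power2_eq_square)
  qed (auto simp: Q_def)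
  have "\<bar>z * T + Q * h ^ 3\<bar> \<le> \<bar>z\<bar> * \<bar>T\<bar> + \<bar>Q\<bar> * \<bar>h\<bar> ^ 3"
    by (metis abs_mult abs_triangle_ineq power_abs)
  also have "\<dots> \<le> 1 * (real a ^ 3 * \<bar>h\<bar> ^ 3) + real a ^ 2 * \<bar>h\<bar> ^ 3"
    using assms T Q by (intro add_mono mult_mono) auto
  also have "\<dots> = (real a ^ 3 + real a ^ 2) * \<bar>h\<bar> ^ 3" by (simp add: algebra_simps)
  also have "\<dots> \<le> real (Suc a) ^ 3 * \<bar>h\<bar> ^ 3"
    by (intro mult_right_mono zero_le_power) (auto simp: power3_eq_cube power2_eq_square algebra_simps)
  finally show ?case unfolding eq[symmetric] by (simp add: h_def)
qed auto

text \<open>Linear terms cancel by the martingale property. With total rates discordance over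
  \<open>n\<close> and over \<open>m\<close>, the squares of the jumps of \<open>M\<close> add up to
  discordance times \<open>m + n\<close>, their cubes to discordance times \<open>m^2 + n^2\<close>.
  The latter cancels a power of the normalisation and leaves an error of order \<open>n^-3\<close>,
  small compared with the order \<open>n^-2\<close> of \<open>lam\<close>.\<close>

lemma generator_weight_power:
  assumes m: "m > 0" and n: "n > 0" and "k \<le> m" "l \<le> n"
  shows "\<bar>generator m n (\<lambda>k l. degree_weight m n k l ^ a) (real k) (real l) -
    real a * (real a - 1) / 2 * degree_weight m n k l ^ (a - 2) * discordance m n k l * (real m + real n) /
      (real m ^ 2 + real n ^ 2) ^ 2\<bar> \<le> 2 * real m * real a ^ 3 / real n ^ 3"
proof -
  define D where "D = real m ^ 2 + real n ^ 2"
  have mn: "real m \<ge> 1" "real n \<ge> 1" using m n by auto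
  have kl: "0 \<le> real k" "real k \<le> real m" "0 \<le> real l" "real l \<le> real n" using assms by auto
  have D: "D > 0" "real n ^ 2 \<le> D" using mn by (auto simp: D_def add_pos_pos)
  define Y where "Y = degree_weight m n (real k) (real l)"
  define T where "T = (\<lambda>h. real a * Y ^ (a - 1) * h + real a * (real a - 1) / 2 * Y ^ (a - 2) * h ^ 2)"
  have wr: "0 \<le> degree_weight m n u v \<and> degree_weight m n u v \<le> 1"
    if "0 \<le> u" "u \<le> real m" "0 \<le> v" "v \<le> real n" for u v
    using weight_bounds that by blast
  have ws: "degree_weight m n (real k + u) (real l + v) = Y + (real m * u + real n * v) / D" for u v
    using D by (simp add: degree_weight_def Y_def D_def[symmetric] field_simps)
  \<comment> \<open>The expansion requires both points in the unit interval; a jump out of the grid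
    may violate this, but its rate is 0.\<close>
  have step: "\<bar>r * ((Y + h) ^ a - Y ^ a) - r * T h\<bar> \<le> r * (real a ^ 3 * \<bar>h\<bar> ^ 3)"
    if "r \<ge> 0" "r \<noteq> 0 \<Longrightarrow> 0 \<le> Y + h \<and> Y + h \<le> 1" for r h
  proof (cases "r = 0")
    case False
    have "\<bar>(Y + h) ^ a - Y ^ a - T h\<bar> \<le> real a ^ 3 * \<bar>h\<bar> ^ 3"
      using taylor_power[of Y "Y + h" a] wr[OF kl] that(2)[OF False]
      by (simp add: T_def Y_def algebra_simps)
    hence "r * \<bar>(Y + h) ^ a - Y ^ a - T h\<bar> \<le> r * (real a ^ 3 * \<bar>h\<bar> ^ 3)"
      using that by (intro mult_left_mono)
    moreover have "r * ((Y + h) ^ a - Y ^ a) - r * T h = r * ((Y + h) ^ a - Y ^ a - T h)"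
      by (simp add: algebra_simps)
    ultimately show ?thesis using that(1) by (simp add: abs_mult)
  qed simp
  define r1 r2 r3 r4 where "r1 = real k * (real n - real l) / real n" and "r2 = (real m - real k) * real l / real n"
    and "r3 = real l * (real m - real k) / real m" and "r4 = (real n - real l) * real k / real m"
  have g: "generator m n (\<lambda>k l. degree_weight m n k l ^ a) (real k) (real l) =
     r1 * ((Y + real n / D) ^ a - Y ^ a) + r2 * ((Y + (- real n / D)) ^ a - Y ^ a) +
     r3 * ((Y + real m / D) ^ a - Y ^ a) + r4 * ((Y + (- real m / D)) ^ a - Y ^ a)"
    using ws[of 0 1] ws[of 0 "-1"] ws[of 1 0] ws[of "-1" 0]
    by (simp add: generator_def r1_def r2_def r3_def r4_def Y_def[symmetric])
  have b1: "\<bar>r1 * ((Y + real n / D) ^ a - Y ^ a) - r1 * T (real n / D)\<bar> \<le> r1 * (real a ^ 3 * \<bar>real n / D\<bar> ^ 3)"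
  proof (rule step)
    assume "r1 \<noteq> 0"
    hence "l < n" using assms by (auto simp: r1_def)
    thus "0 \<le> Y + real n / D \<and> Y + real n / D \<le> 1"
      using ws[of 0 1] wr[of "real k" "real l + 1"] kl by simp
  qed (use kl in \<open>simp add: r1_def\<close>)
  have b2: "\<bar>r2 * ((Y + (- real n / D)) ^ a - Y ^ a) - r2 * T (- real n / D)\<bar> \<le> r2 * (real a ^ 3 * \<bar>- real n / D\<bar> ^ 3)"
  proof (rule step)
    assume "r2 \<noteq> 0"
    hence "0 < l" by (cases l) (auto simp: r2_def)
    thus "0 \<le> Y + (- real n / D) \<and> Y + (- real n / D) \<le> 1"
      using ws[of 0 "-1"] wr[of "real k" "real l - 1"] kl by simp
  qed (use kl in \<open>simp add: r2_def\<close>)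
  have b3: "\<bar>r3 * ((Y + real m / D) ^ a - Y ^ a) - r3 * T (real m / D)\<bar> \<le> r3 * (real a ^ 3 * \<bar>real m / D\<bar> ^ 3)"
  proof (rule step)
    assume "r3 \<noteq> 0"
    hence "k < m" using assms by (auto simp: r3_def)
    thus "0 \<le> Y + real m / D \<and> Y + real m / D \<le> 1"
      using ws[of 1 0] wr[of "real k + 1" "real l"] kl by simp
  qed (use kl in \<open>simp add: r3_def\<close>)
  have b4: "\<bar>r4 * ((Y + (- real m / D)) ^ a - Y ^ a) - r4 * T (- real m / D)\<bar> \<le> r4 * (real a ^ 3 * \<bar>- real m / D\<bar> ^ 3)"
  proof (rule step)
    assume "r4 \<noteq> 0"
    hence "0 < k" by (cases k) (auto simp: r4_def)
    thus "0 \<le> Y + (- real m / D) \<and> Y + (- real m / D) \<le> 1"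
      using ws[of "-1" 0] wr[of "real k - 1" "real l"] kl by simp
  qed (use kl in \<open>simp add: r4_def\<close>)
  have rates: "r1 + r2 = discordance m n k l / real n" "r3 + r4 = discordance m n k l / real m"
    by (auto simp: r1_def r2_def r3_def r4_def discordance_def add_divide_distrib mult_ac)
  have drift: "(r1 - r2) * real n + (r3 - r4) * real m = 0"
  proof -
    have "r1 * real n = k * (real n - l)" "r2 * real n = (real m - k) * l"
      "r3 * real m = l * (real m - k)" "r4 * real m = (real n - l) * k"
      using mn by (auto simp: r1_def r2_def r3_def r4_def)
    thus ?thesis by (simp add: left_diff_distrib algebra_simps)
  qed
  have main: "r1 * T (real n / D) + r2 * T (- real n / D) + r3 * T (real m / D) + r4 * T (- real m / D) =
    real a * (real a - 1) / 2 * Y ^ (a - 2) * discordance m n k l * (real m + real n) / D ^ 2"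
  proof -
    have "r1 * T (real n / D) + r2 * T (- real n / D) + r3 * T (real m / D) + r4 * T (- real m / D) =
      real a * Y ^ (a - 1) * ((r1 - r2) * real n + (r3 - r4) * real m) / D +
      real a * (real a - 1) / 2 * Y ^ (a - 2) * ((r1 + r2) * real n ^ 2 + (r3 + r4) * real m ^ 2) / D ^ 2"
      by (simp add: T_def power_divide algebra_simps add_divide_distrib diff_divide_distrib)
    also have "(r1 + r2) * real n ^ 2 + (r3 + r4) * real m ^ 2 = discordance m n k l * (real m + real n)"
      unfolding rates using mn by (simp add: power2_eq_square algebra_simps)
    finally show ?thesis unfolding drift by (simp add: mult_ac)
  qed
  have err: "r1 * (real a ^ 3 * \<bar>real n / D\<bar> ^ 3) + r2 * (real a ^ 3 * \<bar>- real n / D\<bar> ^ 3) +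
    r3 * (real a ^ 3 * \<bar>real m / D\<bar> ^ 3) + r4 * (real a ^ 3 * \<bar>- real m / D\<bar> ^ 3) \<le> 2 * real m * real a ^ 3 / real n ^ 3"
  proof -
    have "r1 * (real a ^ 3 * \<bar>real n / D\<bar> ^ 3) + r2 * (real a ^ 3 * \<bar>- real n / D\<bar> ^ 3) +
      r3 * (real a ^ 3 * \<bar>real m / D\<bar> ^ 3) + r4 * (real a ^ 3 * \<bar>- real m / D\<bar> ^ 3) =
      real a ^ 3 * ((r1 + r2) * real n ^ 3 + (r3 + r4) * real m ^ 3) / D ^ 3"
      using D by (simp add: power_divide algebra_simps add_divide_distrib)
    also have "(r1 + r2) * real n ^ 3 + (r3 + r4) * real m ^ 3 = discordance m n k l * D"
      unfolding rates D_def using mn by (simp add: power2_eq_square power3_eq_cube algebra_simps)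
    also have "real a ^ 3 * (discordance m n k l * D) / D ^ 3 = real a ^ 3 * discordance m n k l / D ^ 2"
      using D by (simp add: power2_eq_square power3_eq_cube)
    also have "\<dots> \<le> real a ^ 3 * (2 * real m * real n) / (real n ^ 2) ^ 2"
      using D mn discordance_bounds[OF kl] by (intro frac_le mult_left_mono power_mono mult_nonneg_nonneg) auto
    also have "\<dots> = 2 * real m * real a ^ 3 / real n ^ 3"
      using mn by (simp add: field_simps power2_eq_square power3_eq_cube)
    finally show ?thesis .
  qed
  show ?thesis unfolding D_def[symmetric] Y_def[symmetric] main[symmetric] g
    using b1 b2 b3 b4 err by linarith
qed

section \<open>Convergence of moments\<close>

text \<open>\<open>F\<close> and each of its two interpolated boundary values contribute at most
  \<open>B\<close>.\<close>

lemma (in qs_law) generator_mean_le: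
  assumes "\<And>k l. k \<le> m \<Longrightarrow> l \<le> n \<Longrightarrow> \<bar>F (real k) (real l)\<bar> \<le> B"
  shows "\<bar>E (A F)\<bar> \<le> lam * (3 * B)"
proof -
  have "\<bar>E (\<lambda>k l. F k l - F 0 0 * (1 - degree_weight m n k l) - F (real m) (real n) * degree_weight m n k l)\<bar> \<le> 3 * B"
  proof (rule mean_abs_le)
    fix k l assume kl: "k \<le> m" "l \<le> n"
    define w where "w = degree_weight m n (real k) (real l)"
    have w: "0 \<le> w" "w \<le> 1" using kl weight_bounds[of "real k" m "real l" n] by (auto simp: w_def)
    have B: "\<bar>F (real k) (real l)\<bar> \<le> B" "\<bar>F 0 0\<bar> \<le> B" "\<bar>F (real m) (real n)\<bar> \<le> B"
      using assms[of k l] assms[of 0 0] assms[of m n] kl by auto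
    have "\<bar>F 0 0 * (1 - w)\<bar> \<le> B * 1" "\<bar>F (real m) (real n) * w\<bar> \<le> B * 1"
      unfolding abs_mult using B w by (intro mult_mono; force)+
    thus "\<bar>F (real k) (real l) - F 0 0 * (1 - degree_weight m n (real k) (real l)) -
      F (real m) (real n) * degree_weight m n (real k) (real l)\<bar> \<le> 3 * B"
      using B(1) unfolding w_def[symmetric] by linarith
  qed
  thus ?thesis unfolding generator_mean abs_mult using lam_nonneg by (simp add: mult_left_mono)
qed

text \<open>Validity for large \<open>n\<close> only, as the excluded small graphs require; every
  property of the sequence below is an eventual one or a limit.\<close>

locale qs_sequence =
  fixes m :: nat and p :: "nat \<Rightarrow> nat \<Rightarrow> nat \<Rightarrow> real" and lam :: "nat \<Rightarrow> real"
  assumes m_pos: "1 \<le> m"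
    and qs: "\<forall>\<^sub>F n in sequentially. qs_law m n (p n) (lam n)"
begin

abbreviation "mean_at n \<equiv> mean m n (p n)"

definition moment :: "nat \<Rightarrow> nat \<Rightarrow> real" where
  "moment j n = mean_at n (\<lambda>k l. (l / real n) ^ j)"

text \<open>The killing rate on the diffusive time scale: multiplied by \<open>n^2 / m\<close>, the
  generator acts on functions of \<open>x\<close> approximately as \<open>x * (1 - x) * f''\<close>,
  for which the uniform density decays at rate 2.\<close>

definition rate :: "nat \<Rightarrow> real" where
  "rate n = real n ^ 2 * lam n / real m"

lemma eventually_qs:
  assumes "\<And>n. qs_law m n (p n) (lam n) \<Longrightarrow> n \<ge> N \<Longrightarrow> P n"
  shows "\<forall>\<^sub>F n in sequentially. P n"
  using qs eventually_ge_at_top[of N] by eventually_elim (use assms in auto)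

lemma mean_tendsto_0:
  assumes "\<And>n k l. n \<ge> 2 \<Longrightarrow> k \<le> m \<Longrightarrow> l \<le> n \<Longrightarrow> \<bar>\<phi> n (real k) (real l)\<bar> \<le> C / real n"
  shows "(\<lambda>n. mean_at n (\<phi> n)) \<longlonglongrightarrow> 0"
proof (rule Lim_null_comparison)
  show "\<forall>\<^sub>F n in sequentially. norm (mean_at n (\<phi> n)) \<le> C / real n"
  proof (rule eventually_qs[of 2])
    fix n assume "qs_law m n (p n) (lam n)" "n \<ge> 2"
    then interpret qs_law m n "p n" "lam n" by simp
    show "norm (mean_at n (\<phi> n)) \<le> C / real n"
      unfolding real_norm_def by (rule mean_abs_le) (use assms \<open>n \<ge> 2\<close> in auto)
  qed
  show "(\<lambda>n. C / real n) \<longlonglongrightarrow> 0" by real_asymp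
qed

lemma rate_bounds: "\<forall>\<^sub>F n in sequentially. 0 \<le> rate n \<and> rate n \<le> 2 * (1 + real m ^ 2)"
proof (rule eventually_qs[of 2])
  fix n assume "qs_law m n (p n) (lam n)" "n \<ge> 2"
  then interpret qs_law m n "p n" "lam n" by simp
  have "real n ^ 2 * lam n \<le> 2 * real m * (1 + real m ^ 2)"
    using lam_le n_ge by (simp add: field_simps)
  thus "0 \<le> rate n \<and> rate n \<le> 2 * (1 + real m ^ 2)"
    using lam_nonneg m_pos by (simp add: rate_def field_simps)
qed

lemma moment_bounds: "\<forall>\<^sub>F n in sequentially. 0 \<le> moment j n \<and> moment j n \<le> 1 \<and> moment (Suc j) n \<le> moment j n"
proof (rule eventually_qs[of 2])
  fix n assume "qs_law m n (p n) (lam n)" "n \<ge> 2"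
  then interpret qs_law m n "p n" "lam n" by simp
  have "E (\<lambda>_ _. 0) \<le> moment j n" unfolding moment_def by (rule mean_mono) auto
  moreover have "moment j n \<le> E (\<lambda>_ _. 1)" unfolding moment_def
  proof (rule mean_mono)
    fix k l assume "l \<le> n"
    thus "(real l / real n) ^ j \<le> 1" by (intro power_le_one) (auto simp: divide_simps)
  qed
  moreover have "moment (Suc j) n \<le> moment j n" unfolding moment_def
  proof (rule mean_mono)
    fix k l assume "l \<le> n"
    thus "(real l / real n) ^ Suc j \<le> (real l / real n) ^ j"
      by (intro power_decreasing) (auto simp: divide_simps)
  qed
  ultimately show "0 \<le> moment j n \<and> moment j n \<le> 1 \<and> moment (Suc j) n \<le> moment j n"
    by (simp add: mean_const)
qed

text \<open>Multiplying the generator identity by \<open>m / n\<close> isolates the fast part: the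
  slow part and the killing term are bounded before that, so both become of order
  \<open>1 / n\<close>. Asymptotically, given \<open>x\<close>, the binomial moment of
  \<open>k\<close> of index \<open>i + 1\<close> is \<open>(m - i) * x / (i + 1)\<close> times that
  of index \<open>i\<close>, as for \<open>Bin(m, x)\<close>.\<close>

lemma binomial_recursion:
  "(\<lambda>n. mean_at n (\<lambda>k l. (l / real n) ^ j *
    ((real m - real i) * (l / real n) * (k gchoose i) - real (Suc i) * (k gchoose Suc i)))) \<longlonglongrightarrow> 0"
    (is "(\<lambda>n. mean_at n (?\<phi> n)) \<longlonglongrightarrow> 0")
proof (rule Lim_null_comparison)
  let ?B = "2 ^ m :: real"
  let ?c = "?B * (2 * real m * real j)" and ?C = "2 * real m * (1 + real m ^ 2)"
  show "\<forall>\<^sub>F n in sequentially. norm (mean_at n (?\<phi> n)) \<le> real m / real n * (?C * (3 * ?B) + ?c)"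
  proof (rule eventually_qs[of 2])
    fix n assume "qs_law m n (p n) (lam n)" "n \<ge> 2"
    then interpret qs_law m n "p n" "lam n" by simp
    have mn: "real m \<ge> 1" "real n \<ge> 2" using m_pos n_ge by auto
    define F where "F = (\<lambda>k l. (k gchoose Suc i) * (l / real n) ^ j)"
    define S where "S = (\<lambda>k l. (k gchoose Suc i) * (k * (1 - l / real n) * ((l / real n + 1 / real n) ^ j - (l / real n) ^ j) +
      (real m - k) * (l / real n) * ((l / real n - 1 / real n) ^ j - (l / real n) ^ j)))"
    have gb: "\<bar>real k gchoose Suc i\<bar> \<le> ?B" if "k \<le> m" for k
    proof -
      have "k choose Suc i \<le> 2 ^ k" by (rule binomial_le_pow2)
      also have "\<dots> \<le> 2 ^ m" using that by simp
      finally have "real (k choose Suc i) \<le> real (2 ^ m)" by (rule of_nat_mono)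
      thus ?thesis by (simp add: binomial_gbinomial[symmetric])
    qed
    have "A F k l = S k l + real n / real m * ?\<phi> n k l" for k l
      unfolding F_def S_def using mn by (intro generator_binomial_power) auto
    hence "?\<phi> n = (\<lambda>k l. real m / real n * (A F k l - S k l))" using mn by (simp add: fun_eq_iff)
    hence "E (?\<phi> n) = real m / real n * (E (A F) - E S)" by (simp only: mean_cmult mean_diff)
    moreover have "\<bar>E (A F)\<bar> \<le> ?C * (3 * ?B)"
    proof -
      have "\<bar>E (A F)\<bar> \<le> lam n * (3 * ?B)"
      proof (rule generator_mean_le)
        fix k l assume kl: "k \<le> m" "l \<le> n"
        have "\<bar>F (real k) (real l)\<bar> \<le> ?B * 1"
          unfolding F_def abs_mult using kl gb[of k] mn by (intro mult_mono) (auto intro!: power_le_one)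
        thus "\<bar>F (real k) (real l)\<bar> \<le> ?B" by simp
      qed
      also have "lam n \<le> ?C / real n ^ 2" by (rule lam_le)
      also have "\<dots> \<le> ?C / 1" using mn by (intro divide_left_mono) (auto intro!: one_le_power)
      finally show ?thesis by (simp add: mult_right_mono)
    qed
    moreover have "\<bar>E S\<bar> \<le> ?c"
    proof (rule mean_abs_le)
      fix k l assume kl: "k \<le> m" "l \<le> n"
      define x h where "x = real l / real n" and "h = 1 / real n"
      have x: "0 \<le> x" "x \<le> 1" and h: "0 \<le> h" "h \<le> 1" using kl mn by (auto simp: x_def h_def)
      have up: "\<bar>real k * (1 - x) * ((x + h) ^ j - x ^ j)\<bar> \<le> real m * 1 * real j"
      \<comment> \<open>For \<open>l = n\<close> the point \<open>x + h\<close> leaves the unit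
        interval, but the factor \<open>1 - x\<close> is 0.\<close>
      proof (cases "l = n")
        case False
        hence "real l + 1 \<le> real n" using kl by linarith
        hence xh: "x + h \<le> 1" using mn by (simp add: x_def h_def field_simps)
        have "norm ((x + h) ^ j - x ^ j) \<le> real j * norm ((x + h) - x)"
          using x h xh by (intro norm_power_diff) auto
        also have "\<dots> \<le> real j * 1" using h by (intro mult_left_mono) auto
        finally show ?thesis unfolding abs_mult using kl x by (intro mult_mono) auto
      qed (use mn in \<open>simp add: x_def\<close>)
      have down: "\<bar>(real m - real k) * x * ((x - h) ^ j - x ^ j)\<bar> \<le> real m * 1 * real j"
      proof (cases "l = 0")
        case False
        hence xh: "0 \<le> x - h" using mn by (simp add: x_def h_def field_simps)
        have "norm ((x - h) ^ j - x ^ j) \<le> real j * norm ((x - h) - x)"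
          using x h xh by (intro norm_power_diff) auto
        also have "\<dots> \<le> real j * 1" using h by (intro mult_left_mono) auto
        finally show ?thesis unfolding abs_mult using kl x by (intro mult_mono) auto
      qed (simp add: x_def)
      have "\<bar>real k * (1 - x) * ((x + h) ^ j - x ^ j) + (real m - real k) * x * ((x - h) ^ j - x ^ j)\<bar> \<le> 2 * real m * real j"
        using up down by linarith
      hence "\<bar>real k gchoose Suc i\<bar> * \<bar>real k * (1 - x) * ((x + h) ^ j - x ^ j) + (real m - real k) * x * ((x - h) ^ j - x ^ j)\<bar> \<le> ?c"
        using gb[OF kl(1)] by (intro mult_mono) auto
      thus "\<bar>S (real k) (real l)\<bar> \<le> ?c" unfolding S_def x_def h_def abs_mult .
    qed
    ultimately have "\<bar>E (A F) - E S\<bar> \<le> ?C * (3 * ?B) + ?c" by linarith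
    thus "norm (E (?\<phi> n)) \<le> real m / real n * (?C * (3 * ?B) + ?c)"
      unfolding \<open>E (?\<phi> n) = _\<close> real_norm_def abs_mult by (simp add: mult_left_mono divide_right_mono)
  qed
  show "(\<lambda>n. real m / real n * (?C * (3 * ?B) + ?c)) \<longlonglongrightarrow> 0"
    by (rule tendsto_mult_left_zero) real_asymp
qed

end

lemma bounded_mult_null:
  fixes u v :: "nat \<Rightarrow> real"
  assumes "\<forall>\<^sub>F n in sequentially. \<bar>u n\<bar> \<le> B" "v \<longlonglongrightarrow> 0"
  shows "(\<lambda>n. u n * v n) \<longlonglongrightarrow> 0"
proof (rule Lim_null_comparison)
  show "\<forall>\<^sub>F n in sequentially. norm (u n * v n) \<le> B * \<bar>v n\<bar>"
    using assms(1) by eventually_elim (auto simp: abs_mult intro: mult_right_mono)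
  show "(\<lambda>n. B * \<bar>v n\<bar>) \<longlonglongrightarrow> 0"
    using tendsto_mult_right_zero[OF tendsto_rabs_zero[OF assms(2)]] .
qed

text \<open>The difference of the bases is \<open>m * (k * n - m * l) / (n * D)\<close>, at most
  \<open>m^2 / n\<close> in absolute value. Hence the martingale and \<open>x\<close> have
  asymptotically the same moments.\<close>

lemma weight_power_diff:
  assumes "0 < m" "0 < n" "k \<le> m" "l \<le> n"
  shows "\<bar>degree_weight m n (real k) (real l) ^ j - (real l / real n) ^ j\<bar> \<le> real j * real m ^ 2 / real n"
proof -
  let ?Y = "degree_weight m n (real k) (real l)" and ?x = "real l / real n"
  define D where "D = real m ^ 2 + real n ^ 2"
  have mn: "real m \<ge> 1" "real n \<ge> 1" using assms by auto
  have D: "D > 0" "real n \<le> D"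
    using mn self_le_power[of "real n" 2] by (auto simp: D_def add_pos_pos add_increasing)
  have "?Y - ?x = real m * (real k * real n - real m * real l) / (real n * D)"
    using mn D unfolding degree_weight_def D_def[symmetric]
    by (simp add: field_simps) (simp add: D_def power2_eq_square algebra_simps)
  moreover have "\<bar>real k * real n - real m * real l\<bar> \<le> real m * real n"
  proof -
    have "real k * real n \<le> real m * real n" "real m * real l \<le> real m * real n"
      using assms by (auto intro!: mult_mono)
    moreover have "0 \<le> real k * real n" "0 \<le> real m * real l" by auto
    ultimately show ?thesis by linarith
  qed
  ultimately have eq: "\<bar>?Y - ?x\<bar> = real m * \<bar>real k * real n - real m * real l\<bar> / (real n * D)"
    and le: "\<bar>real k * real n - real m * real l\<bar> \<le> real m * real n"
    using mn D by (simp_all add: abs_mult)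
  have "\<bar>?Y - ?x\<bar> \<le> real m * (real m * real n) / (real n * D)"
    unfolding eq using mn D le by (intro divide_right_mono mult_left_mono) auto
  also have "\<dots> = real m ^ 2 / D" using mn by (simp add: power2_eq_square)
  also have "\<dots> \<le> real m ^ 2 / real n" using mn D by (intro divide_left_mono) auto
  finally have d: "\<bar>?Y - ?x\<bar> \<le> real m ^ 2 / real n" .
  have "norm (?Y ^ j - ?x ^ j) \<le> real j * norm (?Y - ?x)"
    using assms weight_bounds[of "real k" m "real l" n] by (intro norm_power_diff) auto
  also have "\<dots> \<le> real j * (real m ^ 2 / real n)" using d by (intro mult_left_mono) auto
  finally show ?thesis by simp
qed

context qs_sequence
begin

lemma weight_moment:
  "(\<lambda>n. mean_at n (\<lambda>k l. degree_weight m n k l ^ j) - moment j n) \<longlonglongrightarrow> 0"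
proof -
  have "(\<lambda>n. mean_at n (\<lambda>k l. degree_weight m n k l ^ j - (l / real n) ^ j)) \<longlonglongrightarrow> 0"
    by (rule mean_tendsto_0[where C = "real j * real m ^ 2"]) (use weight_power_diff[of m] m_pos in auto)
  thus ?thesis by (simp add: mean_diff moment_def)
qed

text \<open>The adjoint Wright-Fisher equation in weak form, tested with \<open>x ^ (b + 2)\<close>.
  The term \<open>moment 1 n\<close> comes from the value 1 of the test function at
  \<open>(m, n)\<close>, which the martingale interpolates. The equation closes in \<open>x\<close>
  because the first binomial moment already allows replacing \<open>discordance / n\<close> by
  \<open>2 * m * x * (1 - x)\<close>.\<close>

lemma moment_recursion:
  "(\<lambda>n. real (b + 2) * real (b + 1) * (moment (b + 1) n - moment (b + 2) n) -
    rate n * (moment 1 n - moment (b + 2) n)) \<longlonglongrightarrow> 0"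
proof -
  define a where "a = b + 2"
  define c where "c = real a * (real a - 1) / 2"
  \<comment> \<open>The dependence on \<open>n\<close> of the quadratic term after multiplication by
    \<open>n^2\<close> and splitting off \<open>discordance / n\<close>; it tends to 1.\<close>
  define \<kappa> where "\<kappa> = (\<lambda>n. real n ^ 3 * (real m + real n) / (real m ^ 2 + real n ^ 2) ^ 2)"
  define V where "V = (\<lambda>n. mean_at n (\<lambda>k l. degree_weight m n k l ^ b * (discordance m n k l / real n)))"
  define Z where "Z = (\<lambda>n. mean_at n (\<lambda>k l. (l / real n) ^ b * (discordance m n k l / real n)))"
  define W where "W = (\<lambda>j n. mean_at n (\<lambda>k l. degree_weight m n k l ^ j))"
  have discordance_le: "\<bar>discordance m n (real k) (real l) / real n\<bar> \<le> 2 * real m"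
    if "n \<ge> 2" "k \<le> m" "l \<le> n" for n k l
    using that discordance_bounds[of "real k" m "real l" n] by (auto simp: field_simps)
  have V_bound: "\<forall>\<^sub>F n in sequentially. \<bar>V n\<bar> \<le> 2 * real m"
  proof (rule eventually_qs[of 2])
    fix n assume "qs_law m n (p n) (lam n)" "n \<ge> 2"
    then interpret qs_law m n "p n" "lam n" by simp
    show "\<bar>V n\<bar> \<le> 2 * real m" unfolding V_def
    proof (rule mean_abs_le)
      fix k l assume kl: "k \<le> m" "l \<le> n"
      have "\<bar>degree_weight m n (real k) (real l) ^ b * (discordance m n (real k) (real l) / real n)\<bar> \<le> 1 * (2 * real m)"
        unfolding abs_mult using kl discordance_le[OF n_ge kl] weight_bounds[of "real k" m "real l" n]
        by (intro mult_mono) (auto intro: power_le_one)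
      thus "\<bar>degree_weight m n (real k) (real l) ^ b * (discordance m n (real k) (real l) / real n)\<bar> \<le> 2 * real m" by simp
    qed
  qed
  have h1: "(\<lambda>n. mean_at n (\<lambda>k l. real n ^ 2 / real m * generator m n (\<lambda>k l. degree_weight m n k l ^ a) k l -
      c / real m * \<kappa> n * (degree_weight m n k l ^ b * (discordance m n k l / real n)))) \<longlonglongrightarrow> 0"
  proof (rule mean_tendsto_0)
    fix n k l :: nat assume n: "n \<ge> 2" and kl: "k \<le> m" "l \<le> n"
    let ?G = "generator m n (\<lambda>k l. degree_weight m n k l ^ a) (real k) (real l)"
    let ?T = "c * degree_weight m n (real k) (real l) ^ b * discordance m n (real k) (real l) * (real m + real n) / (real m ^ 2 + real n ^ 2) ^ 2"
    have "\<bar>?G - ?T\<bar> \<le> 2 * real m * real a ^ 3 / real n ^ 3"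
      using generator_weight_power[of m n k l a] n kl m_pos by (simp add: c_def a_def)
    hence "real n ^ 2 / real m * \<bar>?G - ?T\<bar> \<le> real n ^ 2 / real m * (2 * real m * real a ^ 3 / real n ^ 3)"
      by (intro mult_left_mono) auto
    also have "\<dots> = 2 * real a ^ 3 / real n" using n m_pos by (simp add: power2_eq_square power3_eq_cube)
    also have "real n ^ 2 / real m * \<bar>?G - ?T\<bar> = \<bar>real n ^ 2 / real m * ?G - real n ^ 2 / real m * ?T\<bar>"
      unfolding right_diff_distrib[symmetric] abs_mult by simp
    also have "real n ^ 2 / real m * ?T = c / real m * \<kappa> n * (degree_weight m n (real k) (real l) ^ b * (discordance m n (real k) (real l) / real n))"
      using n by (simp add: \<kappa>_def power2_eq_square power3_eq_cube)
    finally show "\<bar>real n ^ 2 / real m * ?G - c / real m * \<kappa> n * (degree_weight m n (real k) (real l) ^ b * (discordance m n (real k) (real l) / real n))\<bar>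
      \<le> 2 * real a ^ 3 / real n" .
  qed
  have h2: "\<forall>\<^sub>F n in sequentially. real n ^ 2 / real m * mean_at n (generator m n (\<lambda>k l. degree_weight m n k l ^ a)) = rate n * (W 1 n - W a n)"
  proof (rule eventually_qs[of 2])
    fix n assume "qs_law m n (p n) (lam n)" "n \<ge> 2"
    then interpret qs_law m n "p n" "lam n" by simp
    have "real m ^ 2 + real n ^ 2 > 0" using m_pos n_ge by (simp add: add_pos_pos)
    hence "degree_weight m n 0 0 = 0" "degree_weight m n (real m) (real n) = 1"
      using m_pos n_ge by (auto simp: degree_weight_def power2_eq_square)
    hence e: "E (A (\<lambda>k l. degree_weight m n k l ^ a)) = - lam n * (W a n - W 1 n)"
      unfolding generator_mean W_def by (simp add: a_def mean_diff)
    show "real n ^ 2 / real m * E (A (\<lambda>k l. degree_weight m n k l ^ a)) = rate n * (W 1 n - W a n)"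
      unfolding e by (simp add: rate_def algebra_simps diff_divide_distrib)
  qed
  have t1: "(\<lambda>n. rate n * (W 1 n - W a n) - c / real m * \<kappa> n * V n) \<longlonglongrightarrow> 0"
    by (rule Lim_transform_eventually[OF h1], use h2 in eventually_elim)
       (simp only: mean_diff mean_cmult V_def)
  have t2: "(\<lambda>n. rate n * ((W 1 n - moment 1 n) - (W a n - moment a n))) \<longlonglongrightarrow> 0"
  proof (rule bounded_mult_null)
    show "\<forall>\<^sub>F n in sequentially. \<bar>rate n\<bar> \<le> 2 * (1 + real m ^ 2)"
      using rate_bounds by eventually_elim auto
    show "(\<lambda>n. (W 1 n - moment 1 n) - (W a n - moment a n)) \<longlonglongrightarrow> 0"
      using tendsto_diff[OF weight_moment[of 1] weight_moment[of a]] by (simp add: W_def)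
  qed
  have t3: "(\<lambda>n. V n * (\<kappa> n - 1)) \<longlonglongrightarrow> 0"
  proof (rule bounded_mult_null[OF V_bound])
    show "(\<lambda>n. \<kappa> n - 1) \<longlonglongrightarrow> 0" unfolding \<kappa>_def by real_asymp
  qed
  have t4: "(\<lambda>n. V n - Z n) \<longlonglongrightarrow> 0"
  proof -
    have "(\<lambda>n. mean_at n (\<lambda>k l. (degree_weight m n k l ^ b - (l / real n) ^ b) * (discordance m n k l / real n))) \<longlonglongrightarrow> 0"
    proof (rule mean_tendsto_0)
      fix n k l :: nat assume n: "n \<ge> 2" and kl: "k \<le> m" "l \<le> n"
      have "\<bar>(degree_weight m n (real k) (real l) ^ b - (real l / real n) ^ b) * (discordance m n (real k) (real l) / real n)\<bar>
        \<le> (real b * real m ^ 2 / real n) * (2 * real m)"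
        unfolding abs_mult[of "_ - _"] using weight_power_diff[of m n k l b] discordance_le[of n k l] n kl m_pos
        by (intro mult_mono) auto
      thus "\<bar>(degree_weight m n (real k) (real l) ^ b - (real l / real n) ^ b) * (discordance m n (real k) (real l) / real n)\<bar>
        \<le> (real b * real m ^ 2 * (2 * real m)) / real n" by simp
    qed
    thus ?thesis by (simp only: V_def Z_def mean_diff left_diff_distrib)
  qed
  have t5: "(\<lambda>n. Z n - 2 * real m * (moment (b + 1) n - moment (b + 2) n)) \<longlonglongrightarrow> 0"
  proof -
    define R where "R = (\<lambda>j n. mean_at n (\<lambda>k l. (l / real n) ^ j * (real m * (l / real n) - k)))"
    have R: "R j \<longlonglongrightarrow> 0" for j using binomial_recursion[of j 0] by (simp add: R_def)
    \<comment> \<open>From \<open>k * (1 - x) + (m - k) * x = k + m * x - 2 * k * x\<close>,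
      replacing each \<open>k\<close> by \<open>m * x\<close>; the null sequences \<open>R\<close>
      measure the replacement, with the coefficients -1 and 2 of the two occurrences.\<close>
    have "Z n = - 1 * R b n + (2 * R (b + 1) n + (2 * real m * moment (b + 1) n - 2 * real m * moment (b + 2) n))"
      if "n > 0" for n
      unfolding Z_def R_def moment_def mean_cmult[symmetric] mean_add[symmetric] mean_diff[symmetric]
    proof (rule mean_cong)
      fix k l
      define x where "x = real l / real n"
      have eq: "discordance m n (real k) (real l) / real n = real k * (1 - x) + (real m - real k) * x"
        using that by (simp add: discordance_def x_def field_simps)
      show "(real l / real n) ^ b * (discordance m n (real k) (real l) / real n) =
         - 1 * ((real l / real n) ^ b * (real m * (real l / real n) - real k)) +
         (2 * ((real l / real n) ^ (b + 1) * (real m * (real l / real n) - real k)) +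
         (2 * real m * (real l / real n) ^ (b + 1) - 2 * real m * (real l / real n) ^ (b + 2)))"
        unfolding eq x_def[symmetric] by (simp add: algebra_simps)
    qed
    hence "\<forall>\<^sub>F n in sequentially. - R b n + 2 * R (b + 1) n = Z n - 2 * real m * (moment (b + 1) n - moment (b + 2) n)"
      by (intro eventually_mono[OF eventually_gt_at_top[of 0]]) (simp add: algebra_simps)
    moreover have "(\<lambda>n. - R b n + 2 * R (b + 1) n) \<longlonglongrightarrow> - 0 + 2 * 0" by (intro tendsto_intros R)
    ultimately show ?thesis using Lim_transform_eventually by force
  qed
  \<comment> \<open>Five errors add up to the claim: the Taylor remainder, moments of the martingale
    against those of \<open>x\<close>, \<open>\<kappa>\<close> against 1, the power of the
    martingale against that of \<open>x\<close> inside \<open>V\<close>, and \<open>k\<close>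
    against \<open>m * x\<close>.\<close>
  have "(\<lambda>n. - (rate n * (W 1 n - W a n) - c / real m * \<kappa> n * V n) +
      rate n * ((W 1 n - moment 1 n) - (W a n - moment a n)) -
      c / real m * (V n * (\<kappa> n - 1) + (V n - Z n) + (Z n - 2 * real m * (moment (b + 1) n - moment (b + 2) n)))) \<longlonglongrightarrow>
      - 0 + 0 - c / real m * (0 + 0 + 0)"
    by (intro tendsto_add tendsto_diff tendsto_minus tendsto_mult tendsto_const t1 t2 t3 t4 t5)
  moreover have "- (rate n * (W 1 n - W a n) - c / real m * \<kappa> n * V n) +
      rate n * ((W 1 n - moment 1 n) - (W a n - moment a n)) -
      c / real m * (V n * (\<kappa> n - 1) + (V n - Z n) + (Z n - 2 * real m * (moment (b + 1) n - moment (b + 2) n))) =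
      2 * c * (moment (b + 1) n - moment (b + 2) n) - rate n * (moment 1 n - moment a n)" for n
  proof -
    have "c / real m * (V n * (\<kappa> n - 1) + (V n - Z n) + (Z n - 2 * real m * (moment (b + 1) n - moment (b + 2) n))) =
      c / real m * \<kappa> n * V n - 2 * c * (moment (b + 1) n - moment (b + 2) n)"
      using m_pos by (simp add: algebra_simps) 
    thus ?thesis by (simp add: algebra_simps)
  qed
  moreover have "2 * c = real (b + 2) * real (b + 1)" by (simp add: c_def a_def)
  ultimately show ?thesis by (simp add: a_def)
qed

text \<open>The relation between moments in a mixture of atoms at 0 and 1 with the uniform law of
  weight \<open>6 * (moment 1 n - moment 2 n)\<close>: the atoms drop out of the differences, so
  their weights stay open here. The case \<open>b = 0\<close> of the recursion yields
  \<open>rate n\<close> near 2 only where \<open>w n\<close> stays away from 0, which is not known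
  yet; but \<open>(2 - rate n) * w n\<close> is null, and that suffices since all differences are
  bounded by multiples of \<open>w n\<close>.\<close>

lemma moment_difference:
  "(\<lambda>n. (moment 1 n - moment (a + 1) n) - 3 * (moment 1 n - moment 2 n) * (real a / real (a + 2))) \<longlonglongrightarrow> 0"
proof (induction a)
  case (Suc a)
  show ?case
  \<comment> \<open>The induction step divides by
    \<open>K = (a + 2) * (a + 1) - 2 = (a + 3) * a\<close>, so it can only start from
    \<open>a = 1\<close>, where the claim is an identity.\<close>
  proof (cases "a = 0")
    case False
    define w where "w = (\<lambda>n. moment 1 n - moment 2 n)"
    define d where "d = (\<lambda>a n. moment 1 n - moment (a + 1) n)"
    have IH: "(\<lambda>n. d a n - 3 * w n * (real a / real (a + 2))) \<longlonglongrightarrow> 0"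
      using Suc by (simp add: d_def w_def)
    have w0: "(\<lambda>n. (2 - rate n) * w n) \<longlonglongrightarrow> 0"
      using moment_recursion[of 0] by (simp add: w_def algebra_simps numeral_2_eq_2)
    \<comment> \<open>Consecutive powers differ by \<open>x ^ j * (x * (1 - x))\<close>, which is at
      most \<open>x * (1 - x)\<close>.\<close>
    have step: "\<forall>\<^sub>F n in sequentially. moment (Suc (Suc j)) n \<le> moment (Suc j) n \<and> moment (Suc j) n - moment (Suc (Suc j)) n \<le> w n" for j
    proof (rule eventually_qs[of 2])
      fix n assume "qs_law m n (p n) (lam n)" "n \<ge> 2"
      then interpret qs_law m n "p n" "lam n" by simp
      have "E (\<lambda>_ _. 0) \<le> E (\<lambda>k l. (l / real n) ^ Suc j - (l / real n) ^ Suc (Suc j))"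
      proof (rule mean_mono)
        fix k l assume "l \<le> n"
        hence "(real l / real n) ^ Suc (Suc j) \<le> (real l / real n) ^ Suc j"
          by (intro power_decreasing) (auto simp: divide_simps)
        thus "0 \<le> (real l / real n) ^ Suc j - (real l / real n) ^ Suc (Suc j)" by simp
      qed
      moreover have "E (\<lambda>k l. (l / real n) ^ Suc j - (l / real n) ^ Suc (Suc j)) \<le> E (\<lambda>k l. (l / real n) ^ 1 - (l / real n) ^ 2)"
      proof (rule mean_mono)
        fix k l assume l: "l \<le> n"
        define x where "x = real l / real n"
        have x: "0 \<le> x" "x \<le> 1" using l by (auto simp: x_def divide_simps)
        have "x ^ Suc j - x ^ Suc (Suc j) = x ^ j * (x * (1 - x))" by (simp add: algebra_simps)
        also have "\<dots> \<le> 1 * (x * (1 - x))" using x by (intro mult_right_mono power_le_one) auto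
        finally show "(real l / real n) ^ Suc j - (real l / real n) ^ Suc (Suc j) \<le> (real l / real n) ^ 1 - (real l / real n) ^ 2"
          by (simp add: x_def algebra_simps power2_eq_square)
      qed
      ultimately show "moment (Suc (Suc j)) n \<le> moment (Suc j) n \<and> moment (Suc j) n - moment (Suc (Suc j)) n \<le> w n"
        by (simp add: w_def moment_def mean_diff mean_const)
    qed
    have d: "\<forall>\<^sub>F n in sequentially. 0 \<le> d j n \<and> d j n \<le> real j * w n" for j
    proof (induction j)
      case (Suc j)
      with step[of j] show ?case
        by eventually_elim (auto simp: d_def algebra_simps)
    qed (simp add: d_def)
    have dL: "(\<lambda>n. (2 - rate n) * d (Suc a) n) \<longlonglongrightarrow> 0"
    proof (rule Lim_null_comparison)
      show "\<forall>\<^sub>F n in sequentially. norm ((2 - rate n) * d (Suc a) n) \<le> real (Suc a) * \<bar>(2 - rate n) * w n\<bar>"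
        using d[of "Suc a"] d[of 1]
      proof eventually_elim
        case (elim n)
        hence "\<bar>2 - rate n\<bar> * \<bar>d (Suc a) n\<bar> \<le> \<bar>2 - rate n\<bar> * \<bar>real (Suc a) * w n\<bar>"
          by (intro mult_left_mono) auto
        thus ?case by (simp add: abs_mult mult_ac)
      qed
      show "(\<lambda>n. real (Suc a) * \<bar>(2 - rate n) * w n\<bar>) \<longlonglongrightarrow> 0"
        by (intro tendsto_mult_right_zero tendsto_rabs_zero w0)
    qed
    have r: "(\<lambda>n. real (a + 2) * real (a + 1) * (d (a + 1) n - d a n) - rate n * d (a + 1) n) \<longlonglongrightarrow> 0"
      using moment_recursion[of a] by (simp add: d_def)
    define K where "K = (real a + 3) * real a"
    have K: "K > 0" using False by (simp add: K_def)
    have "(\<lambda>n. ((real (a + 2) * real (a + 1) * (d (a + 1) n - d a n) - rate n * d (a + 1) n) - (2 - rate n) * d (Suc a) n +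
      real (a + 2) * real (a + 1) * (d a n - 3 * w n * (real a / real (a + 2)))) / K) \<longlonglongrightarrow> (0 - 0 + real (a + 2) * real (a + 1) * 0) / K"
      by (intro tendsto_divide tendsto_add tendsto_diff tendsto_mult tendsto_const r dL IH) (use K in auto)
    moreover have "((real (a + 2) * real (a + 1) * (d (a + 1) n - d a n) - rate n * d (a + 1) n) - (2 - rate n) * d (Suc a) n +
      real (a + 2) * real (a + 1) * (d a n - 3 * w n * (real a / real (a + 2)))) / K =
      d (Suc a) n - 3 * w n * (real (Suc a) / real (Suc a + 2))" for n
    proof -
      have "(real (a + 2) * real (a + 1) * (d (a + 1) n - d a n) - rate n * d (a + 1) n) - (2 - rate n) * d (Suc a) n +
        real (a + 2) * real (a + 1) * (d a n - 3 * w n * (real a / real (a + 2))) =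
        K * d (Suc a) n - real (a + 2) * real (a + 1) * (3 * w n * (real a / real (a + 2)))"
        by (simp add: K_def algebra_simps)
      also have "real (a + 2) * real (a + 1) * (3 * w n * (real a / real (a + 2))) = K * (3 * w n * (real (Suc a) / real (Suc a + 2)))"
        by (simp add: K_def) (simp add: field_simps)
      finally show ?thesis using K by (simp add: diff_divide_distrib)
    qed
    ultimately show ?thesis by (simp add: d_def w_def)
  qed (simp add: numeral_2_eq_2 diff_divide_distrib)
qed simp

end

section \<open>Exclusion of atoms and identification of the limiting moments\<close>

context qs_sequence
begin

lemma qs_sequence_flip: "qs_sequence m (\<lambda>n k l. p n (m - k) (n - l)) lam"
proof
  show "\<forall>\<^sub>F n in sequentially. qs_law m n (\<lambda>k l. p n (m - k) (n - l)) (lam n)"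
    using qs by eventually_elim (rule qs_law.qs_law_flip)
qed (rule m_pos)

text \<open>High moments see only an atom at 1, and \<open>upper_tail\<close> makes them small
  uniformly in \<open>n\<close>; letting \<open>a\<close> grow in \<open>moment_difference\<close>
  leaves the mean as \<open>3 * w\<close>. The index \<open>J\<close> is fixed before
  \<open>n\<close>; the error \<open>6 / (J + 2)\<close> is what \<open>3 * w\<close> loses through
  the factor \<open>J / (J + 2)\<close>, as \<open>w \<le> 1\<close>.\<close>

lemma moment_1_minus_w: "(\<lambda>n. moment 1 n - 3 * (moment 1 n - moment 2 n)) \<longlonglongrightarrow> 0"
proof (rule LIMSEQ_I)
  fix e :: real assume e: "0 < e"
  define K where "K = 8 * real m * (1 + real m ^ 2) * (2 * real m ^ 2 + 3) * (1 + real m) ^ 2"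
  have "(\<lambda>J. K / sqrt (real J) + 6 / (real J + 2)) \<longlonglongrightarrow> 0" by real_asymp
  hence "\<forall>\<^sub>F J in sequentially. K / sqrt (real J) + 6 / (real J + 2) < e / 2"
    by (rule order_tendstoD) (use e in auto)
  with eventually_ge_at_top[of 1] have "\<forall>\<^sub>F J in sequentially. 1 \<le> J \<and> K / sqrt (real J) + 6 / (real J + 2) < e / 2"
    by eventually_elim auto
  then obtain J where J: "1 \<le> J" "K / sqrt (real J) + 6 / (real J + 2) < e / 2"
    by (auto simp: eventually_sequentially)
  have "\<forall>\<^sub>F n in sequentially. \<bar>(moment 1 n - moment (J + 1) n) - 3 * (moment 1 n - moment 2 n) * (real J / real (J + 2))\<bar> < e / 2"
    using moment_difference[of J, THEN tendsto_rabs_zero] by (rule order_tendstoD) (use e in auto)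
  moreover have "\<forall>\<^sub>F n in sequentially. moment (J + 1) n \<le> K / sqrt (real J)"
  proof (rule eventually_qs[of J])
    fix n assume "qs_law m n (p n) (lam n)" "n \<ge> J"
    then interpret qs_law m n "p n" "lam n" by simp
    show "moment (J + 1) n \<le> K / sqrt (real J)"
      using upper_tail[OF J(1) \<open>n \<ge> J\<close>] by (simp add: moment_def K_def)
  qed
  ultimately have "\<forall>\<^sub>F n in sequentially. norm (moment 1 n - 3 * (moment 1 n - moment 2 n) - 0) < e"
    using moment_bounds[of 1] moment_bounds[of 2] moment_bounds[of "J + 1"]
  proof eventually_elim
    case (elim n)
    define w where "w = moment 1 n - moment 2 n"
    have w: "0 \<le> w" "w \<le> 1" using elim by (auto simp: w_def numeral_2_eq_2)
    have J': "real J / real (J + 2) = 1 - 2 / (real J + 2)" by (simp add: field_simps)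
    have "moment 1 n - 3 * w = ((moment 1 n - moment (J + 1) n) - 3 * w * (real J / real (J + 2))) +
      moment (J + 1) n - 6 * w / (real J + 2)"
      unfolding J' by (simp add: algebra_simps)
    moreover have "6 * w / (real J + 2) \<le> 6 / (real J + 2)" "0 \<le> 6 * w / (real J + 2)" 
      using w by (auto intro!: divide_right_mono)
    ultimately show ?case using elim J(2) unfolding w_def[symmetric] real_norm_def by linarith
  qed
  thus "\<exists>no. \<forall>n\<ge>no. norm (moment 1 n - 3 * (moment 1 n - moment 2 n) - 0) < e"
    by (simp add: eventually_sequentially)
qed

text \<open>Exchanging the opinions preserves \<open>w\<close>, since \<open>x * (1 - x)\<close> is
  symmetric. So both \<open>moment 1\<close> and \<open>1 - moment 1\<close> approach
  \<open>3 * w\<close>; their sum gives \<open>w\<close> the limit \<open>1 / 6\<close>, and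
  \<open>moment_difference\<close> then fixes all other moments.\<close>

lemma moment_tendsto: "moment j \<longlonglongrightarrow> 1 / (real j + 1)"
proof -
  define w where "w = (\<lambda>n. moment 1 n - moment 2 n)"
  interpret flip: qs_sequence m "\<lambda>n k l. p n (m - k) (n - l)" lam by (rule qs_sequence_flip)
  have fl: "\<forall>\<^sub>F n in sequentially. flip.moment 1 n = 1 - moment 1 n \<and> flip.moment 1 n - flip.moment 2 n = w n"
  proof (rule eventually_qs[of 2])
    fix n assume "qs_law m n (p n) (lam n)" "n \<ge> 2"
    then interpret qs_law m n "p n" "lam n" by simp
    have "flip.moment 1 n = E (\<lambda>k l. 1 - (l / real n) ^ 1)"
      unfolding flip.moment_def mean_flip by (rule mean_cong) (use n_ge in \<open>auto simp: field_simps\<close>)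
    also have "\<dots> = 1 - moment 1 n" by (simp only: mean_diff mean_const moment_def)
    finally have 1: "flip.moment 1 n = 1 - moment 1 n" .
    have "flip.moment 2 n = E (\<lambda>k l. 1 - 2 * (l / real n) ^ 1 + (l / real n) ^ 2)"
      unfolding flip.moment_def mean_flip by (rule mean_cong) (use n_ge in \<open>auto simp: field_simps power2_eq_square\<close>)
    also have "\<dots> = 1 - 2 * moment 1 n + moment 2 n" by (simp only: mean_add mean_diff mean_cmult mean_const moment_def)
    finally show "flip.moment 1 n = 1 - moment 1 n \<and> flip.moment 1 n - flip.moment 2 n = w n"
      using 1 by (simp add: w_def)
  qed
  have c: "(\<lambda>n. moment 1 n - 3 * w n) \<longlonglongrightarrow> 0" using moment_1_minus_w by (simp add: w_def)
  have c': "(\<lambda>n. 1 - moment 1 n - 3 * w n) \<longlonglongrightarrow> 0"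
    by (rule Lim_transform_eventually[OF flip.moment_1_minus_w]) (use fl in eventually_elim, simp)
  have "(\<lambda>n. (1 - ((moment 1 n - 3 * w n) + (1 - moment 1 n - 3 * w n))) / 6) \<longlonglongrightarrow> (1 - (0 + 0)) / 6"
    by (intro tendsto_intros c c') auto
  moreover have "(1 - ((moment 1 n - 3 * w n) + (1 - moment 1 n - 3 * w n))) / 6 = w n" for n
    by (simp add: field_simps)
  ultimately have w: "w \<longlonglongrightarrow> 1 / 6" by simp
  have "(\<lambda>n. (moment 1 n - 3 * w n) + 3 * w n) \<longlonglongrightarrow> 0 + 3 * (1 / 6)" by (intro tendsto_intros c w)
  hence m1: "moment 1 \<longlonglongrightarrow> 1 / 2" by simp
  show ?thesis
  proof (cases j)
    case 0
    have "\<forall>\<^sub>F n in sequentially. 1 = moment 0 n"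
      by (rule eventually_qs[of 2]) (simp add: moment_def qs_law.mean_const)
    from Lim_transform_eventually[OF tendsto_const this] show ?thesis using 0 by simp
  next
    case (Suc a)
    have "(\<lambda>n. moment 1 n - (((moment 1 n - moment (a + 1) n) - 3 * w n * (real a / real (a + 2))) + 3 * w n * (real a / real (a + 2))))
      \<longlonglongrightarrow> 1 / 2 - (0 + 3 * (1 / 6) * (real a / real (a + 2)))"
      by (intro tendsto_diff tendsto_add tendsto_mult tendsto_const m1 w)
         (use moment_difference[of a] in \<open>simp add: w_def\<close>)
    moreover have "1 / 2 - (0 + 3 * (1 / 6) * (real a / real (a + 2))) = 1 / (real j + 1)"
      using Suc by (simp add: field_simps)
    ultimately show ?thesis using Suc by simp
  qed
qed

text \<open>Each use of \<open>binomial_recursion\<close> trades one index of the binomial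
  coefficient for one power of \<open>x\<close>, hence the induction over \<open>i\<close> with
  \<open>j\<close> arbitrary. The limit is the integral of \<open>(m choose i) * x ^ (i + j)\<close>
  over the unit interval.\<close>

lemma binomial_moment_tendsto:
  "(\<lambda>n. mean_at n (\<lambda>k l. (k gchoose i) * (l / real n) ^ j)) \<longlonglongrightarrow> (real m gchoose i) / (real (i + j) + 1)"
proof (induction i arbitrary: j)
  case 0
  show ?case using moment_tendsto[of j] by (simp add: moment_def[abs_def])
next
  case (Suc i)
  define B where "B = (\<lambda>i j n. mean_at n (\<lambda>k l. (k gchoose i) * (l / real n) ^ j))"
  define R where "R = (\<lambda>n. mean_at n (\<lambda>k l. (l / real n) ^ j *
    ((real m - real i) * (l / real n) * (k gchoose i) - real (Suc i) * (k gchoose Suc i))))"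
  have "R n = (real m - real i) * B i (Suc j) n - real (Suc i) * B (Suc i) j n" for n
    unfolding B_def R_def mean_cmult[symmetric] mean_diff[symmetric]
    by (rule mean_cong) (simp add: algebra_simps)
  hence eq: "B (Suc i) j = (\<lambda>n. ((real m - real i) * B i (Suc j) n - R n) / real (Suc i))"
    by (simp add: fun_eq_iff)
  have "B (Suc i) j \<longlonglongrightarrow> ((real m - real i) * ((real m gchoose i) / (real (i + Suc j) + 1)) - 0) / real (Suc i)"
    unfolding eq by (intro tendsto_intros) (use Suc[of "Suc j"] binomial_recursion[of j i] in \<open>simp_all add: B_def R_def\<close>)
  also have "((real m - real i) * ((real m gchoose i) / (real (i + Suc j) + 1)) - 0) / real (Suc i) =
      ((real m - real i) * (real m gchoose i)) / real (Suc i) / (real (Suc i + j) + 1)"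
    by simp
  also have "((real m - real i) * (real m gchoose i)) / real (Suc i) = real m gchoose Suc i"
    using gbinomial_shift[of i "real m"] by (simp add: field_simps)
  finally show ?case by (simp add: B_def)
qed

end

section \<open>From joint moments to continuous test functions\<close>

definition density_integral :: "nat \<Rightarrow> nat \<Rightarrow> (real \<Rightarrow> real) \<Rightarrow> real" where
  "density_integral m k f = integral {0..1} (\<lambda>x. f x * (real (m choose k) * x ^ k * (1 - x) ^ (m - k)))"

lemma density_integrable:
  assumes "continuous_on {0..1} f"
  shows "(\<lambda>x. f x * (real (m choose k) * x ^ k * (1 - x) ^ (m - k))) integrable_on {0..1::real}"
  by (intro integrable_continuous_interval continuous_intros assms)

text \<open>The binomial moment of \<open>Bin(m, x)\<close>: choosing \<open>i\<close> of the
  successes first leaves a complete binomial sum over the other \<open>m - i\<close> trials.\<close>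

lemma binomial_weighted_sum:
  assumes "i \<le> m"
  shows "(\<Sum>k\<le>m. real (k choose i) * (real (m choose k) * x ^ k * (1 - x) ^ (m - k))) = real (m choose i) * (x :: real) ^ i"
proof -
  have "(\<Sum>k\<le>m. real (k choose i) * (real (m choose k) * x ^ k * (1 - x) ^ (m - k))) =
    (\<Sum>k=i..m. real (k choose i) * (real (m choose k) * x ^ k * (1 - x) ^ (m - k)))"
    by (rule sum.mono_neutral_right) (auto simp: not_le)
  also have "\<dots> = (\<Sum>k=0 + i..(m - i) + i. real (k choose i) * (real (m choose k) * x ^ k * (1 - x) ^ (m - k)))"
    using assms by simp
  also have "\<dots> = (\<Sum>k=0..m - i. real ((k + i) choose i) * (real (m choose (k + i)) * x ^ (k + i) * (1 - x) ^ (m - (k + i))))"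
    by (rule sum.shift_bounds_cl_nat_ivl)
  also have "\<dots> = (\<Sum>k=0..m - i. real (m choose i) * x ^ i * (real ((m - i) choose k) * x ^ k * (1 - x) ^ (m - i - k)))"
  proof (rule sum.cong[OF refl])
    fix k assume k: "k \<in> {0..m - i}"
    have "(m choose (k + i)) * ((k + i) choose i) = (m choose i) * ((m - i) choose k)"
      using choose_mult[of i "k + i" m] k assms by simp
    hence "real (m choose (k + i)) * real ((k + i) choose i) = real (m choose i) * real ((m - i) choose k)"
      by (metis of_nat_mult)
    hence "real ((k + i) choose i) * (real (m choose (k + i)) * x ^ (k + i) * (1 - x) ^ (m - (k + i))) =
      real (m choose i) * real ((m - i) choose k) * x ^ (k + i) * (1 - x) ^ (m - (k + i))"
      by (simp add: mult_ac)
    thus "real ((k + i) choose i) * (real (m choose (k + i)) * x ^ (k + i) * (1 - x) ^ (m - (k + i))) =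
      real (m choose i) * x ^ i * (real ((m - i) choose k) * x ^ k * (1 - x) ^ (m - i - k))"
      by (simp add: power_add mult_ac add.commute diff_diff_left)
  qed
  also have "\<dots> = real (m choose i) * x ^ i * (\<Sum>k\<le>m - i. real ((m - i) choose k) * x ^ k * (1 - x) ^ (m - i - k))"
    by (simp add: sum_distrib_left atLeast0AtMost)
  also have "(\<Sum>k\<le>m - i. real ((m - i) choose k) * x ^ k * (1 - x) ^ (m - i - k)) = (x + (1 - x)) ^ (m - i)"
    by (rule binomial_ring[symmetric])
  finally show ?thesis by simp
qed

lemma density_integral_power:
  assumes "i \<le> m"
  shows "(\<Sum>k\<le>m. real (k choose i) * density_integral m k (\<lambda>x. x ^ j)) = real (m choose i) / (real (i + j) + 1)"
proof -
  have "(\<Sum>k\<le>m. real (k choose i) * density_integral m k (\<lambda>x. x ^ j)) =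
    integral {0..1} (\<lambda>x. \<Sum>k\<le>m. real (k choose i) * (x ^ j * (real (m choose k) * x ^ k * (1 - x) ^ (m - k))))"
    unfolding density_integral_def
    by (subst integral_sum) (auto intro!: integrable_continuous_interval continuous_intros)
  also have "\<dots> = integral {0..1} (\<lambda>x. real (m choose i) * x ^ (i + j))"
  proof (rule integral_cong)
    fix x :: real
    have "(\<Sum>k\<le>m. real (k choose i) * (x ^ j * (real (m choose k) * x ^ k * (1 - x) ^ (m - k)))) =
      x ^ j * (\<Sum>k\<le>m. real (k choose i) * (real (m choose k) * x ^ k * (1 - x) ^ (m - k)))"
      by (simp add: sum_distrib_left mult_ac)
    thus "(\<Sum>k\<le>m. real (k choose i) * (x ^ j * (real (m choose k) * x ^ k * (1 - x) ^ (m - k)))) = real (m choose i) * x ^ (i + j)"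
      using binomial_weighted_sum[OF assms, of x] by (simp add: power_add mult_ac)
  qed
  also have "\<dots> = real (m choose i) / (real (i + j) + 1)"
  proof -
    define N where "N = i + j"
    have "((\<lambda>x. real (m choose i) * x ^ N) has_integral
      real (m choose i) * 1 ^ Suc N / real (Suc N) - real (m choose i) * 0 ^ Suc N / real (Suc N)) {0..1}"
    proof (rule fundamental_theorem_of_calculus)
      fix x :: real
      have "((\<lambda>x. real (m choose i) * x ^ Suc N / real (Suc N)) has_real_derivative
          real (m choose i) * (real (Suc N) * x ^ N) / real (Suc N)) (at x within {0..1})"
        by (auto intro!: derivative_eq_intros simp del: power_Suc of_nat_Suc)
      thus "((\<lambda>x. real (m choose i) * x ^ Suc N / real (Suc N)) has_vector_derivative real (m choose i) * x ^ N) (at x within {0..1})"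
        by (simp add: has_real_derivative_iff_has_vector_derivative del: power_Suc of_nat_Suc)
    qed simp
    hence "integral {0..1} (\<lambda>x. real (m choose i) * x ^ N) = real (m choose i) / (real N + 1)"
      by (subst integral_unique) (assumption, simp add: add.commute)
    thus ?thesis unfolding N_def .
  qed
  finally show ?thesis .
qed

lemma density_integral_diff_le:
  assumes "continuous_on {0..1} f" "continuous_on {0..1} g" "k \<le> m"
    and "\<And>x. x \<in> {0..1} \<Longrightarrow> \<bar>f x - g x\<bar> \<le> e"
  shows "\<bar>density_integral m k f - density_integral m k g\<bar> \<le> e * density_integral m k (\<lambda>_. 1)"
proof -
  let ?r = "\<lambda>x. real (m choose k) * x ^ k * (1 - x) ^ (m - k)"
  have "density_integral m k f - density_integral m k g = integral {0..1} (\<lambda>x. f x * ?r x - g x * ?r x)"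
    unfolding density_integral_def by (intro integral_diff[symmetric] density_integrable assms)
  moreover have "norm (integral {0..1} (\<lambda>x. f x * ?r x - g x * ?r x)) \<le> integral {0..1} (\<lambda>x. e * (1 * ?r x))"
  proof (rule integral_norm_bound_integral)
    fix x :: real assume x: "x \<in> {0..1}"
    have "?r x \<ge> 0" using x by auto
    hence "\<bar>f x - g x\<bar> * ?r x \<le> e * ?r x" using assms(4)[OF x] by (intro mult_right_mono)
    thus "norm (f x * ?r x - g x * ?r x) \<le> e * (1 * ?r x)"
      using \<open>?r x \<ge> 0\<close> unfolding left_diff_distrib[symmetric] real_norm_def abs_mult[of "f x - g x"] by simp
  qed (intro integrable_diff density_integrable integrable_continuous_interval continuous_intros assms)+
  ultimately show ?thesis by (simp add: density_integral_def)
qed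

context qs_sequence
begin

text \<open>The matrix of the \<open>k choose r\<close> is triangular with ones on the diagonal, so
  the contributions of single fibres are recovered from the binomial moments by descending recursion
  in \<open>r\<close>.\<close>

lemma fibre_power_tendsto:
  assumes "r \<le> m"
  shows "(\<lambda>n. \<Sum>l\<le>n. p n r l * (real l / real n) ^ j) \<longlonglongrightarrow> density_integral m r (\<lambda>x. x ^ j)"
  using assms
proof (induction "m - r" arbitrary: r rule: less_induct)
  case less
  define a where "a = (\<lambda>r n. \<Sum>l\<le>n. p n r l * (real l / real n) ^ j)"
  define \<alpha> where "\<alpha> = (\<lambda>r. density_integral m r (\<lambda>x. x ^ j))"
  define S where "S = (\<lambda>n. \<Sum>k\<le>m. real (k choose r) * a k n)"
  have split: "(\<Sum>k\<le>m. real (k choose r) * b k) = b r + (\<Sum>k\<in>{r<..m}. real (k choose r) * b k)" for b :: "nat \<Rightarrow> real"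
  proof -
    have "(\<Sum>k\<le>m. real (k choose r) * b k) = (\<Sum>k\<in>insert r {r<..m}. real (k choose r) * b k)"
      using less.prems by (intro sum.mono_neutral_right) (auto simp: not_le)
    thus ?thesis by simp
  qed
  have "S = (\<lambda>n. mean_at n (\<lambda>k l. (k gchoose r) * (l / real n) ^ j))"
    by (simp add: S_def a_def mean_def sum_distrib_left binomial_gbinomial mult_ac fun_eq_iff)
  hence "S \<longlonglongrightarrow> real (m choose r) / (real (r + j) + 1)"
    using binomial_moment_tendsto[of r j] by (simp add: binomial_gbinomial)
  hence "(\<lambda>n. S n - (\<Sum>k\<in>{r<..m}. real (k choose r) * a k n)) \<longlonglongrightarrow>
    (\<Sum>k\<le>m. real (k choose r) * \<alpha> k) - (\<Sum>k\<in>{r<..m}. real (k choose r) * \<alpha> k)"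
    unfolding \<alpha>_def density_integral_power[OF less.prems]
    by (intro tendsto_intros) (use less in \<open>auto simp: a_def \<alpha>_def\<close>)
  thus ?case unfolding S_def split by (simp add: a_def \<alpha>_def)
qed

text \<open>Uniform approximation by polynomials, whose powers are already treated; each fibre has
  mass at most 1, so the error of the approximation is uniform in \<open>n\<close>.\<close>

lemma fibre_tendsto:
  assumes r: "r \<le> m" and f: "continuous_on {0..1} f"
  shows "(\<lambda>n. \<Sum>l\<le>n. p n r l * f (real l / real n)) \<longlonglongrightarrow> density_integral m r f"
proof (rule LIMSEQ_I)
  fix e :: real assume e: "0 < e"
  define d where "d = density_integral m r (\<lambda>_. 1)"
  define M where "M = (\<lambda>n g. \<Sum>l\<le>n. p n r l * g (real l / real n))"
  have d: "d \<ge> 0" unfolding d_def density_integral_def by (intro integral_nonneg density_integrable[where f = "\<lambda>_. 1"]) auto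
  \<comment> \<open>The errors \<open>e'\<close>, \<open>e'\<close> and \<open>e' * d\<close> occur;
    their sum is \<open>e / 2\<close>.\<close>
  define e' where "e' = e / (2 * (d + 2))"
  have e': "e' > 0" using e d by (simp add: e'_def)
  obtain g where g: "real_polynomial_function g" "\<And>x. x \<in> {0..1} \<Longrightarrow> \<bar>f x - g x\<bar> < e'"
    using Stone_Weierstrass_real_polynomial_function[OF compact_Icc f e'] by blast
  then obtain c N where gN: "g = (\<lambda>x. \<Sum>i\<le>N. c i * x ^ i)" by (auto simp: real_polynomial_function_iff_sum)
  have gc: "continuous_on {0..1} g" unfolding gN by (intro continuous_intros)
  have "(\<lambda>n. \<Sum>i\<le>N. c i * M n (\<lambda>x. x ^ i)) \<longlonglongrightarrow> (\<Sum>i\<le>N. c i * density_integral m r (\<lambda>x. x ^ i))"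
    unfolding M_def by (intro tendsto_intros fibre_power_tendsto r)
  also have "(\<lambda>n. \<Sum>i\<le>N. c i * M n (\<lambda>x. x ^ i)) = (\<lambda>n. M n g)"
  proof
    fix n
    have "(\<Sum>i\<le>N. c i * M n (\<lambda>x. x ^ i)) = (\<Sum>i\<le>N. \<Sum>l\<le>n. p n r l * (c i * (real l / real n) ^ i))"
      unfolding M_def sum_distrib_left by (simp only: mult_ac)
    also have "\<dots> = M n g" unfolding M_def gN sum_distrib_left by (rule sum.swap)
    finally show "(\<Sum>i\<le>N. c i * M n (\<lambda>x. x ^ i)) = M n g" .
  qed
  also have "(\<Sum>i\<le>N. c i * density_integral m r (\<lambda>x. x ^ i)) = density_integral m r g"
  proof -
    have "density_integral m r g = integral {0..1} (\<lambda>x. \<Sum>i\<le>N. c i * (x ^ i * (real (m choose r) * x ^ r * (1 - x) ^ (m - r))))"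
      unfolding density_integral_def gN sum_distrib_right by (simp only: mult.assoc)
    also have "\<dots> = (\<Sum>i\<le>N. c i * density_integral m r (\<lambda>x. x ^ i))"
      unfolding density_integral_def
      by (subst integral_sum) (auto intro!: integrable_continuous_interval continuous_intros)
    finally show ?thesis by simp
  qed
  finally have "(\<lambda>n. M n g) \<longlonglongrightarrow> density_integral m r g" .
  hence "\<forall>\<^sub>F n in sequentially. dist (M n g) (density_integral m r g) < e'"
    using e' by (rule tendstoD)
  moreover have "\<forall>\<^sub>F n in sequentially. \<bar>M n f - M n g\<bar> \<le> e'"
  proof (rule eventually_qs[of 2])
    fix n assume "qs_law m n (p n) (lam n)" "n \<ge> 2"
    then interpret qs_law m n "p n" "lam n" by simp
    have "\<bar>M n f - M n g\<bar> = \<bar>\<Sum>l\<le>n. p n r l * (f (real l / real n) - g (real l / real n))\<bar>"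
      by (simp add: M_def sum_subtractf algebra_simps)
    also have "\<dots> \<le> (\<Sum>l\<le>n. p n r l * e')"
    proof (rule order.trans[OF sum_abs], rule sum_mono)
      fix l assume "l \<in> {..n}"
      hence "real l / real n \<in> {0..1}" by (auto simp: divide_simps)
      hence "\<bar>f (real l / real n) - g (real l / real n)\<bar> \<le> e'" using g(2) by (simp add: less_imp_le)
      thus "\<bar>p n r l * (f (real l / real n) - g (real l / real n))\<bar> \<le> p n r l * e'"
        unfolding abs_mult using nonneg[of r l] by (simp add: mult_left_mono)
    qed
    also have "\<dots> = (\<Sum>l\<le>n. p n r l) * e'" by (simp add: sum_distrib_right)
    also have "(\<Sum>l\<le>n. p n r l) \<le> (\<Sum>k\<le>m. \<Sum>l\<le>n. p n k l)"
      using r by (intro member_le_sum[of r "{..m}" "\<lambda>k. \<Sum>l\<le>n. p n k l"]) (auto intro: sum_nonneg nonneg)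
    also have "\<dots> = 1" by (rule total)
    finally show "\<bar>M n f - M n g\<bar> \<le> e'" using e' by simp
  qed
  ultimately have "\<forall>\<^sub>F n in sequentially. norm (M n f - density_integral m r f) < e"
  proof eventually_elim
    case (elim n)
    have "\<bar>density_integral m r f - density_integral m r g\<bar> \<le> e' * d"
      unfolding d_def using g(2) by (intro density_integral_diff_le f gc r) (simp add: less_imp_le)
    hence "\<bar>M n f - density_integral m r f\<bar> < e' + e' + e' * d"
      using elim unfolding dist_real_def by linarith
    also have "\<dots> = e' * (2 * (d + 2)) / 2" by (simp add: algebra_simps)
    also have "\<dots> = e / 2" using d by (simp add: e'_def)
    also have "\<dots> < e" using e by simp
    finally show ?case by simp
  qed
  thus "\<exists>no. \<forall>n\<ge>no. norm ((\<Sum>l\<le>n. p n r l * f (real l / real n)) - density_integral m r f) < e"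
    by (simp add: eventually_sequentially M_def)
qed

end

section \<open>The limit law\<close>

abbreviation binomial_weight :: "nat \<Rightarrow> nat \<Rightarrow> real \<Rightarrow> real" where
  "binomial_weight m k x \<equiv> real (m choose k) * x ^ k * (1 - x) ^ (m - k)"

lemma sigma_finite_unit_interval: "sigma_finite_measure (restrict_space lborel {0..1::real})"
  by (rule sigma_finite_measure_restrict_space) (auto simp: lborel.sigma_finite_measure_axioms)

lemma sets_limit_law: "sets (limit_law m) = sets (count_space {0..m} \<Otimes>\<^sub>M restrict_space borel {0..1::real})"
  unfolding limit_law_def sets_density
  by (intro sets_pair_measure_cong refl sets_restrict_space_cong) simp

lemma space_limit_law: "space (limit_law m) = {0..m} \<times> {0..1}"
  by (simp add: limit_law_def space_pair_measure space_restrict_space)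

lemma binomial_weight_measurable:
  "(\<lambda>(k, x). binomial_weight m k x) \<in> borel_measurable (count_space {0..m} \<Otimes>\<^sub>M restrict_space lborel {0..1::real})"
  by (rule measurable_pair_measure_countable1) (auto intro: measurable_restrict_space1)

lemma nn_integral_limit_law:
  assumes g: "g \<in> borel_measurable (limit_law m)"
  shows "(\<integral>\<^sup>+\<omega>. g \<omega> \<partial>limit_law m) =
    (\<Sum>k\<le>m. \<integral>\<^sup>+x. g (k, x) * ennreal (binomial_weight m k x) * indicator {0..1} x \<partial>lborel)"
proof -
  let ?P = "count_space {0..m} \<Otimes>\<^sub>M restrict_space lborel {0..1::real}"
  interpret sigma_finite_measure "restrict_space lborel {0..1::real}" by (rule sigma_finite_unit_interval)
  have [measurable]: "g \<in> borel_measurable ?P" using g by (simp add: limit_law_def)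
  note [measurable] = binomial_weight_measurable[of m]
  have "(\<integral>\<^sup>+\<omega>. g \<omega> \<partial>limit_law m) = (\<integral>\<^sup>+\<omega>. ennreal ((\<lambda>(k, x). binomial_weight m k x) \<omega>) * g \<omega> \<partial>?P)"
    unfolding limit_law_def by (subst nn_integral_density) (auto simp: case_prod_unfold)
  also have "\<dots> = (\<integral>\<^sup>+k. \<integral>\<^sup>+x. ennreal (binomial_weight m k x) * g (k, x) \<partial>restrict_space lborel {0..1} \<partial>count_space {0..m})"
    by (subst nn_integral_fst[symmetric]) auto
  also have "\<dots> = (\<Sum>k\<le>m. \<integral>\<^sup>+x. ennreal (binomial_weight m k x) * g (k, x) \<partial>restrict_space lborel {0..1})"
    by (simp add: nn_integral_count_space_finite atLeast0AtMost)
  finally show ?thesis by (simp add: nn_integral_restrict_space mult_ac)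
qed

lemma emeasure_limit_law_rectangle:
  assumes "A \<in> sets borel"
  shows "emeasure (limit_law m) {\<omega> \<in> space (limit_law m). fst \<omega> \<in> B \<and> snd \<omega> \<in> A} =
    (\<Sum>k\<le>m. indicator B k * (\<integral>\<^sup>+x. ennreal (binomial_weight m k x) * indicator (A \<inter> {0..1}) x \<partial>lborel))"
proof -
  let ?S = "{\<omega> \<in> space (limit_law m). fst \<omega> \<in> B \<and> snd \<omega> \<in> A}"
  have "?S = ({0..m} \<inter> B) \<times> (A \<inter> {0..1})" by (auto simp: space_limit_law)
  moreover have "A \<inter> {0..1} \<in> sets (restrict_space borel {0..1::real})"
    using assms by (auto simp: sets_restrict_space_iff)
  ultimately have S: "?S \<in> sets (limit_law m)" unfolding sets_limit_law by (auto intro!: pair_measureI)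
  have "emeasure (limit_law m) ?S = (\<integral>\<^sup>+\<omega>. indicator ?S \<omega> \<partial>limit_law m)" using S by simp
  also have "\<dots> = (\<Sum>k\<le>m. \<integral>\<^sup>+x. indicator ?S (k, x) * ennreal (binomial_weight m k x) * indicator {0..1} x \<partial>lborel)"
    by (rule nn_integral_limit_law) (use S in simp)
  also have "\<dots> = (\<Sum>k\<le>m. indicator B k * (\<integral>\<^sup>+x. ennreal (binomial_weight m k x) * indicator (A \<inter> {0..1}) x \<partial>lborel))"
  proof (rule sum.cong[OF refl])
    fix k assume "k \<in> {..m}"
    hence "(\<integral>\<^sup>+x. indicator ?S (k, x) * ennreal (binomial_weight m k x) * indicator {0..1} x \<partial>lborel) =
      (\<integral>\<^sup>+x. indicator B k * (ennreal (binomial_weight m k x) * indicator (A \<inter> {0..1}) x) \<partial>lborel)"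
      by (intro nn_integral_cong) (auto simp: space_limit_law indicator_def)
    also have "\<dots> = indicator B k * (\<integral>\<^sup>+x. ennreal (binomial_weight m k x) * indicator (A \<inter> {0..1}) x \<partial>lborel)"
      using assms by (intro nn_integral_cmult) auto
    finally show "(\<integral>\<^sup>+x. indicator ?S (k, x) * ennreal (binomial_weight m k x) * indicator {0..1} x \<partial>lborel) =
      indicator B k * (\<integral>\<^sup>+x. ennreal (binomial_weight m k x) * indicator (A \<inter> {0..1}) x \<partial>lborel)" .
  qed
  finally show ?thesis .
qed

lemma sum_binomial_weight: "(\<Sum>k\<le>m. binomial_weight m k x) = 1"
  using binomial_ring[of x "1 - x" m] by simp

lemma sets_beta_distribution [simp]: "sets (beta_distribution a b) = sets borel"
  by (simp add: beta_distribution_def)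

lemma prob_space_beta_distribution:
  assumes "0 < a" "0 < b"
  shows "prob_space (beta_distribution a b)"
proof
  have B: "Beta a b > 0" using assms by (simp add: Beta_def)
  have "((\<lambda>x. x powr (a - 1) * (1 - x) powr (b - 1)) has_integral Beta a b) {0<..<1}"
    using has_integral_Beta_real[OF assms] by (simp add: has_integral_Icc_iff_Ioo)
  hence "((\<lambda>x. x powr (a - 1) * (1 - x) powr (b - 1) / Beta a b) has_integral Beta a b / Beta a b) {0<..<1}"
    by (rule has_integral_divide)
  hence "((\<lambda>x. x powr (a - 1) * (1 - x) powr (b - 1) / Beta a b) has_integral 1) {0<..<1}"
    using B by simp
  hence I: "((\<lambda>x. if x \<in> {0<..<1} then x powr (a - 1) * (1 - x) powr (b - 1) / Beta a b else 0) has_integral 1) UNIV"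
    by (simp only: has_integral_restrict_UNIV)
  have eq: "(\<lambda>x. if x \<in> {0<..<1} then x powr (a - 1) * (1 - x) powr (b - 1) / Beta a b else 0) =
    (\<lambda>x. x powr (a - 1) * (1 - x) powr (b - 1) / Beta a b * indicator {0<..<1} x)"
    by (auto simp: fun_eq_iff)
  have "(\<integral>\<^sup>+x. ennreal (x powr (a - 1) * (1 - x) powr (b - 1) / Beta a b * indicator {0<..<1} x) \<partial>lborel) = ennreal 1"
    by (rule nn_integral_has_integral_lborel[OF _ _ I[unfolded eq]]) (use B in auto)
  thus "emeasure (beta_distribution a b) (space (beta_distribution a b)) = 1"
    unfolding beta_distribution_def by (subst emeasure_density) auto
qed

text \<open>This says that all fibres of the limit law have the same mass, which makes the first
  marginal uniform.\<close>

lemma binomial_Beta: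
  assumes "k \<le> m"
  shows "real (m choose k) * Beta (real k + 1) (real m - real k + 1) = 1 / (real m + 1)"
proof -
  have "Gamma (real k + 1) = fact k" "Gamma (real m - real k + 1) = fact (m - k)" "Gamma (real m + 2) = fact (m + 1)"
    using Gamma_fact[of k, where 'a = real] Gamma_fact[of "m - k", where 'a = real] Gamma_fact[of "m + 1", where 'a = real] assms
    by (simp_all add: add.commute add.left_commute of_nat_diff)
  hence "Beta (real k + 1) (real m - real k + 1) = fact k * fact (m - k) / fact (m + 1)"
    by (simp add: Beta_def add.commute)
  moreover have "real (m choose k) = fact m / (fact k * fact (m - k))" using binomial_fact[OF assms] by simp
  ultimately have "real (m choose k) * Beta (real k + 1) (real m - real k + 1) = fact m / fact (m + 1)" by simp
  also have "\<dots> = 1 / (real m + 1)" by (simp add: add.commute)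
  finally show ?thesis .
qed

text \<open>Inside the interval the density on fibre \<open>k\<close> is \<open>1 / (m + 1)\<close>
  times the Beta density. At 0 and 1 the two may differ, the Beta density being cut to the open
  interval; hence equality only almost everywhere.\<close>

lemma emeasure_beta_distribution:
  assumes "k \<le> m" and A: "A \<in> sets borel"
  shows "(\<integral>\<^sup>+x. ennreal (binomial_weight m k x) * indicator (A \<inter> {0..1}) x \<partial>lborel) =
    ennreal (1 / (real m + 1)) * emeasure (beta_distribution (real k + 1) (real m - real k + 1)) A"
proof -
  let ?B = "Beta (real k + 1) (real m - real k + 1)"
  have B: "?B > 0" using assms by (simp add: Beta_def)
  have c: "real (m choose k) = 1 / (real m + 1) * (1 / ?B)"
    unfolding mult_1_right times_divide_eq_right binomial_Beta[OF assms(1), symmetric] using B by simp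
  have "AE x in lborel. x \<noteq> (0::real)" "AE x in lborel. x \<noteq> (1::real)"
    by (rule AE_lborel_singleton)+
  hence "AE x in lborel. ennreal (binomial_weight m k x) * indicator (A \<inter> {0..1}) x =
    ennreal (1 / (real m + 1)) * (ennreal (x powr (real k + 1 - 1) * (1 - x) powr (real m - real k + 1 - 1) / ?B * indicator {0<..<1} x) * indicator A x)"
  proof eventually_elim
    case (elim x)
    show ?case
    proof (cases "0 < x \<and> x < 1")
      case True
      have "x powr (real k + 1 - 1) = x ^ k" "(1 - x) powr (real m - real k + 1 - 1) = (1 - x) ^ (m - k)"
        using True assms by (simp_all add: powr_realpow[symmetric] of_nat_diff)
      thus ?thesis using True B unfolding c
        by (simp add: ennreal_mult[symmetric] mult.assoc[symmetric] indicator_def)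
    next
      case False
      thus ?thesis using elim by (auto simp: indicator_def)
    qed
  qed
  hence "(\<integral>\<^sup>+x. ennreal (binomial_weight m k x) * indicator (A \<inter> {0..1}) x \<partial>lborel) =
    (\<integral>\<^sup>+x. ennreal (1 / (real m + 1)) * (ennreal (x powr (real k + 1 - 1) * (1 - x) powr (real m - real k + 1 - 1) / ?B * indicator {0<..<1} x) * indicator A x) \<partial>lborel)"
    by (rule nn_integral_cong_AE)
  also have "\<dots> = ennreal (1 / (real m + 1)) * emeasure (beta_distribution (real k + 1) (real m - real k + 1)) A"
    unfolding beta_distribution_def using A by (subst nn_integral_cmult) (auto simp: emeasure_density)
  finally show ?thesis .
qed

lemma emeasure_limit_law_beta:
  assumes A: "A \<in> sets borel"
  shows "emeasure (limit_law m) {\<omega> \<in> space (limit_law m). fst \<omega> \<in> B \<and> snd \<omega> \<in> A} =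
    (\<Sum>k\<le>m. indicator B k * (ennreal (1 / (real m + 1)) * emeasure (beta_distribution (real k + 1) (real m - real k + 1)) A))"
  unfolding emeasure_limit_law_rectangle[OF A] by (intro sum.cong refl) (simp add: emeasure_beta_distribution[OF _ A])

lemma emeasure_beta_UNIV:
  assumes "k \<le> m"
  shows "emeasure (beta_distribution (real k + 1) (real m - real k + 1)) UNIV = 1"
proof -
  interpret prob_space "beta_distribution (real k + 1) (real m - real k + 1)"
    by (rule prob_space_beta_distribution) (use assms in auto)
  show ?thesis using emeasure_space_1 by (simp add: beta_distribution_def)
qed

lemma emeasure_limit_law_fst:
  "emeasure (limit_law m) {\<omega> \<in> space (limit_law m). fst \<omega> \<in> B} = (\<Sum>k\<le>m. indicator B k * ennreal (1 / (real m + 1)))"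
  using emeasure_limit_law_beta[of UNIV m B] by (simp add: emeasure_beta_UNIV)

lemma prob_space_limit_law: "prob_space (limit_law m)"
proof
  have "emeasure (limit_law m) (space (limit_law m)) = (\<Sum>k\<le>m. ennreal (1 / (real m + 1)))"
    using emeasure_limit_law_fst[of m UNIV] by simp
  also have "\<dots> = ennreal (\<Sum>k\<le>m. 1 / (real m + 1))" by (rule sum_ennreal) simp
  also have "(\<Sum>k\<le>m. 1 / (real m + 1)) = 1" by simp
  finally show "emeasure (limit_law m) (space (limit_law m)) = 1" by simp
qed

lemma fst_limit_law_measurable: "fst \<in> limit_law m \<rightarrow>\<^sub>M count_space {0..m}"
  by (subst measurable_cong_sets[OF sets_limit_law refl]) simp

lemma fst_limit_law_measurable_UNIV: "fst \<in> limit_law m \<rightarrow>\<^sub>M count_space UNIV"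
proof -
  have "(\<lambda>x. x) \<in> count_space {0..m} \<rightarrow>\<^sub>M count_space UNIV" by simp
  from measurable_compose[OF fst_limit_law_measurable this] show ?thesis by simp
qed

lemma snd_limit_law_measurable: "snd \<in> limit_law m \<rightarrow>\<^sub>M restrict_space borel {0..1}"
  by (subst measurable_cong_sets[OF sets_limit_law refl]) simp

lemma snd_limit_law_measurable_borel: "snd \<in> limit_law m \<rightarrow>\<^sub>M borel"
proof -
  have "(\<lambda>x. x) \<in> restrict_space borel {0..1::real} \<rightarrow>\<^sub>M borel" by (simp add: measurable_restrict_space1)
  from measurable_compose[OF snd_limit_law_measurable this] show ?thesis by simp
qed

lemma distr_limit_law_fst: "distr (limit_law m) (count_space UNIV) fst = measure_pmf (pmf_of_set {0..m})"
proof (rule measure_eqI_countable[where A = UNIV])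
  fix k :: nat
  have "emeasure (distr (limit_law m) (count_space UNIV) fst) {k} = emeasure (limit_law m) {\<omega> \<in> space (limit_law m). fst \<omega> \<in> {k}}"
    by (subst emeasure_distr[OF fst_limit_law_measurable_UNIV]) (auto intro: arg_cong[where f = "emeasure _"])
  also have "\<dots> = (\<Sum>j\<le>m. indicator {k} j * ennreal (1 / (real m + 1)))" by (rule emeasure_limit_law_fst)
  also have "\<dots> = (if k \<le> m then ennreal (1 / (real m + 1)) else 0)"
    by (auto simp: indicator_def of_bool_def if_distrib[of "\<lambda>x. x * _"] cong: if_cong)
  also have "\<dots> = emeasure (measure_pmf (pmf_of_set {0..m})) {k}"
    by (simp add: emeasure_pmf_single pmf_of_set indicator_def add.commute)
  finally show "emeasure (distr (limit_law m) (count_space UNIV) fst) {k} = emeasure (measure_pmf (pmf_of_set {0..m})) {k}" .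
qed auto

text \<open>For each \<open>x\<close> the binomial weights sum to 1, which leaves Lebesgue
  measure.\<close>

lemma emeasure_limit_law_snd:
  assumes A: "A \<in> sets borel"
  shows "emeasure (limit_law m) {\<omega> \<in> space (limit_law m). snd \<omega> \<in> A} = emeasure lborel (A \<inter> {0..1})"
proof -
  have "emeasure (limit_law m) {\<omega> \<in> space (limit_law m). snd \<omega> \<in> A} =
    (\<Sum>k\<le>m. \<integral>\<^sup>+x. ennreal (binomial_weight m k x) * indicator (A \<inter> {0..1}) x \<partial>lborel)"
    using emeasure_limit_law_rectangle[OF A, of m UNIV] by simp
  also have "\<dots> = (\<integral>\<^sup>+x. (\<Sum>k\<le>m. ennreal (binomial_weight m k x) * indicator (A \<inter> {0..1}) x) \<partial>lborel)"
    by (rule nn_integral_sum[symmetric]) (use A in auto)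
  also have "\<dots> = (\<integral>\<^sup>+x. indicator (A \<inter> {0..1}) x \<partial>lborel)"
  proof (rule nn_integral_cong)
    fix x :: real
    show "(\<Sum>k\<le>m. ennreal (binomial_weight m k x) * indicator (A \<inter> {0..1}) x) = indicator (A \<inter> {0..1}) x"
    proof (cases "x \<in> A \<inter> {0..1}")
      case True
      hence "(\<Sum>k\<le>m. ennreal (binomial_weight m k x)) = ennreal (\<Sum>k\<le>m. binomial_weight m k x)"
        by (intro sum_ennreal) auto
      thus ?thesis using True unfolding sum_binomial_weight by simp
    qed simp
  qed
  also have "\<dots> = emeasure lborel (A \<inter> {0..1})" using A by (intro nn_integral_indicator) auto
  finally show ?thesis .
qed

lemma distr_limit_law_snd: "distr (limit_law m) borel snd = uniform_measure lborel {0..1}"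
proof (rule measure_eqI)
  fix A assume "A \<in> sets (distr (limit_law m) borel snd)"
  hence A: "A \<in> sets borel" by simp
  have "emeasure (distr (limit_law m) borel snd) A = emeasure (limit_law m) {\<omega> \<in> space (limit_law m). snd \<omega> \<in> A}"
    by (subst emeasure_distr[OF snd_limit_law_measurable_borel A]) (auto intro: arg_cong[where f = "emeasure _"])
  also have "\<dots> = emeasure (uniform_measure lborel {0..1}) A"
    using A by (simp add: emeasure_limit_law_snd Int_commute divide_ennreal_def)
  finally show "emeasure (distr (limit_law m) borel snd) A = emeasure (uniform_measure lborel {0..1}) A" .
qed simp

lemma emeasure_binomial_pmf:
  assumes "x \<in> {0..1}"
  shows "emeasure (measure_pmf (binomial_pmf m x)) A = (\<Sum>k\<le>m. indicator A k * ennreal (binomial_weight m k x))"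
proof -
  have sub: "set_pmf (binomial_pmf m x) \<subseteq> {..m}" using assms set_pmf_binomial_eq[of x m] by (auto split: if_splits)
  have "emeasure (measure_pmf (binomial_pmf m x)) A = (\<integral>\<^sup>+k. indicator A k \<partial>measure_pmf (binomial_pmf m x))" by simp
  also have "\<dots> = (\<Sum>k\<le>m. indicator A k * ennreal (pmf (binomial_pmf m x) k))"
    by (rule nn_integral_measure_pmf_support) (use sub in auto)
  also have "\<dots> = (\<Sum>k\<le>m. indicator A k * ennreal (binomial_weight m k x))"
    using assms by simp
  finally show ?thesis .
qed

lemma conditional_distribution_binomial:
  "conditional_distribution (limit_law m) (count_space UNIV) fst (restrict_space borel {0..1}) snd
      (\<lambda>x. measure_pmf (binomial_pmf m x))"
  unfolding conditional_distribution_def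
proof (intro conjI ballI)
  show "fst \<in> limit_law m \<rightarrow>\<^sub>M count_space UNIV" by (rule fst_limit_law_measurable_UNIV)
  show "snd \<in> limit_law m \<rightarrow>\<^sub>M restrict_space borel {0..1}" by (rule snd_limit_law_measurable)
  have meas: "(\<lambda>x. emeasure (measure_pmf (binomial_pmf m x)) A) \<in> borel_measurable (restrict_space borel {0..1})" for A
    by (subst measurable_cong[OF emeasure_binomial_pmf]) (auto simp: space_restrict_space intro!: measurable_restrict_space1)
  show "(\<lambda>x. measure_pmf (binomial_pmf m x)) \<in> restrict_space borel {0..1} \<rightarrow>\<^sub>M prob_algebra (count_space UNIV)"
    by (rule measurable_prob_algebraI) (auto intro!: measurable_subprob_algebra meas measure_pmf.prob_space_axioms prob_space_imp_subprob_space)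
  fix A :: "nat set" and B :: "real set" assume "B \<in> sets (restrict_space borel {0..1})"
  hence B: "B \<in> sets borel" "B \<subseteq> {0..1}" by (auto simp: sets_restrict_space_iff)
  have "emeasure (limit_law m) {\<omega> \<in> space (limit_law m). fst \<omega> \<in> A \<and> snd \<omega> \<in> B} =
    (\<Sum>k\<le>m. indicator A k * (\<integral>\<^sup>+x. ennreal (binomial_weight m k x) * indicator (B \<inter> {0..1}) x \<partial>lborel))"
    by (rule emeasure_limit_law_rectangle[OF B(1)])
  also have "\<dots> = (\<integral>\<^sup>+x. (\<Sum>k\<le>m. indicator A k * (ennreal (binomial_weight m k x) * indicator (B \<inter> {0..1}) x)) \<partial>lborel)"
    using B by (subst nn_integral_sum) (auto simp: nn_integral_cmult)
  \<comment> \<open>Inserting a factor 1, written as the sum of the binomial weights at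
    \<open>x\<close>, gives the integrand the shape of an integral under
    \<open>limit_law m\<close>.\<close>
  also have "\<dots> = (\<integral>\<^sup>+x. (\<Sum>k\<le>m. emeasure (measure_pmf (binomial_pmf m x)) A * indicator B x * ennreal (binomial_weight m k x) * indicator {0..1} x) \<partial>lborel)"
  proof (rule nn_integral_cong)
    fix x :: real
    show "(\<Sum>k\<le>m. indicator A k * (ennreal (binomial_weight m k x) * indicator (B \<inter> {0..1}) x)) =
      (\<Sum>k\<le>m. emeasure (measure_pmf (binomial_pmf m x)) A * indicator B x * ennreal (binomial_weight m k x) * indicator {0..1} x)"
    proof (cases "x \<in> B")
      case True
      hence x: "x \<in> {0..1}" using B by auto
      have "(\<Sum>k\<le>m. ennreal (binomial_weight m k x)) = ennreal (\<Sum>k\<le>m. binomial_weight m k x)"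
        using x by (intro sum_ennreal) auto
      hence "(\<Sum>k\<le>m. ennreal (binomial_weight m k x)) = 1" unfolding sum_binomial_weight by simp
      thus ?thesis using True x by (simp add: emeasure_binomial_pmf[OF x] sum_distrib_left[symmetric])
    qed simp
  qed
  also have "\<dots> = (\<Sum>k\<le>m. \<integral>\<^sup>+x. emeasure (measure_pmf (binomial_pmf m x)) A * indicator B x * ennreal (binomial_weight m k x) * indicator {0..1} x \<partial>lborel)"
  proof (rule nn_integral_sum)
    fix k
    \<comment> \<open>The explicit formula for the binomial law holds only on the unit interval;
      outside it the last indicator is 0, so it may be substituted on the whole line.\<close>
    have "(\<lambda>x. (\<Sum>j\<le>m. indicator A j * ennreal (binomial_weight m j x)) * indicator B x * ennreal (binomial_weight m k x) * indicator {0..1} x) \<in> borel_measurable lborel"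
      using B by measurable
    also have "(\<lambda>x. (\<Sum>j\<le>m. indicator A j * ennreal (binomial_weight m j x)) * indicator B x * ennreal (binomial_weight m k x) * indicator {0..1} x) =
      (\<lambda>x. emeasure (measure_pmf (binomial_pmf m x)) A * indicator B x * ennreal (binomial_weight m k x) * indicator {0..1} x)"
      by (auto simp: fun_eq_iff indicator_def emeasure_binomial_pmf)
    finally show "(\<lambda>x. emeasure (measure_pmf (binomial_pmf m x)) A * indicator B x * ennreal (binomial_weight m k x) * indicator {0..1} x) \<in> borel_measurable lborel" .
  qed
  also have "\<dots> = (\<integral>\<^sup>+\<omega>. emeasure (measure_pmf (binomial_pmf m (snd \<omega>))) A * indicator B (snd \<omega>) \<partial>limit_law m)"
    by (subst nn_integral_limit_law)
       (use B in \<open>auto intro!: borel_measurable_times_ennreal measurable_compose[OF snd_limit_law_measurable meas]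
         measurable_compose[OF snd_limit_law_measurable_borel borel_measurable_indicator]\<close>)
  also have "\<dots> = (\<integral>\<^sup>+x\<in>B. emeasure (measure_pmf (binomial_pmf m x)) A \<partial>distr (limit_law m) (restrict_space borel {0..1}) snd)"
    by (subst nn_integral_distr[OF snd_limit_law_measurable])
       (use meas B in \<open>auto intro!: borel_measurable_times_ennreal borel_measurable_indicator simp: sets_restrict_space_iff\<close>)
  finally show "emeasure (limit_law m) {\<omega> \<in> space (limit_law m). fst \<omega> \<in> A \<and> snd \<omega> \<in> B} =
    (\<integral>\<^sup>+x\<in>B. emeasure (measure_pmf (binomial_pmf m x)) A \<partial>distr (limit_law m) (restrict_space borel {0..1}) snd)" .
qed

lemma conditional_distribution_beta:
  "conditional_distribution (limit_law m) borel snd (count_space {0..m}) fst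
      (\<lambda>k. beta_distribution (real k + 1) (real m - real k + 1))"
  unfolding conditional_distribution_def
proof (intro conjI ballI)
  show "fst \<in> limit_law m \<rightarrow>\<^sub>M count_space {0..m}" by (rule fst_limit_law_measurable)
  show "snd \<in> limit_law m \<rightarrow>\<^sub>M borel" by (rule snd_limit_law_measurable_borel)
  show "(\<lambda>k. beta_distribution (real k + 1) (real m - real k + 1)) \<in> count_space {0..m} \<rightarrow>\<^sub>M prob_algebra borel"
    unfolding measurable_count_space_eq1
    by (auto simp: space_prob_algebra intro!: prob_space_beta_distribution)
  fix A :: "real set" and B :: "nat set" assume A: "A \<in> sets borel" and B: "B \<in> sets (count_space {0..m})"
  let ?b = "\<lambda>k. emeasure (beta_distribution (real k + 1) (real m - real k + 1)) A"
  have "emeasure (limit_law m) {\<omega> \<in> space (limit_law m). snd \<omega> \<in> A \<and> fst \<omega> \<in> B} =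
    (\<Sum>k\<le>m. indicator B k * (ennreal (1 / (real m + 1)) * ?b k))"
    using emeasure_limit_law_beta[OF A, of m B] by (simp add: conj_commute)
  also have "\<dots> = (\<Sum>k\<le>m. \<integral>\<^sup>+x. ?b k * indicator B k * ennreal (binomial_weight m k x) * indicator {0..1} x \<partial>lborel)"
  proof (rule sum.cong[OF refl])
    fix k assume k: "k \<in> {..m}"
    have "(\<integral>\<^sup>+x. ?b k * indicator B k * ennreal (binomial_weight m k x) * indicator {0..1} x \<partial>lborel) =
      ?b k * indicator B k * (\<integral>\<^sup>+x. ennreal (binomial_weight m k x) * indicator (UNIV \<inter> {0..1}) x \<partial>lborel)"
      by (subst nn_integral_cmult[symmetric]) (auto simp: mult.assoc)
    also have "\<dots> = ?b k * indicator B k * ennreal (1 / (real m + 1))"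
      using k by (subst emeasure_beta_distribution) (auto simp: emeasure_beta_UNIV)
    finally show "indicator B k * (ennreal (1 / (real m + 1)) * ?b k) =
      (\<integral>\<^sup>+x. ?b k * indicator B k * ennreal (binomial_weight m k x) * indicator {0..1} x \<partial>lborel)"
      by (simp add: mult_ac)
  qed
  also have "\<dots> = (\<integral>\<^sup>+\<omega>. ?b (fst \<omega>) * indicator B (fst \<omega>) \<partial>limit_law m)"
    by (subst nn_integral_limit_law) (auto intro!: measurable_compose[OF fst_limit_law_measurable])
  also have "\<dots> = (\<integral>\<^sup>+k\<in>B. ?b k \<partial>distr (limit_law m) (count_space {0..m}) fst)"
    by (subst nn_integral_distr[OF fst_limit_law_measurable]) auto
  finally show "emeasure (limit_law m) {\<omega> \<in> space (limit_law m). snd \<omega> \<in> A \<and> fst \<omega> \<in> B} =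
    (\<integral>\<^sup>+k\<in>B. ?b k \<partial>distr (limit_law m) (count_space {0..m}) fst)" .
qed

lemma count_proportion_measurable:
  fixes f :: "nat \<times> real \<Rightarrow> real"
  assumes "continuous_on ({0..m} \<times> {0..1}) f"
  shows "f \<in> borel_measurable (count_proportion_space m)"
  unfolding count_proportion_space_def
proof (rule measurable_pair_measure_countable1)
  fix k assume "k \<in> {0..m}"
  hence "continuous_on {0..1} (\<lambda>x. f (k, x))"
    by (intro continuous_on_compose2[OF assms]) (auto intro!: continuous_intros)
  thus "(\<lambda>x. f (k, x)) \<in> borel_measurable (restrict_space borel {0..1})"
    by (rule borel_measurable_continuous_on_restrict)
qed simp

lemma integral_limit_law:
  fixes f :: "nat \<times> real \<Rightarrow> real"
  assumes cont: "continuous_on ({0..m} \<times> {0..1}) f" and bdd: "bounded (f ` ({0..m} \<times> {0..1}))"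
  shows "(\<integral>\<omega>. f \<omega> \<partial>limit_law m) = (\<Sum>k\<le>m. density_integral m k (\<lambda>x. f (k, x)))"
proof -
  interpret P: prob_space "limit_law m" by (rule prob_space_limit_law)
  let ?L = "restrict_space lborel {0..1::real}"
  let ?P = "count_space {0..m} \<Otimes>\<^sub>M ?L"
  interpret L: sigma_finite_measure ?L by (rule sigma_finite_unit_interval)
  interpret C: sigma_finite_measure "count_space {0..m}" by (rule sigma_finite_measure_count_space_finite) simp
  interpret PL: pair_sigma_finite "count_space {0..m}" ?L ..
  have meas: "f \<in> borel_measurable (limit_law m)"
    using count_proportion_measurable[OF cont]
    by (subst measurable_cong_sets[OF sets_limit_law refl]) (simp add: count_proportion_space_def)
  have [measurable]: "f \<in> borel_measurable ?P" using meas by (simp add: limit_law_def)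
  note [measurable] = binomial_weight_measurable[of m]
  obtain B where "\<forall>\<omega> \<in> {0..m} \<times> {0..1}. norm (f \<omega>) \<le> B" using bdd by (auto simp: bounded_iff)
  hence "integrable (limit_law m) f"
    by (intro P.integrable_const_bound[of _ B] AE_I2 meas) (auto simp: space_limit_law)
  hence int: "integrable ?P (\<lambda>\<omega>. (\<lambda>(k, x). binomial_weight m k x) \<omega> *\<^sub>R f \<omega>)"
    unfolding limit_law_def case_prod_unfold
    by (subst (asm) integrable_density) (auto simp: space_pair_measure space_restrict_space intro!: AE_I2)
  have "(\<integral>\<omega>. f \<omega> \<partial>limit_law m) = (\<integral>\<omega>. (\<lambda>(k, x). binomial_weight m k x) \<omega> *\<^sub>R f \<omega> \<partial>?P)"
    unfolding limit_law_def case_prod_unfold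
    by (subst integral_density) (auto simp: space_pair_measure space_restrict_space intro!: AE_I2)
  also have "\<dots> = (\<integral>k. \<integral>x. binomial_weight m k x * f (k, x) \<partial>?L \<partial>count_space {0..m})"
    using PL.integral_fst'[OF int] by simp
  also have "\<dots> = (\<Sum>k\<le>m. \<integral>x. binomial_weight m k x * f (k, x) \<partial>?L)"
    by (simp add: lebesgue_integral_count_space_finite atLeast0AtMost)
  also have "\<dots> = (\<Sum>k\<le>m. density_integral m k (\<lambda>x. f (k, x)))"
  proof (rule sum.cong[OF refl])
    fix k assume "k \<in> {..m}"
    hence c: "continuous_on {0..1} (\<lambda>x. f (k, x))"
      by (intro continuous_on_compose2[OF cont]) (auto intro!: continuous_intros)
    have "(\<integral>x. binomial_weight m k x * f (k, x) \<partial>?L) = (LINT x:{0..1}|lborel. f (k, x) * binomial_weight m k x)"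
      by (subst integral_restrict_space) (auto simp: set_lebesgue_integral_def mult_ac)
    also have "\<dots> = density_integral m k (\<lambda>x. f (k, x))"
      unfolding density_integral_def
      by (intro set_borel_integral_eq_integral borel_integrable_atLeastAtMost' continuous_intros c)
    finally show "(\<integral>x. binomial_weight m k x * f (k, x) \<partial>?L) = density_integral m k (\<lambda>x. f (k, x))" .
  qed
  finally show ?thesis .
qed

section \<open>From quasistationary distributions to laws of counts\<close>

text \<open>Absorption times are integers, so exceeding 1 means being at least 2. If consensus is
  never reached, the infimum over the empty set is infinite and the equivalence persists.\<close>

lemma one_less_absorption_time:
  "1 < absorption_time G \<omega> \<longleftrightarrow> invasion 0 \<omega> \<notin> consensus G \<and> invasion 1 \<omega> \<notin> consensus G"
proof
  assume *: "1 < absorption_time G \<omega>"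
  have "invasion t \<omega> \<notin> consensus G" if "t \<le> 1" for t
  proof
    assume "invasion t \<omega> \<in> consensus G"
    hence "absorption_time G \<omega> \<le> enat t" unfolding absorption_time_def by (intro INF_lower) simp
    also have "\<dots> \<le> 1" using that by (simp add: one_enat_def)
    finally show False using * by simp
  qed
  thus "invasion 0 \<omega> \<notin> consensus G \<and> invasion 1 \<omega> \<notin> consensus G" by blast
next
  assume *: "invasion 0 \<omega> \<notin> consensus G \<and> invasion 1 \<omega> \<notin> consensus G"
  have "enat 2 \<le> absorption_time G \<omega>" unfolding absorption_time_def
  proof (rule INF_greatest)
    fix t assume "t \<in> {t. invasion t \<omega> \<in> consensus G}"
    hence "t \<noteq> 0" "t \<noteq> 1" using * by (metis mem_Collect_eq)+
    thus "enat 2 \<le> enat t" by simp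
  qed
  moreover have "(1 :: enat) < enat 2" by (simp add: one_enat_def)
  ultimately show "1 < absorption_time G \<omega>" by (rule less_le_trans[rotated])
qed

lemma finite_configs: "finite (pverts G) \<Longrightarrow> finite (configs G)"
  unfolding configs_def by (intro finite_PiE) auto

lemma sets_stream_space_first:
  "{s \<in> space (stream_space (measure_pmf q)). s !! 0 \<in> B} \<in> sets (stream_space (measure_pmf q))"
proof -
  have "{s \<in> space (stream_space (measure_pmf q)). s !! 0 \<in> B} = (\<lambda>s. s !! 0) -` B \<inter> space (stream_space (measure_pmf q))"
    by auto
  thus ?thesis using measurable_sets[OF measurable_snth[of 0 "measure_pmf q"], of B] by simp
qed

lemma measure_stream_space_first:
  "measure (stream_space (measure_pmf q)) {s \<in> space (stream_space (measure_pmf q)). s !! 0 \<in> B} = measure (measure_pmf q) B"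
proof -
  let ?S = "stream_space (measure_pmf q)"
  interpret S: prob_space ?S by (rule prob_space.prob_space_stream_space[OF measure_pmf.prob_space_axioms])
  have "emeasure ?S {s \<in> space ?S. s !! 0 \<in> B} = (\<integral>\<^sup>+s. indicator {s \<in> space ?S. s !! 0 \<in> B} s \<partial>?S)"
    by (rule nn_integral_indicator[symmetric]) (rule sets_stream_space_first)
  also have "\<dots> = (\<integral>\<^sup>+x. \<integral>\<^sup>+s. indicator {s \<in> space ?S. s !! 0 \<in> B} (x ## s) \<partial>?S \<partial>measure_pmf q)"
    by (rule prob_space.nn_integral_stream_space[OF measure_pmf.prob_space_axioms])
       (rule borel_measurable_indicator sets_stream_space_first)+
  also have "\<dots> = (\<integral>\<^sup>+x. \<integral>\<^sup>+s. indicator B x \<partial>?S \<partial>measure_pmf q)"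
    by (intro nn_integral_cong) (auto simp: indicator_def space_stream_space)
  also have "\<dots> = emeasure (measure_pmf q) B" by (simp add: S.emeasure_space_1)
  finally show ?thesis by (simp add: measure_def)
qed

lemma integral_finite_count_space:
  fixes f :: "'a \<Rightarrow> real"
  assumes "prob_space \<nu>" "sets \<nu> = sets (count_space X)" "finite X"
  shows "(\<integral>\<eta>. f \<eta> \<partial>\<nu>) = (\<Sum>\<eta>\<in>X. measure \<nu> {\<eta>} * f \<eta>)"
proof -
  interpret prob_space \<nu> by fact
  have sp: "space \<nu> = X" using sets_eq_imp_space_eq[OF assms(2)] by simp
  have s: "{c} \<in> sets \<nu>" if "c \<in> X" for c using assms(2) that by simp
  have "(\<integral>\<eta>. f \<eta> \<partial>\<nu>) = (\<integral>\<eta>. (\<Sum>c\<in>X. f c * indicator {c} \<eta>) \<partial>\<nu>)"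
  proof (rule Bochner_Integration.integral_cong[OF refl])
    fix \<eta> assume "\<eta> \<in> space \<nu>"
    hence "(\<Sum>c\<in>X. f c * indicator {c} \<eta>) = (\<Sum>c\<in>{\<eta>}. f c * indicator {c} \<eta>)"
      using assms(3) sp by (intro sum.mono_neutral_right) auto
    thus "f \<eta> = (\<Sum>c\<in>X. f c * indicator {c} \<eta>)" by simp
  qed
  also have "\<dots> = (\<Sum>c\<in>X. \<integral>\<eta>. f c * indicator {c} \<eta> \<partial>\<nu>)"
    using s by (intro Bochner_Integration.integral_sum) (auto simp: less_top[symmetric] intro!: integrable_mult_right)
  also have "\<dots> = (\<Sum>c\<in>X. measure \<nu> {c} * f c)"
    using s sp by (intro sum.cong refl) (auto simp: mult.commute)
  finally show ?thesis .
qed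

lemma measure_invasion_1:
  assumes "prob_space \<nu>" "sets \<nu> = sets (count_space X)" "finite X"
  shows "measure (invasion_space G \<nu>) {\<omega> \<in> space (invasion_space G \<nu>). invasion 1 \<omega> \<in> A} =
    (\<Sum>\<eta>\<in>X. measure \<nu> {\<eta>} * measure (measure_pmf (sample_pair G)) {s. invade s \<eta> \<in> A})"
    (is "measure ?P ?E = _")
    and "{\<omega> \<in> space (invasion_space G \<nu>). invasion 1 \<omega> \<in> A} \<in> sets (invasion_space G \<nu>)"
proof -
  let ?S = "stream_space (measure_pmf (sample_pair G))"
  interpret N: prob_space \<nu> by fact
  interpret S: prob_space ?S by (rule prob_space.prob_space_stream_space[OF measure_pmf.prob_space_axioms])
  interpret P: pair_prob_space \<nu> ?S ..
  have sp: "space \<nu> = X" using sets_eq_imp_space_eq[OF assms(2)] by simp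
  define B where "B = (\<lambda>\<eta>. {s \<in> space ?S. s !! 0 \<in> {s. invade s \<eta> \<in> A}})"
  have Bs: "B \<eta> \<in> sets ?S" for \<eta> unfolding B_def by (rule sets_stream_space_first)
  have E: "?E = (\<Union>\<eta>\<in>X. {\<eta>} \<times> B \<eta>)"
    by (auto simp: invasion_space_def space_pair_measure sp B_def)
  have meas: "{\<eta>} \<times> B \<eta> \<in> sets ?P" if "\<eta> \<in> X" for \<eta>
    unfolding invasion_space_def using that Bs assms(2) by (intro pair_measureI) auto
  show "?E \<in> sets ?P" unfolding E using meas assms(3) by (intro sets.finite_UN) auto
  have "measure ?P ?E = (\<Sum>\<eta>\<in>X. measure ?P ({\<eta>} \<times> B \<eta>))"
    unfolding E using meas assms(3) unfolding invasion_space_def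
    by (intro P.finite_measure_finite_Union) (auto simp: disjoint_family_on_def)
  also have "\<dots> = (\<Sum>\<eta>\<in>X. measure \<nu> {\<eta>} * measure ?S (B \<eta>))"
  proof (rule sum.cong[OF refl])
    fix \<eta> assume "\<eta> \<in> X"
    hence "emeasure ?P ({\<eta>} \<times> B \<eta>) = emeasure \<nu> {\<eta>} * emeasure ?S (B \<eta>)"
      unfolding invasion_space_def using Bs assms(2) by (intro S.emeasure_pair_measure_Times) auto
    thus "measure ?P ({\<eta>} \<times> B \<eta>) = measure \<nu> {\<eta>} * measure ?S (B \<eta>)"
      by (simp add: measure_def enn2real_mult)
  qed
  finally show "measure ?P ?E = (\<Sum>\<eta>\<in>X. measure \<nu> {\<eta>} * measure (measure_pmf (sample_pair G)) {s. invade s \<eta> \<in> A})"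
    unfolding B_def measure_stream_space_first .
qed

text \<open>On survival the configuration at time 1 has law \<open>\<nu>\<close> times the survival
  probability \<open>\<rho>\<close>, and a function vanishing on consensus sees only this
  event.\<close>

lemma quasistationary_expectation:
  fixes G :: "'a pair_pre_digraph"
  assumes qs: "quasistationary G \<nu>" and fin: "finite (pverts G)"
    and valid: "\<And>v u. (v, u) \<in> set_pmf (sample_pair G) \<Longrightarrow> v \<in> pverts G \<and> u \<in> pverts G"
  defines "X \<equiv> configs G - consensus G"
  shows "\<exists>\<rho>. \<rho> \<le> 1 \<and> (\<forall>f :: ('a \<Rightarrow> nat) \<Rightarrow> real. (\<forall>c\<in>consensus G. f c = 0) \<longrightarrow>
    (\<Sum>\<eta>\<in>X. measure \<nu> {\<eta>} * measure_pmf.expectation (sample_pair G) (\<lambda>s. f (invade s \<eta>))) =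
      \<rho> * (\<Sum>\<eta>\<in>X. measure \<nu> {\<eta>} * f \<eta>))"
proof -
  let ?P = "invasion_space G \<nu>" and ?sp = "measure_pmf (sample_pair G)"
  have \<nu>: "prob_space \<nu>" "sets \<nu> = sets (count_space X)"
    and cond: "\<And>A. A \<subseteq> X \<Longrightarrow> \<P>(\<omega> in ?P. invasion 1 \<omega> \<in> A \<bar> absorption_time G \<omega> > 1) = measure \<nu> A"
    using qs by (auto simp: quasistationary_def X_def)
  interpret N: prob_space \<nu> by fact
  interpret S: prob_space "stream_space ?sp" by (rule prob_space.prob_space_stream_space[OF measure_pmf.prob_space_axioms])
  interpret PP: pair_prob_space \<nu> "stream_space ?sp" ..
  interpret P: prob_space ?P unfolding invasion_space_def by (rule PP.prob_space_axioms)
  have finX: "finite X" using finite_configs[OF fin] by (simp add: X_def)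
  have sp: "space \<nu> = X" using sets_eq_imp_space_eq[OF \<nu>(2)] by simp
  have sp': "fst \<omega> \<in> X" if "\<omega> \<in> space ?P" for \<omega>
    using that sp by (auto simp: invasion_space_def space_pair_measure)
  define \<rho> where "\<rho> = measure ?P {\<omega> \<in> space ?P. absorption_time G \<omega> > 1}"
  have ratio: "measure ?P {\<omega> \<in> space ?P. invasion 1 \<omega> \<in> A} / \<rho> = measure \<nu> A" if A: "A \<subseteq> X" for A
  proof -
    \<comment> \<open>Landing in \<open>A\<close> already entails survival, since neither the start
      nor \<open>A\<close> meets consensus.\<close>
    have "{\<omega> \<in> space ?P. invasion 1 \<omega> \<in> A \<and> absorption_time G \<omega> > 1} = {\<omega> \<in> space ?P. invasion 1 \<omega> \<in> A}"
      using A sp' unfolding one_less_absorption_time by (auto simp: X_def)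
    thus ?thesis using cond[OF A] by (simp add: cond_prob_def \<rho>_def)
  qed
  \<comment> \<open>For \<open>\<rho> = 0\<close> the conditional probability of \<open>X\<close>
    would be 0 through division by zero, whereas \<open>\<nu>\<close> gives \<open>X\<close> mass
    1.\<close>
  have "\<rho> \<noteq> 0" using ratio[of X] N.prob_space sp by auto
  hence law: "measure ?P {\<omega> \<in> space ?P. invasion 1 \<omega> \<in> A} = \<rho> * measure \<nu> A" if "A \<subseteq> X" for A
    using ratio[OF that] by (simp add: field_simps)
  show ?thesis
  proof (intro exI conjI allI impI)
    show "\<rho> \<le> 1" by (simp add: \<rho>_def)
    fix f :: "('a \<Rightarrow> nat) \<Rightarrow> real" assume f: "\<forall>c\<in>consensus G. f c = 0"
    have step: "measure_pmf.expectation (sample_pair G) (\<lambda>s. f (invade s \<eta>)) =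
      (\<Sum>c\<in>X. f c * measure ?sp {s. invade s \<eta> \<in> {c}})" if \<eta>: "\<eta> \<in> X" for \<eta>
    proof -
      have "measure_pmf.expectation (sample_pair G) (\<lambda>s. f (invade s \<eta>)) =
        measure_pmf.expectation (sample_pair G) (\<lambda>s. \<Sum>c\<in>X. f c * indicator {s. invade s \<eta> \<in> {c}} s)"
      proof (rule integral_cong_AE)
        show "AE s in ?sp. f (invade s \<eta>) = (\<Sum>c\<in>X. f c * indicator {s. invade s \<eta> \<in> {c}} s)"
        proof (rule AE_pmfI)
          fix s assume "s \<in> set_pmf (sample_pair G)"
          hence "invade s \<eta> \<in> configs G"
            using \<eta> valid[of "fst s" "snd s"] by (cases s) (auto simp: X_def configs_def PiE_iff extensional_def)
          moreover have "f (invade s \<eta>) = (\<Sum>c\<in>X. f c * indicator {s. invade s \<eta> \<in> {c}} s)" if "invade s \<eta> \<in> X"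
          proof -
            have "(\<Sum>c\<in>X. f c * indicator {s. invade s \<eta> \<in> {c}} s) = (\<Sum>c\<in>{invade s \<eta>}. f c * indicator {s. invade s \<eta> \<in> {c}} s)"
              using that finX by (intro sum.mono_neutral_right) auto
            thus ?thesis by simp
          qed
          moreover have "f (invade s \<eta>) = (\<Sum>c\<in>X. f c * indicator {s. invade s \<eta> \<in> {c}} s)" if c: "invade s \<eta> \<in> consensus G"
          proof -
            have "(\<Sum>c\<in>X. f c * indicator {s. invade s \<eta> \<in> {c}} s) = 0"
              using c by (intro sum.neutral) (auto simp: X_def indicator_def)
            thus ?thesis using f c by simp
          qed
          ultimately show "f (invade s \<eta>) = (\<Sum>c\<in>X. f c * indicator {s. invade s \<eta> \<in> {c}} s)"
            unfolding X_def by blast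
        qed
      qed auto
      also have "\<dots> = (\<Sum>c\<in>X. measure_pmf.expectation (sample_pair G) (\<lambda>s. f c * indicator {s. invade s \<eta> \<in> {c}} s))"
        by (intro Bochner_Integration.integral_sum) (auto intro!: integrable_mult_right simp: less_top[symmetric])
      finally show ?thesis by simp
    qed
    have "(\<Sum>\<eta>\<in>X. measure \<nu> {\<eta>} * measure_pmf.expectation (sample_pair G) (\<lambda>s. f (invade s \<eta>))) =
      (\<Sum>\<eta>\<in>X. \<Sum>c\<in>X. f c * (measure \<nu> {\<eta>} * measure ?sp {s. invade s \<eta> \<in> {c}}))"
      by (intro sum.cong refl) (simp only: step sum_distrib_left mult.left_commute)
    also have "\<dots> = (\<Sum>c\<in>X. f c * (\<Sum>\<eta>\<in>X. measure \<nu> {\<eta>} * measure ?sp {s. invade s \<eta> \<in> {c}}))"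
      unfolding sum_distrib_left by (rule sum.swap)
    also have "\<dots> = (\<Sum>c\<in>X. f c * (\<rho> * measure \<nu> {c}))"
      by (intro sum.cong refl arg_cong2[where f = "(*)"])
         (subst measure_invasion_1(1)[OF \<nu> finX, symmetric], rule law, simp)
    finally show "(\<Sum>\<eta>\<in>X. measure \<nu> {\<eta>} * measure_pmf.expectation (sample_pair G) (\<lambda>s. f (invade s \<eta>))) =
      \<rho> * (\<Sum>\<eta>\<in>X. measure \<nu> {\<eta>} * f \<eta>)"
      by (simp add: sum_distrib_left mult_ac)
  qed
qed

section \<open>The chain of counts on the complete bipartite graph\<close>

lemma neighbours_complete_bipartite:
  "v \<in> part_S m \<Longrightarrow> neighbours (complete_bipartite m n) v = part_L n"
  "v \<in> part_L n \<Longrightarrow> neighbours (complete_bipartite m n) v = part_S m"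
  by (auto simp: neighbours_def complete_bipartite_def part_S_def part_L_def)

lemma bipartite_parts:
  "finite (part_S m)" "finite (part_L n)" "card (part_S m) = m" "card (part_L n) = n" "part_S m \<inter> part_L n = {}"
  by (auto simp: part_S_def part_L_def card_image)

lemma expectation_sample_pair:
  fixes h :: "(nat + nat) \<times> (nat + nat) \<Rightarrow> real"
  assumes "m > 0" "n > 0"
  shows "measure_pmf.expectation (sample_pair (complete_bipartite m n)) h =
    ((\<Sum>v\<in>part_S m. \<Sum>u\<in>part_L n. h (v, u)) / real n + (\<Sum>v\<in>part_L n. \<Sum>u\<in>part_S m. h (v, u)) / real m) / real (m + n)"
    and "(v, u) \<in> set_pmf (sample_pair (complete_bipartite m n)) \<Longrightarrow>
      v \<in> pverts (complete_bipartite m n) \<and> u \<in> pverts (complete_bipartite m n)"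
proof -
  let ?G = "complete_bipartite m n" and ?V = "part_S m \<union> part_L n"
  have V: "pverts ?G = ?V" by (simp add: complete_bipartite_def)
  have cV: "card ?V = m + n" by (simp add: card_Un_disjoint bipartite_parts)
  have ne: "part_S m \<noteq> {}" "part_L n \<noteq> {}" using assms by (auto simp: part_S_def part_L_def)
  have nb: "finite (neighbours ?G v)" "neighbours ?G v \<noteq> {}" "neighbours ?G v \<subseteq> ?V" if "v \<in> ?V" for v
    using that ne by (auto simp: neighbours_complete_bipartite bipartite_parts)
  have inner: "measure_pmf.expectation (pmf_of_set (neighbours ?G v) \<bind> (\<lambda>u. return_pmf (v, u))) h =
    (\<Sum>u\<in>neighbours ?G v. h (v, u)) / real (card (neighbours ?G v))" if "v \<in> ?V" for v
    by (subst pmf_expectation_bind_pmf_of_set) (use nb[OF that] in \<open>auto simp: sum_distrib_left divide_inverse_commute\<close>)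
  have "measure_pmf.expectation (sample_pair ?G) h =
    (\<Sum>v\<in>?V. measure_pmf.expectation (pmf_of_set (neighbours ?G v) \<bind> (\<lambda>u. return_pmf (v, u))) h /\<^sub>R real (card ?V))"
    unfolding sample_pair_def V
    by (rule pmf_expectation_bind_pmf_of_set) (use ne nb in \<open>auto simp: bipartite_parts\<close>)
  also have "\<dots> = (\<Sum>v\<in>?V. (\<Sum>u\<in>neighbours ?G v. h (v, u)) / real (card (neighbours ?G v)) / real (m + n))"
    unfolding cV by (intro sum.cong refl) (simp only: inner real_scaleR_def divide_inverse_commute)
  also have "\<dots> = (\<Sum>v\<in>?V. (\<Sum>u\<in>neighbours ?G v. h (v, u)) / real (card (neighbours ?G v))) / real (m + n)"
    by (rule sum_divide_distrib[symmetric])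
  also have "(\<Sum>v\<in>?V. (\<Sum>u\<in>neighbours ?G v. h (v, u)) / real (card (neighbours ?G v))) =
    (\<Sum>v\<in>part_S m. (\<Sum>u\<in>part_L n. h (v, u)) / real n) + (\<Sum>v\<in>part_L n. (\<Sum>u\<in>part_S m. h (v, u)) / real m)"
    by (subst sum.union_disjoint) (auto simp: bipartite_parts neighbours_complete_bipartite)
  finally show "measure_pmf.expectation (sample_pair ?G) h =
    ((\<Sum>v\<in>part_S m. \<Sum>u\<in>part_L n. h (v, u)) / real n + (\<Sum>v\<in>part_L n. \<Sum>u\<in>part_S m. h (v, u)) / real m) / real (m + n)"
    by (simp add: sum_divide_distrib)
  assume "(v, u) \<in> set_pmf (sample_pair ?G)"
  thus "v \<in> pverts ?G \<and> u \<in> pverts ?G"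
    unfolding sample_pair_def V using ne nb by (auto simp: bipartite_parts)
qed

text \<open>The difference of two opinions is 1 or -1 according to which end holds the 1; both
  indicators are products of a function of \<open>v\<close> and one of \<open>u\<close>, so the
  double sum factorises into counts.\<close>

lemma sum_pair_opinions:
  fixes \<eta> :: "'a \<Rightarrow> nat" and \<phi> :: "real \<Rightarrow> real"
  assumes "\<And>v. v \<in> S \<union> L \<Longrightarrow> \<eta> v \<in> {0, 1}" and fin: "finite S" "finite L" and "\<phi> 0 = 0"
  shows "(\<Sum>v\<in>S. \<Sum>u\<in>L. \<phi> (real (\<eta> v) - real (\<eta> u))) =
    real (\<Sum>v\<in>S. \<eta> v) * (real (card L) - real (\<Sum>u\<in>L. \<eta> u)) * \<phi> 1 +
    (real (card S) - real (\<Sum>v\<in>S. \<eta> v)) * real (\<Sum>u\<in>L. \<eta> u) * \<phi> (- 1)"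
proof -
  have "(\<Sum>v\<in>S. \<Sum>u\<in>L. \<phi> (real (\<eta> v) - real (\<eta> u))) =
    (\<Sum>v\<in>S. \<Sum>u\<in>L. real (\<eta> v) * (1 - real (\<eta> u)) * \<phi> 1 + (1 - real (\<eta> v)) * real (\<eta> u) * \<phi> (- 1))"
  proof (intro sum.cong refl)
    fix v u assume "v \<in> S" "u \<in> L"
    thus "\<phi> (real (\<eta> v) - real (\<eta> u)) = real (\<eta> v) * (1 - real (\<eta> u)) * \<phi> 1 + (1 - real (\<eta> v)) * real (\<eta> u) * \<phi> (- 1)"
      using assms(1)[of v] assms(1)[of u] assms(4) by auto
  qed
  also have "\<dots> = (\<Sum>v\<in>S. real (\<eta> v)) * (\<Sum>u\<in>L. 1 - real (\<eta> u)) * \<phi> 1 + (\<Sum>v\<in>S. 1 - real (\<eta> v)) * (\<Sum>u\<in>L. real (\<eta> u)) * \<phi> (- 1)"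
    by (simp only: sum.distrib sum_product) (simp only: sum_distrib_right)
  also have "\<dots> = real (\<Sum>v\<in>S. \<eta> v) * (real (card L) - real (\<Sum>u\<in>L. \<eta> u)) * \<phi> 1 +
    (real (card S) - real (\<Sum>v\<in>S. \<eta> v)) * real (\<Sum>u\<in>L. \<eta> u) * \<phi> (- 1)"
    by (simp add: sum_subtractf)
  finally show ?thesis .
qed

lemma sum_update_opinion:
  fixes \<eta> :: "'a \<Rightarrow> nat"
  assumes "finite T"
  shows "u \<in> T \<Longrightarrow> real (\<Sum>w\<in>T. (\<eta>(u := c)) w) = real (\<Sum>w\<in>T. \<eta> w) + (real c - real (\<eta> u))"
    and "u \<notin> T \<Longrightarrow> (\<Sum>w\<in>T. (\<eta>(u := c)) w) = (\<Sum>w\<in>T. \<eta> w)"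
proof -
  assume u: "u \<in> T"
  have "(\<Sum>w\<in>T - {u}. (\<eta>(u := c)) w) = (\<Sum>w\<in>T - {u}. \<eta> w)" by (intro sum.cong) auto
  thus "real (\<Sum>w\<in>T. (\<eta>(u := c)) w) = real (\<Sum>w\<in>T. \<eta> w) + (real c - real (\<eta> u))"
    using sum.remove[OF assms u, of "\<eta>(u := c)"] sum.remove[OF assms u, of \<eta>] by simp
next
  assume "u \<notin> T"
  thus "(\<Sum>w\<in>T. (\<eta>(u := c)) w) = (\<Sum>w\<in>T. \<eta> w)" by (intro sum.cong) auto
qed

definition ones_S :: "nat \<Rightarrow> (nat + nat \<Rightarrow> nat) \<Rightarrow> nat" where
  "ones_S m \<eta> = (\<Sum>u\<in>part_S m. \<eta> u)"

definition ones_L :: "nat \<Rightarrow> (nat + nat \<Rightarrow> nat) \<Rightarrow> nat" where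
  "ones_L n \<eta> = (\<Sum>u\<in>part_L n. \<eta> u)"

text \<open>Every new value is the current one plus an increment. The \<open>m * n\<close> pairs of
  each direction, divided by \<open>n\<close> and by \<open>m\<close>, contribute
  \<open>f \<eta>\<close> with total weight \<open>m + n\<close>, and the increments give the four
  jump rates.\<close>

lemma expectation_invade:
  fixes g :: "real \<Rightarrow> real \<Rightarrow> real"
  assumes "m > 0" "n > 0" and \<eta>: "\<eta> \<in> configs (complete_bipartite m n)"
  defines "f \<equiv> \<lambda>\<eta>. g (real (ones_S m \<eta>)) (real (ones_L n \<eta>))"
  shows "real (m + n) * (measure_pmf.expectation (sample_pair (complete_bipartite m n)) (\<lambda>s. f (invade s \<eta>)) - f \<eta>) =
    generator m n g (real (ones_S m \<eta>)) (real (ones_L n \<eta>))"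
proof -
  define K L where "K = real (ones_S m \<eta>)" and "L = real (ones_L n \<eta>)"
  have 01: "\<eta> v \<in> {0, 1}" if "v \<in> part_S m \<union> part_L n" for v
    using \<eta> that by (auto simp: configs_def complete_bipartite_def)
  have sym01: "\<eta> v \<in> {0, 1}" if "v \<in> part_L n \<union> part_S m" for v
    using 01[of v] that by blast
  have f0: "f \<eta> = g K L" by (simp add: f_def K_def L_def)
  have SL: "f (invade (v, u) \<eta>) = f \<eta> + (g K (L + (real (\<eta> v) - real (\<eta> u))) - g K L)"
    if "v \<in> part_S m" "u \<in> part_L n" for v u
  proof -
    have "u \<notin> part_S m" using that bipartite_parts(5)[of m n] by blast
    thus ?thesis using that
      by (simp add: f_def K_def L_def ones_S_def ones_L_def sum_update_opinion bipartite_parts del: fun_upd_apply of_nat_sum)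
  qed
  have LS: "f (invade (v, u) \<eta>) = f \<eta> + (g (K + (real (\<eta> v) - real (\<eta> u))) L - g K L)"
    if "v \<in> part_L n" "u \<in> part_S m" for v u
  proof -
    have "u \<notin> part_L n" using that bipartite_parts(5)[of m n] by blast
    thus ?thesis using that
      by (simp add: f_def K_def L_def ones_S_def ones_L_def sum_update_opinion bipartite_parts del: fun_upd_apply of_nat_sum)
  qed
  have 1: "(\<Sum>v\<in>part_S m. \<Sum>u\<in>part_L n. f (invade (v, u) \<eta>)) = real m * real n * f \<eta> +
    (K * (real n - L) * (g K (L + 1) - g K L) + (real m - K) * L * (g K (L - 1) - g K L))"
  proof -
    have "(\<Sum>v\<in>part_S m. \<Sum>u\<in>part_L n. f (invade (v, u) \<eta>)) =
      (\<Sum>v\<in>part_S m. \<Sum>u\<in>part_L n. f \<eta> + (g K (L + (real (\<eta> v) - real (\<eta> u))) - g K L))"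
      by (intro sum.cong refl SL)
    also have "\<dots> = real m * real n * f \<eta> + (\<Sum>v\<in>part_S m. \<Sum>u\<in>part_L n. (g K (L + (real (\<eta> v) - real (\<eta> u))) - g K L))"
      by (simp only: sum.distrib sum_constant bipartite_parts)
    also have "(\<Sum>v\<in>part_S m. \<Sum>u\<in>part_L n. (g K (L + (real (\<eta> v) - real (\<eta> u))) - g K L)) =
      K * (real n - L) * (g K (L + 1) - g K L) + (real m - K) * L * (g K (L - 1) - g K L)"
      using sum_pair_opinions[of "part_S m" "part_L n" \<eta> "\<lambda>d. g K (L + d) - g K L"] 01
      by (simp add: bipartite_parts K_def L_def ones_S_def ones_L_def del: of_nat_sum)
    finally show ?thesis .
  qed
  have 2: "(\<Sum>v\<in>part_L n. \<Sum>u\<in>part_S m. f (invade (v, u) \<eta>)) = real n * real m * f \<eta> +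
    (L * (real m - K) * (g (K + 1) L - g K L) + (real n - L) * K * (g (K - 1) L - g K L))"
  proof -
    have "(\<Sum>v\<in>part_L n. \<Sum>u\<in>part_S m. f (invade (v, u) \<eta>)) =
      (\<Sum>v\<in>part_L n. \<Sum>u\<in>part_S m. f \<eta> + (g (K + (real (\<eta> v) - real (\<eta> u))) L - g K L))"
      by (intro sum.cong refl LS)
    also have "\<dots> = real n * real m * f \<eta> + (\<Sum>v\<in>part_L n. \<Sum>u\<in>part_S m. (g (K + (real (\<eta> v) - real (\<eta> u))) L - g K L))"
      by (simp only: sum.distrib sum_constant bipartite_parts)
    also have "(\<Sum>v\<in>part_L n. \<Sum>u\<in>part_S m. (g (K + (real (\<eta> v) - real (\<eta> u))) L - g K L)) =
      L * (real m - K) * (g (K + 1) L - g K L) + (real n - L) * K * (g (K - 1) L - g K L)"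
      using sum_pair_opinions[of "part_L n" "part_S m" \<eta> "\<lambda>d. g (K + d) L - g K L"] sym01
      by (simp add: bipartite_parts K_def L_def ones_S_def ones_L_def del: of_nat_sum)
    finally show ?thesis .
  qed
  have "real (m + n) * measure_pmf.expectation (sample_pair (complete_bipartite m n)) (\<lambda>s. f (invade s \<eta>)) =
    (\<Sum>v\<in>part_S m. \<Sum>u\<in>part_L n. f (invade (v, u) \<eta>)) / real n + (\<Sum>v\<in>part_L n. \<Sum>u\<in>part_S m. f (invade (v, u) \<eta>)) / real m"
    using assms(1) by (subst expectation_sample_pair(1)[OF assms(1,2)]) (simp del: invade.simps)
  also have "\<dots> = real (m + n) * f \<eta> + generator m n g K L"
    unfolding 1 2 generator_def using assms(1,2) by (simp add: add_divide_distrib distrib_right)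
  finally show ?thesis by (simp add: K_def L_def right_diff_distrib)
qed

definition count_weight :: "nat \<Rightarrow> nat \<Rightarrow> (nat + nat \<Rightarrow> nat) measure \<Rightarrow> nat \<Rightarrow> nat \<Rightarrow> real" where
  "count_weight m n \<nu> k l =
    (\<Sum>\<eta>\<in>configs (complete_bipartite m n) - consensus (complete_bipartite m n).
      if ones_S m \<eta> = k \<and> ones_L n \<eta> = l then measure \<nu> {\<eta>} else 0)"

lemma ones_le:
  assumes "\<eta> \<in> configs (complete_bipartite m n)"
  shows "ones_S m \<eta> \<le> m" "ones_L n \<eta> \<le> n"
proof -
  have 01: "\<eta> v \<le> 1" if "v \<in> part_S m \<union> part_L n" for v
  proof -
    have "\<eta> v \<in> {0, 1}" using assms that by (auto simp: configs_def complete_bipartite_def)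
    thus ?thesis by auto
  qed
  show "ones_S m \<eta> \<le> m" using sum_bounded_above[of "part_S m" \<eta> 1] 01 by (simp add: ones_S_def bipartite_parts)
  show "ones_L n \<eta> \<le> n" using sum_bounded_above[of "part_L n" \<eta> 1] 01 by (simp add: ones_L_def bipartite_parts)
qed

lemma finite_configs_bipartite: "finite (configs (complete_bipartite m n))"
  by (rule finite_configs) (simp add: complete_bipartite_def bipartite_parts)

lemma sum_count_weight:
  "(\<Sum>k\<le>m. \<Sum>l\<le>n. count_weight m n \<nu> k l * F k l) =
    (\<Sum>\<eta>\<in>configs (complete_bipartite m n) - consensus (complete_bipartite m n). measure \<nu> {\<eta>} * F (ones_S m \<eta>) (ones_L n \<eta>))"
proof -
  let ?X = "configs (complete_bipartite m n) - consensus (complete_bipartite m n)"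
  have "(\<Sum>k\<le>m. \<Sum>l\<le>n. count_weight m n \<nu> k l * F k l) =
    (\<Sum>k\<le>m. \<Sum>l\<le>n. \<Sum>\<eta>\<in>?X. if ones_S m \<eta> = k then (if ones_L n \<eta> = l then measure \<nu> {\<eta>} * F k l else 0) else 0)"
    unfolding count_weight_def sum_distrib_right by (intro sum.cong refl) auto
  also have "\<dots> = (\<Sum>k\<le>m. \<Sum>\<eta>\<in>?X. \<Sum>l\<le>n. if ones_S m \<eta> = k then (if ones_L n \<eta> = l then measure \<nu> {\<eta>} * F k l else 0) else 0)"
    by (intro sum.cong refl sum.swap)
  also have "\<dots> = (\<Sum>\<eta>\<in>?X. \<Sum>k\<le>m. \<Sum>l\<le>n. if ones_S m \<eta> = k then (if ones_L n \<eta> = l then measure \<nu> {\<eta>} * F k l else 0) else 0)"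
    by (rule sum.swap)
  also have "\<dots> = (\<Sum>\<eta>\<in>?X. measure \<nu> {\<eta>} * F (ones_S m \<eta>) (ones_L n \<eta>))"
  proof (rule sum.cong[OF refl])
    fix \<eta> assume "\<eta> \<in> ?X"
    hence "ones_S m \<eta> \<le> m" "ones_L n \<eta> \<le> n" using ones_le by auto
    moreover have "(\<Sum>l\<le>n. if ones_S m \<eta> = k then (if ones_L n \<eta> = l then measure \<nu> {\<eta>} * F k l else 0) else 0) =
      (if ones_S m \<eta> = k then (\<Sum>l\<le>n. if ones_L n \<eta> = l then measure \<nu> {\<eta>} * F k l else 0) else 0)" for k
      by simp
    ultimately show "(\<Sum>k\<le>m. \<Sum>l\<le>n. if ones_S m \<eta> = k then (if ones_L n \<eta> = l then measure \<nu> {\<eta>} * F k l else 0) else 0) =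
      measure \<nu> {\<eta>} * F (ones_S m \<eta>) (ones_L n \<eta>)"
      by (simp add: sum.delta')
  qed
  finally show ?thesis .
qed

lemma ones_consensus:
  assumes "c \<in> consensus (complete_bipartite m n)"
  shows "ones_S m c = 0 \<and> ones_L n c = 0 \<or> ones_S m c = m \<and> ones_L n c = n"
proof -
  obtain a where "c = (\<lambda>v\<in>part_S m \<union> part_L n. a)" "a = 0 \<or> a = 1"
    using assms by (auto simp: consensus_def complete_bipartite_def)
  thus ?thesis by (auto simp: ones_S_def ones_L_def bipartite_parts)
qed

lemma consensus_ones:
  assumes \<eta>: "\<eta> \<in> configs (complete_bipartite m n)"
    and "ones_S m \<eta> = 0 \<and> ones_L n \<eta> = 0 \<or> ones_S m \<eta> = m \<and> ones_L n \<eta> = n"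
  shows "\<eta> \<in> consensus (complete_bipartite m n)"
proof -
  let ?V = "part_S m \<union> part_L n"
  have 01: "\<eta> v = 0 \<or> \<eta> v = 1" if "v \<in> ?V" for v
    using \<eta> that by (fastforce simp: configs_def complete_bipartite_def)
  have sum: "ones_S m \<eta> + ones_L n \<eta> = (\<Sum>v\<in>?V. \<eta> v)"
    by (simp add: ones_S_def ones_L_def sum.union_disjoint bipartite_parts)
  have "\<exists>a\<in>{0, 1}. \<forall>v\<in>?V. \<eta> v = a"
    using assms(2)
  proof
    assume "ones_S m \<eta> = 0 \<and> ones_L n \<eta> = 0"
    hence "(\<Sum>v\<in>?V. \<eta> v) = 0" using sum by simp
    thus ?thesis by (auto simp: bipartite_parts)
  next
    assume "ones_S m \<eta> = m \<and> ones_L n \<eta> = n"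
    hence "(\<Sum>v\<in>?V. \<eta> v) = card ?V" using sum by (simp add: card_Un_disjoint bipartite_parts)
    \<comment> \<open>Complementing opinions turns the maximal sum into a vanishing one; truncated
      subtraction is exact here because opinions are 0 or 1.\<close>
    moreover have "(\<Sum>v\<in>?V. \<eta> v) + (\<Sum>v\<in>?V. 1 - \<eta> v) = (\<Sum>v\<in>?V. 1)"
      unfolding sum.distrib[symmetric] by (intro sum.cong refl) (use 01 in fastforce)
    ultimately have "(\<Sum>v\<in>?V. 1 - \<eta> v) = 0" by simp
    hence "\<forall>v\<in>?V. 1 - \<eta> v = 0" by (simp add: bipartite_parts)
    hence "\<forall>v\<in>?V. \<eta> v = 1" using 01 by force
    thus ?thesis by blast
  qed
  then obtain a where a: "a \<in> {0, 1}" "\<forall>v\<in>?V. \<eta> v = a" by blast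
  have "\<eta> = (\<lambda>v\<in>?V. a)"
    using a \<eta> by (auto simp: fun_eq_iff configs_def complete_bipartite_def PiE_iff extensional_def)
  thus ?thesis using a by (auto simp: consensus_def complete_bipartite_def)
qed

lemma quasistationary_qs_law:
  assumes mn: "1 \<le> m" "2 \<le> n" and qs: "quasistationary (complete_bipartite m n) \<nu>"
  shows "\<exists>lam. qs_law m n (count_weight m n \<nu>) lam"
proof -
  let ?G = "complete_bipartite m n"
  let ?X = "configs ?G - consensus ?G"
  have \<nu>: "prob_space \<nu>" "sets \<nu> = sets (count_space ?X)" using qs by (auto simp: quasistationary_def)
  interpret N: prob_space \<nu> by fact
  have finX: "finite ?X" using finite_configs_bipartite by simp
  have mean: "mean m n (count_weight m n \<nu>) \<phi> =
      (\<Sum>\<eta>\<in>?X. measure \<nu> {\<eta>} * \<phi> (real (ones_S m \<eta>)) (real (ones_L n \<eta>)))" for \<phi>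
    unfolding mean_def by (rule sum_count_weight)
  have "finite (pverts ?G)" by (simp add: complete_bipartite_def bipartite_parts)
  from quasistationary_expectation[OF qs this expectation_sample_pair(2)] mn
  obtain \<rho> where \<rho>: "\<rho> \<le> 1" "\<And>f :: (nat + nat \<Rightarrow> nat) \<Rightarrow> real. \<forall>c\<in>consensus ?G. f c = 0 \<Longrightarrow>
    (\<Sum>\<eta>\<in>?X. measure \<nu> {\<eta>} * measure_pmf.expectation (sample_pair ?G) (\<lambda>s. f (invade s \<eta>))) =
      \<rho> * (\<Sum>\<eta>\<in>?X. measure \<nu> {\<eta>} * f \<eta>)"
    by auto
  \<comment> \<open>The factor \<open>m + n\<close> is the one by which the generator rescales
    \<open>P g - g\<close>.\<close>
  have "qs_law m n (count_weight m n \<nu>) (real (m + n) * (1 - \<rho>))"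
  proof
    show "0 \<le> count_weight m n \<nu> k l" for k l unfolding count_weight_def by (intro sum_nonneg) auto
    show "count_weight m n \<nu> 0 0 = 0" "count_weight m n \<nu> m n = 0"
      unfolding count_weight_def by (intro sum.neutral ballI; use consensus_ones[of _ m n] in auto)+
    have "(\<Sum>k\<le>m. \<Sum>l\<le>n. count_weight m n \<nu> k l) = (\<Sum>\<eta>\<in>?X. measure \<nu> {\<eta>})"
      using sum_count_weight[where F = "\<lambda>_ _. 1", of m n \<nu>] by simp
    also have "\<dots> = 1" using integral_finite_count_space[OF \<nu> finX, of "\<lambda>_. 1"] N.prob_space by simp
    finally show "(\<Sum>k\<le>m. \<Sum>l\<le>n. count_weight m n \<nu> k l) = 1" .
    show "0 \<le> real (m + n) * (1 - \<rho>)" using \<rho>(1) by simp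
    fix g :: "real \<Rightarrow> real \<Rightarrow> real" assume g: "g 0 0 = 0" "g (real m) (real n) = 0"
    define f where "f = (\<lambda>\<eta>. g (real (ones_S m \<eta>)) (real (ones_L n \<eta>)))"
    let ?e = "\<lambda>\<eta>. measure_pmf.expectation (sample_pair ?G) (\<lambda>s. f (invade s \<eta>))"
    have "\<forall>c\<in>consensus ?G. f c = 0" using ones_consensus[of _ m n] g by (fastforce simp: f_def)
    note \<rho>2 = \<rho>(2)[OF this]
    have "mean m n (count_weight m n \<nu>) (generator m n g) = (\<Sum>\<eta>\<in>?X. measure \<nu> {\<eta>} * (real (m + n) * (?e \<eta> - f \<eta>)))"
      unfolding mean f_def using mn by (intro sum.cong refl arg_cong2[where f = "(*)"] expectation_invade[symmetric]) auto
    also have "\<dots> = real (m + n) * ((\<Sum>\<eta>\<in>?X. measure \<nu> {\<eta>} * ?e \<eta>) - (\<Sum>\<eta>\<in>?X. measure \<nu> {\<eta>} * f \<eta>))"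
      by (simp only: sum_subtractf[symmetric] sum_distrib_left right_diff_distrib mult.left_commute)
    also have "\<dots> = - (real (m + n) * (1 - \<rho>)) * mean m n (count_weight m n \<nu>) g"
      unfolding \<rho>2 mean f_def[symmetric] by (simp add: f_def algebra_simps)
    finally show "mean m n (count_weight m n \<nu>) (generator m n g) = - (real (m + n) * (1 - \<rho>)) * mean m n (count_weight m n \<nu>) g" .
  qed (use mn in auto)
  thus ?thesis ..
qed

section \<open>Convergence in distribution\<close>

lemma integral_count_proportion_law:
  fixes f :: "nat \<times> real \<Rightarrow> real"
  assumes qs: "quasistationary (complete_bipartite m n) \<nu>" and f: "f \<in> borel_measurable (count_proportion_space m)"
  shows "(\<integral>\<omega>. f \<omega> \<partial>count_proportion_law m n \<nu>) = (\<Sum>k\<le>m. \<Sum>l\<le>n. count_weight m n \<nu> k l * f (k, real l / real n))"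
proof -
  let ?X = "configs (complete_bipartite m n) - consensus (complete_bipartite m n)"
  let ?h = "\<lambda>\<eta>. (ones_S m \<eta>, real (ones_L n \<eta>) / real n)"
  have \<nu>: "prob_space \<nu>" "sets \<nu> = sets (count_space ?X)" using qs by (auto simp: quasistationary_def)
  have "?h \<eta> \<in> space (count_proportion_space m)" if "\<eta> \<in> ?X" for \<eta>
    using that ones_le[of \<eta> m n] by (auto simp: count_proportion_space_def space_pair_measure space_restrict_space divide_le_eq)
  hence h: "?h \<in> \<nu> \<rightarrow>\<^sub>M count_proportion_space m"
    by (subst measurable_cong_sets[OF \<nu>(2) refl]) simp
  have "(\<integral>\<omega>. f \<omega> \<partial>count_proportion_law m n \<nu>) = (\<integral>\<eta>. f (?h \<eta>) \<partial>\<nu>)"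
    using integral_distr[OF h f] by (simp add: count_proportion_law_def ones_S_def ones_L_def)
  also have "\<dots> = (\<Sum>\<eta>\<in>?X. measure \<nu> {\<eta>} * f (?h \<eta>))"
    using finite_configs_bipartite by (intro integral_finite_count_space \<nu>) auto
  also have "\<dots> = (\<Sum>k\<le>m. \<Sum>l\<le>n. count_weight m n \<nu> k l * f (k, real l / real n))"
    by (rule sum_count_weight[symmetric])
  finally show ?thesis .
qed

theorem theorem1:
  fixes m :: nat and \<nu> :: "nat \<Rightarrow> (nat + nat \<Rightarrow> nat) measure"
  assumes m: "m \<ge> 1"
    and qsd: "\<And>n. 2 \<le> m \<and> m \<le> n \<or> m = 1 \<and> 3 \<le> n \<Longrightarrow>
                quasistationary (complete_bipartite m n) (\<nu> n)"
  shows "prob_space (limit_law m) \<and>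
    converges_in_distribution_on ({0..m} \<times> {0..1})
      (\<lambda>n. count_proportion_law m n (\<nu> n)) (limit_law m) \<and>
    distr (limit_law m) (count_space UNIV) fst = measure_pmf (pmf_of_set {0..m}) \<and>
    distr (limit_law m) borel snd = uniform_measure lborel {0..1} \<and>
    conditional_distribution (limit_law m)
      (count_space UNIV) fst (restrict_space borel {0..1}) snd
      (\<lambda>x. measure_pmf (binomial_pmf m x)) \<and>
    conditional_distribution (limit_law m)
      borel snd (count_space {0..m}) fst
      (\<lambda>k. beta_distribution (real k + 1) (real m - real k + 1))"
proof (intro conjI prob_space_limit_law distr_limit_law_fst distr_limit_law_snd
    conditional_distribution_binomial conditional_distribution_beta)
  \<comment> \<open>The threshold \<open>m + 3\<close> meets both alternatives of the hypothesis:
    \<open>m \<le> n\<close> for \<open>m \<ge> 2\<close>, and \<open>3 \<le> n\<close> for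
    \<open>m = 1\<close>.\<close>
  have qsn: "quasistationary (complete_bipartite m n) (\<nu> n)" if "m + 3 \<le> n" for n
    by (rule qsd) (use that m in linarith)
  \<comment> \<open>The killing rates are selected for all \<open>n\<close> at once; below the
    threshold their values are arbitrary.\<close>
  have "\<forall>n. \<exists>lam. m + 3 \<le> n \<longrightarrow> qs_law m n (count_weight m n (\<nu> n)) lam"
    using quasistationary_qs_law[OF m _ qsn] by simp
  then obtain lam where lam: "\<And>n. m + 3 \<le> n \<Longrightarrow> qs_law m n (count_weight m n (\<nu> n)) (lam n)" by metis
  interpret qs_sequence m "\<lambda>n. count_weight m n (\<nu> n)" lam
  proof
    show "\<forall>\<^sub>F n in sequentially. qs_law m n (count_weight m n (\<nu> n)) (lam n)"
      using eventually_ge_at_top[of "m + 3"] by eventually_elim (rule lam)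
  qed (rule m)
  show "converges_in_distribution_on ({0..m} \<times> {0..1}) (\<lambda>n. count_proportion_law m n (\<nu> n)) (limit_law m)"
    unfolding converges_in_distribution_on_def
  proof (intro allI impI)
    fix f :: "nat \<times> real \<Rightarrow> real"
    assume cont: "continuous_on ({0..m} \<times> {0..1}) f" and bdd: "bounded (f ` ({0..m} \<times> {0..1}))"
    \<comment> \<open>The first coordinate takes finitely many values, so convergence is checked
      fibre by fibre.\<close>
    have "(\<lambda>n. \<Sum>k\<le>m. \<Sum>l\<le>n. count_weight m n (\<nu> n) k l * f (k, real l / real n)) \<longlonglongrightarrow>
      (\<Sum>k\<le>m. density_integral m k (\<lambda>x. f (k, x)))"
    proof (rule tendsto_sum)
      fix k assume "k \<in> {..m}"
      thus "(\<lambda>n. \<Sum>l\<le>n. count_weight m n (\<nu> n) k l * f (k, real l / real n)) \<longlonglongrightarrow> density_integral m k (\<lambda>x. f (k, x))"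
        by (intro fibre_tendsto continuous_on_compose2[OF cont]) (auto intro!: continuous_intros)
    qed
    moreover have "\<forall>\<^sub>F n in sequentially. (\<Sum>k\<le>m. \<Sum>l\<le>n. count_weight m n (\<nu> n) k l * f (k, real l / real n)) =
        (\<integral>\<omega>. f \<omega> \<partial>count_proportion_law m n (\<nu> n))"
      using eventually_ge_at_top[of "m + 3"]
      by eventually_elim (simp add: integral_count_proportion_law[OF qsn count_proportion_measurable[OF cont]])
    ultimately show "(\<lambda>n. \<integral>\<omega>. f \<omega> \<partial>count_proportion_law m n (\<nu> n)) \<longlonglongrightarrow> (\<integral>\<omega>. f \<omega> \<partial>limit_law m)"
      unfolding integral_limit_law[OF cont bdd] by (rule Lim_transform_eventually)
  qed
qed

end
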